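(* Let $k$ be a field of characteristic zero, $n\ge1$, $A=A_n(k)$ the $n$-th Weyl algebra over $k$, and let $M$ be a holonomic $A$-bimodule. Then the dual bimodule $\mathrm{Hom}(M,A)$ is finitely generated as a right $A$-module and holonomic as a bimodule over $A$.
   Context: For a field $k$, the Weyl algebra $A_n(k)$ is the $k$-algebra generated by $x_1,\dots,x_n,\partial_1,\dots,\partial_n$ with relations $[x_i,x_j]=0$, $[\partial_i,\partial_j]=0$, $[\partial_i,x_j]=\delta_{ij}$. The monomials $x^\alpha\partial^\beta$ ($\alpha,\beta\in\mathbb{N}^n$) form a $k$-basis; the degree of $x^\alpha\partial^\beta$ is $|\alpha|+|\beta|$, and $B^n_m$ denotes the $k$-span of monomials of degree $\le m$ (Bernstein filtration). A bimodule over a $k$-algebra $A$ is a $k$-vector space $M$ with left and right $A$-module structures compatible with the $k$-vector space structure such that $(a_1m)a_2=a_1(ma_2)$. Bimodules over $A_n(k)$ are identified with left $A_{2n}(k)$-modules via $x_i\cdot m=x_im$, $\partial_i\cdot m=\partial_i m$, $x_{n+i}\cdot m=mx_i$, $\partial_{n+i}\cdot m=-m\partial_i$ for $1\le i\le n$. For bimodules $M,N$ over $A$, $\mathrm{Hom}(M,N)$ denotes the set of left $A$-module homomorphisms $M\to N$, which is an $A$-bimodule via $(a\varphi s)(x)=\varphi(xa)s$ for $a,s\in A$, $x\in M$. For $k$ of characteristic zero and a finitely generated left $A_N(k)$-module $M\ne0$ with finite generating set $m_1,\dots,m_r$, put $\Gamma_i=B^N_im_1+\cdots+B^N_im_r$.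 For $i\gg0$, $\dim_k\Gamma_i$ equals $p(i)$ for a polynomial $p=\frac{e}{d!}x^d+\cdots$, where $d=\dim(M)$ (the dimension) and $e$ are independent of the choice of generators. $M$ is called holonomic if it is finitely generated and either $M=0$ or $\dim(M)=N$. A bimodule over $A_n(k)$ is called holonomic if it is holonomic as a left $A_{2n}(k)$-module. *)

theory Defs
  imports
    Complex_Main
    "HOL-Library.Cardinality"
    "HOL-Library.Poly_Mapping"
    "HOL-Library.Function_Algebras"
    "HOL-Computational_Algebra.Polynomial"
begin

section \<open>The free algebra on the symbols of the Weyl algebra\<close>

datatype 'n gen = GenX 'n | GenD 'n

datatype 'g word = Word (letters: "'g list")

instantiation word :: (type) monoid_add
begin

definition zero_word :: "'g word" where
  "zero_word = Word []"

definition plus_word :: "'g word \<Rightarrow> 'g word \<Rightarrow> 'g word" where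
  "plus_word u v = Word (letters u @ letters v)"

instance
  by standard (simp_all add: zero_word_def plus_word_def)

end

text \<open>
  Since \<^typ>\<open>'g word\<close> is the free monoid on \<^typ>\<open>'g\<close> (written additively), the ring of finitely
  supported functions on words with the convolution product of \<^theory>\<open>HOL-Library.Poly_Mapping\<close>
  is the free associative unital algebra on \<^typ>\<open>'g\<close>.
\<close>

type_synonym ('g, 'k) free_algebra = "'g word \<Rightarrow>\<^sub>0 'k"

definition free_gen :: "'g \<Rightarrow> ('g, 'k::field) free_algebra" where
  "free_gen g = Poly_Mapping.single (Word [g]) 1"

definition free_const :: "'k \<Rightarrow> ('g, 'k::field) free_algebra" where
  "free_const c = Poly_Mapping.single 0 c"

inductive_set weyl_ideal :: "('n gen, 'k::field) free_algebra set" where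
  comm_x: "free_gen (GenX i) * free_gen (GenX j) - free_gen (GenX j) * free_gen (GenX i) \<in> weyl_ideal"
| comm_d: "free_gen (GenD i) * free_gen (GenD j) - free_gen (GenD j) * free_gen (GenD i) \<in> weyl_ideal"
| comm_dx: "free_gen (GenD i) * free_gen (GenX j) - free_gen (GenX j) * free_gen (GenD i)
    - (if i = j then 1 else 0) \<in> weyl_ideal"
| zero: "0 \<in> weyl_ideal"
| add: "p \<in> weyl_ideal \<Longrightarrow> q \<in> weyl_ideal \<Longrightarrow> p + q \<in> weyl_ideal"
| left_mult: "p \<in> weyl_ideal \<Longrightarrow> q * p \<in> weyl_ideal"
| right_mult: "p \<in> weyl_ideal \<Longrightarrow> p * q \<in> weyl_ideal"

lemma weyl_ideal_uminus: "p \<in> weyl_ideal \<Longrightarrow> - p \<in> weyl_ideal"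
  using weyl_ideal.left_mult[of p "-1"] by simp

lemma weyl_ideal_diff: "p \<in> weyl_ideal \<Longrightarrow> q \<in> weyl_ideal \<Longrightarrow> p - q \<in> weyl_ideal"
  using weyl_ideal.add[of p "- q"] weyl_ideal_uminus by fastforce

subsection \<open>The ideal is proper\<close>

text \<open>
  The ring instance below needs \<open>1 \<noteq> 0\<close> in the quotient.  This is seen by letting the free algebra
  act by differential operators on formal power series, represented as functions on exponents.
\<close>

fun series_gen :: "'n gen \<Rightarrow> (('n \<Rightarrow> nat) \<Rightarrow> 'k::field) \<Rightarrow> ('n \<Rightarrow> nat) \<Rightarrow> 'k" where
  "series_gen (GenX i) f \<alpha> = (if \<alpha> i = 0 then 0 else f (\<alpha>(i := \<alpha> i - 1)))"
| "series_gen (GenD i) f \<alpha> = of_nat (\<alpha> i + 1) * f (\<alpha>(i := \<alpha> i + 1))"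

definition series_word :: "'n gen word \<Rightarrow> (('n \<Rightarrow> nat) \<Rightarrow> 'k::field) \<Rightarrow> ('n \<Rightarrow> nat) \<Rightarrow> 'k" where
  "series_word w = foldr series_gen (letters w)"

definition series_act ::
    "('n gen, 'k::field) free_algebra \<Rightarrow> (('n \<Rightarrow> nat) \<Rightarrow> 'k) \<Rightarrow> ('n \<Rightarrow> nat) \<Rightarrow> 'k" where
  "series_act p f \<alpha> = (\<Sum>w\<in>Poly_Mapping.keys p. Poly_Mapping.lookup p w * series_word w f \<alpha>)"

lemma series_gen_lin:
  "series_gen g (\<lambda>\<alpha>. f \<alpha> + h \<alpha>) = (\<lambda>\<alpha>. series_gen g f \<alpha> + series_gen g h \<alpha>)"
  "series_gen g (\<lambda>\<alpha>. c * f \<alpha>) = (\<lambda>\<alpha>. c * series_gen g f \<alpha>)"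
  by (cases g; force simp: fun_eq_iff algebra_simps)+

lemma series_word_lin:
  "series_word w (\<lambda>\<alpha>. f \<alpha> + h \<alpha>) = (\<lambda>\<alpha>. series_word w f \<alpha> + series_word w h \<alpha>)"
  "series_word w (\<lambda>\<alpha>. c * f \<alpha>) = (\<lambda>\<alpha>. c * series_word w f \<alpha>)"
proof -
  have "foldr series_gen gs (\<lambda>\<alpha>. f \<alpha> + h \<alpha>)
      = (\<lambda>\<alpha>. foldr series_gen gs f \<alpha> + foldr series_gen gs h \<alpha>)" for gs
    by (induction gs) (simp_all add: series_gen_lin)
  then show "series_word w (\<lambda>\<alpha>. f \<alpha> + h \<alpha>) = (\<lambda>\<alpha>. series_word w f \<alpha> + series_word w h \<alpha>)"
    by (simp add: series_word_def)
  have "foldr series_gen gs (\<lambda>\<alpha>. c * f \<alpha>) = (\<lambda>\<alpha>. c * foldr series_gen gs f \<alpha>)" for gs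
    by (induction gs) (simp_all add: series_gen_lin)
  then show "series_word w (\<lambda>\<alpha>. c * f \<alpha>) = (\<lambda>\<alpha>. c * series_word w f \<alpha>)"
    by (simp add: series_word_def)
qed

lemma free_algebra_induct [case_names zero single add]:
  assumes "P 0" and "\<And>w c. P (Poly_Mapping.single w c)"
    and "\<And>p q. P p \<Longrightarrow> P q \<Longrightarrow> P (p + q)"
  shows "P (p :: ('g, 'k::field) free_algebra)"
proof (induction p rule: update_induct)
  case const
  show ?case by (fact assms(1))
next
  case (update f a b)
  have "Poly_Mapping.update a b f = Poly_Mapping.single a b + f"
    using update(1)
    by (intro poly_mapping_eqI)
      (auto simp: lookup_update lookup_add lookup_single when_def in_keys_iff)
  then show ?case using assms(2,3) update(3) by simp
qed

lemma series_act_superset: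
  assumes "finite K" "Poly_Mapping.keys p \<subseteq> K"
  shows "series_act p f \<alpha> = (\<Sum>w\<in>K. Poly_Mapping.lookup p w * series_word w f \<alpha>)"
  unfolding series_act_def
  by (rule sum.mono_neutral_left) (use assms in \<open>auto simp: in_keys_iff\<close>)

lemma series_act_add: "series_act (p + q) f = (\<lambda>\<alpha>. series_act p f \<alpha> + series_act q f \<alpha>)"
proof
  fix \<alpha>
  let ?K = "Poly_Mapping.keys p \<union> Poly_Mapping.keys q"
  show "series_act (p + q) f \<alpha> = series_act p f \<alpha> + series_act q f \<alpha>"
    using keys_add[of p q]
    by (simp add: series_act_superset[of ?K] lookup_add sum.distrib algebra_simps)
qed

lemma series_act_zero [simp]: "series_act 0 f = (\<lambda>_. 0)"
  by (simp add: series_act_def fun_eq_iff)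

lemma series_act_uminus: "series_act (- p) f = (\<lambda>\<alpha>. - series_act p f \<alpha>)"
  using series_act_add[of p "- p" f] by (simp add: fun_eq_iff eq_neg_iff_add_eq_0 add.commute)

lemma series_act_diff: "series_act (p - q) f = (\<lambda>\<alpha>. series_act p f \<alpha> - series_act q f \<alpha>)"
  using series_act_add[of p "- q" f] by (simp add: series_act_uminus)

lemma series_act_single: "series_act (Poly_Mapping.single w c) f = (\<lambda>\<alpha>. c * series_word w f \<alpha>)"
  by (rule ext) (simp add: series_act_superset[of "{w}"])

lemma series_act_one [simp]: "series_act 1 f = f"
  using series_act_single[of 0 1 f] by (simp only: single_one) (simp add: series_word_def zero_word_def)

lemma series_word_zero [simp]: "series_word w (\<lambda>_. 0) = (\<lambda>_. 0)"
  using series_word_lin(2)[of w 0 "\<lambda>_. 0"] by simp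

lemma series_act_lin:
  "series_act p (\<lambda>\<alpha>. f \<alpha> + h \<alpha>) = (\<lambda>\<alpha>. series_act p f \<alpha> + series_act p h \<alpha>)"
  "series_act p (\<lambda>_. 0) = (\<lambda>_. 0)"
  by (simp_all add: fun_eq_iff series_act_def series_word_lin sum.distrib distrib_left)

lemma series_act_mult: "series_act (p * q) f = series_act p (series_act q f)"
proof (induction p rule: free_algebra_induct)
  case zero
  show ?case by simp
next
  case (single w c)
  show ?case
  proof (induction q rule: free_algebra_induct)
    case zero
    show ?case by (simp add: series_act_lin)
  next
    case (single v d)
    show ?case
      by (simp add: mult_single series_act_single series_word_lin)
        (simp add: series_word_def plus_word_def mult.assoc)
  next
    case (add p q)
    then show ?case by (simp add: distrib_left series_act_add series_act_lin)
  qed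
next
  case (add p1 p2)
  then show ?case by (simp add: distrib_right series_act_add)
qed

lemma series_act_gen: "series_act (free_gen g) f = series_gen g f"
  by (simp add: free_gen_def series_act_single series_word_def)

lemma series_act_weyl_ideal: "p \<in> weyl_ideal \<Longrightarrow> series_act p f = (\<lambda>_. 0)"
proof (induction arbitrary: f rule: weyl_ideal.induct)
  case (comm_x i j)
  show ?case
    by (cases "i = j")
      (auto simp: series_act_diff series_act_mult series_act_gen fun_eq_iff fun_upd_twist)
next
  case (comm_d i j)
  show ?case
    by (cases "i = j")
      (auto simp: series_act_diff series_act_mult series_act_gen fun_eq_iff fun_upd_twist)
next
  case (comm_dx i j)
  show ?case
  proof
    fix \<alpha>
    show "series_act (free_gen (GenD i) * free_gen (GenX j) - free_gen (GenX j) * free_gen (GenD i)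
      - (if i = j then 1 else 0)) f \<alpha> = 0"
      unfolding series_act_diff series_act_mult series_act_gen
      by (cases "i = j"; cases "\<alpha> j") (auto simp: fun_upd_twist fun_upd_idem algebra_simps)
  qed
qed (simp_all add: series_act_add series_act_mult series_act_lin)

lemma one_not_in_weyl_ideal: "1 \<notin> weyl_ideal"
proof
  assume "1 \<in> (weyl_ideal :: ('n gen, 'k::field) free_algebra set)"
  from series_act_weyl_ideal[OF this, of "\<lambda>_. 1"] show False
    by (simp add: fun_eq_iff)
qed


section \<open>The Weyl algebra\<close>

text \<open>
  The variables are indexed by a type \<^typ>\<open>'n\<close>; for finite \<^typ>\<open>'n\<close> this is the
  Weyl algebra in \<open>CARD('n) \<ge> 1\<close> variables over \<^typ>\<open>'k\<close>.
\<close>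

quotient_type (overloaded) ('n, 'k) weyl = "('n gen, 'k::field) free_algebra" / "\<lambda>p q. p - q \<in> weyl_ideal"
proof (rule equivpI)
  show "reflp (\<lambda>p q. p - q \<in> (weyl_ideal :: ('n gen, 'k) free_algebra set))"
    by (simp add: reflp_def weyl_ideal.zero)
  show "symp (\<lambda>p q. p - q \<in> (weyl_ideal :: ('n gen, 'k) free_algebra set))"
    using weyl_ideal_uminus by (fastforce simp: symp_def)
  show "transp (\<lambda>p q. p - q \<in> (weyl_ideal :: ('n gen, 'k) free_algebra set))"
    using weyl_ideal.add by (fastforce simp: transp_def)
qed

instantiation weyl :: (type, field) ring_1
begin

lift_definition zero_weyl :: "('a, 'b) weyl" is 0 .

lift_definition one_weyl :: "('a, 'b) weyl" is 1 .

lift_definition plus_weyl :: "('a, 'b) weyl \<Rightarrow> ('a, 'b) weyl \<Rightarrow> ('a, 'b) weyl" is "(+)"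
proof -
  fix p p' q q' :: "('a gen, 'b) free_algebra"
  assume "p - p' \<in> weyl_ideal" "q - q' \<in> weyl_ideal"
  then have "(p - p') + (q - q') \<in> weyl_ideal"
    by (rule weyl_ideal.add)
  then show "(p + q) - (p' + q') \<in> weyl_ideal"
    by (simp add: algebra_simps)
qed

lift_definition uminus_weyl :: "('a, 'b) weyl \<Rightarrow> ('a, 'b) weyl" is uminus
proof -
  fix p q :: "('a gen, 'b) free_algebra"
  assume "p - q \<in> weyl_ideal"
  then have "- (p - q) \<in> weyl_ideal"
    by (rule weyl_ideal_uminus)
  then show "- p - - q \<in> weyl_ideal"
    by simp
qed

lift_definition minus_weyl :: "('a, 'b) weyl \<Rightarrow> ('a, 'b) weyl \<Rightarrow> ('a, 'b) weyl" is "(-)"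
proof -
  fix p p' q q' :: "('a gen, 'b) free_algebra"
  assume "p - p' \<in> weyl_ideal" "q - q' \<in> weyl_ideal"
  then have "(p - p') - (q - q') \<in> weyl_ideal"
    by (rule weyl_ideal_diff)
  then show "(p - q) - (p' - q') \<in> weyl_ideal"
    by (simp add: algebra_simps)
qed

lift_definition times_weyl :: "('a, 'b) weyl \<Rightarrow> ('a, 'b) weyl \<Rightarrow> ('a, 'b) weyl" is "(*)"
proof -
  fix p p' q q' :: "('a gen, 'b) free_algebra"
  assume "p - p' \<in> weyl_ideal" "q - q' \<in> weyl_ideal"
  then have "(p - p') * q + p' * (q - q') \<in> weyl_ideal"
    by (intro weyl_ideal.intros)
  then show "p * q - p' * q' \<in> weyl_ideal"
    by (simp add: algebra_simps)
qed

instance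
proof
  fix a b c :: "('a, 'b) weyl"
  show "a + b + c = a + (b + c)" by transfer (simp add: add.assoc weyl_ideal.zero)
  show "a + b = b + a" by transfer (simp add: add.commute weyl_ideal.zero)
  show "0 + a = a" by transfer (simp add: weyl_ideal.zero)
  show "- a + a = 0" by transfer (simp add: weyl_ideal.zero)
  show "a - b = a + - b" by transfer (simp add: weyl_ideal.zero)
  show "a * b * c = a * (b * c)" by transfer (simp add: mult.assoc weyl_ideal.zero)
  show "1 * a = a" by transfer (simp add: weyl_ideal.zero)
  show "a * 1 = a" by transfer (simp add: weyl_ideal.zero)
  show "(a + b) * c = a * c + b * c" by transfer (simp add: distrib_right weyl_ideal.zero)
  show "a * (b + c) = a * b + a * c" by transfer (simp add: distrib_left weyl_ideal.zero)
  show "(0 :: ('a, 'b) weyl) \<noteq> 1"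
  proof transfer
    show "\<not> (0 - 1 \<in> (weyl_ideal :: ('a gen, 'b) free_algebra set))"
      using one_not_in_weyl_ideal weyl_ideal_uminus[of "- 1"] by auto
  qed
qed

end

lift_definition weyl_const :: "'k::field \<Rightarrow> ('n, 'k) weyl" is free_const .

lift_definition weyl_x :: "'n \<Rightarrow> ('n, 'k::field) weyl" is "\<lambda>i. free_gen (GenX i)" .

lift_definition weyl_d :: "'n \<Rightarrow> ('n, 'k::field) weyl" is "\<lambda>i. free_gen (GenD i)" .

lemma weyl_x_commute: "weyl_x i * weyl_x j = weyl_x j * weyl_x i"
  by transfer (rule weyl_ideal.comm_x)

lemma weyl_d_commute: "weyl_d i * weyl_d j = weyl_d j * weyl_d i"
  by transfer (rule weyl_ideal.comm_d)

lemma weyl_d_x: "weyl_d i * weyl_x j - weyl_x j * weyl_d i = (if i = j then 1 else 0)"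
proof -
  have "free_gen (GenD i) * free_gen (GenX j) - free_gen (GenX j) * free_gen (GenD i) - 1
      \<in> (weyl_ideal :: ('a gen, 'b::field) free_algebra set)" if "i = j" for i j :: 'a
    using weyl_ideal.comm_dx[of i j] that by simp
  then have same: "(weyl_d i * weyl_x j - weyl_x j * weyl_d i :: ('a, 'b::field) weyl) = 1"
    if "i = j" for i j :: 'a
    using that by transfer
  have "free_gen (GenD i) * free_gen (GenX j) - free_gen (GenX j) * free_gen (GenD i) - 0
      \<in> (weyl_ideal :: ('a gen, 'b::field) free_algebra set)" if "i \<noteq> j" for i j :: 'a
    using weyl_ideal.comm_dx[of i j] that by simp
  then have diff: "(weyl_d i * weyl_x j - weyl_x j * weyl_d i :: ('a, 'b::field) weyl) = 0"
    if "i \<noteq> j" for i j :: 'a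
    using that by transfer
  from same diff show ?thesis by simp
qed

definition weyl_scale :: "'k::field \<Rightarrow> ('n, 'k) weyl \<Rightarrow> ('n, 'k) weyl" where
  "weyl_scale c a = weyl_const c * a"

lemma free_const_simps:
  "free_const 0 = 0" "free_const 1 = 1"
  "free_const (c + d) = free_const c + free_const d"
  "free_const (c * d) = free_const c * free_const d"
  by (simp_all add: free_const_def single_add mult_single)

lemma weyl_const_simps [simp]:
  "weyl_const 0 = 0" "weyl_const 1 = 1"
  "weyl_const (c + d) = weyl_const c + weyl_const d"
  "weyl_const (c * d) = weyl_const c * weyl_const d"
  by (transfer, simp add: free_const_simps weyl_ideal.zero)+

lemma vector_space_weyl_scale: "vector_space weyl_scale"
  by standard (simp_all add: weyl_scale_def distrib_left distrib_right mult.assoc)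

text \<open>
  The factors of \<open>\<Prod>\<^sub>i x\<^sub>i\<^bsup>\<alpha> i\<^esup>\<close> (and likewise of \<open>\<Prod>\<^sub>i \<partial>\<^sub>i\<^bsup>\<beta> i\<^esup>\<close>) commute, so their product in any order is
  given by \<^const>\<open>Finite_Set.fold\<close>; \<^const>\<open>prod\<close> is not available in a noncommutative ring.
\<close>

definition weyl_monomial :: "('n::finite \<Rightarrow> nat) \<Rightarrow> ('n \<Rightarrow> nat) \<Rightarrow> ('n, 'k::field) weyl" where
  "weyl_monomial \<alpha> \<beta> =
     Finite_Set.fold (\<lambda>i a. weyl_x i ^ \<alpha> i * a) 1 UNIV *
     Finite_Set.fold (\<lambda>i a. weyl_d i ^ \<beta> i * a) 1 UNIV"

lemma power_left_commute:
  fixes a b c :: "'a::monoid_mult"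
  assumes "a * b = b * a"
  shows "a ^ m * (b ^ n * c) = b ^ n * (a ^ m * c)"
proof -
  have "a ^ m * b = b * a ^ m"
    by (rule power_commuting_commutes) (fact assms)
  then have "b ^ n * a ^ m = a ^ m * b ^ n"
    by (intro power_commuting_commutes) simp
  then have "a ^ m * b ^ n * c = b ^ n * a ^ m * c"
    by simp
  then show ?thesis by (simp only: mult.assoc)
qed

lemma comp_fun_commute_weyl:
  "comp_fun_commute (\<lambda>i a. weyl_x i ^ \<alpha> i * a)"
  "comp_fun_commute (\<lambda>i a. weyl_d i ^ \<beta> i * a)"
  by (unfold_locales; rule ext; unfold o_apply;
      rule power_left_commute; rule weyl_x_commute weyl_d_commute)+

definition bernstein :: "nat \<Rightarrow> ('n::finite, 'k::field) weyl set" where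
  "bernstein m = module.span weyl_scale
     {weyl_monomial \<alpha> \<beta> | \<alpha> \<beta>. (\<Sum>i\<in>UNIV. \<alpha> i) + (\<Sum>i\<in>UNIV. \<beta> i) \<le> m}"


section \<open>Modules over noncommutative rings\<close>

text \<open>
  Modules and bimodules live on a subset \<^term>\<open>M\<close> of an abelian group; nothing is required of the
  action outside \<^term>\<open>M\<close>.
\<close>

locale left_module =
  fixes M :: "'m::ab_group_add set" and act :: "'a::ring_1 \<Rightarrow> 'm \<Rightarrow> 'm"
  assumes zero_mem: "0 \<in> M"
    and add_mem: "x \<in> M \<Longrightarrow> y \<in> M \<Longrightarrow> x + y \<in> M"
    and uminus_mem: "x \<in> M \<Longrightarrow> - x \<in> M"
    and act_mem: "x \<in> M \<Longrightarrow> act a x \<in> M"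
    and act_add: "x \<in> M \<Longrightarrow> y \<in> M \<Longrightarrow> act a (x + y) = act a x + act a y"
    and add_act: "x \<in> M \<Longrightarrow> act (a + b) x = act a x + act b x"
    and mult_act: "x \<in> M \<Longrightarrow> act (a * b) x = act a (act b x)"
    and one_act: "x \<in> M \<Longrightarrow> act 1 x = x"

locale right_module =
  fixes M :: "'m::ab_group_add set" and act :: "'m \<Rightarrow> 'a::ring_1 \<Rightarrow> 'm"
  assumes zero_mem: "0 \<in> M"
    and add_mem: "x \<in> M \<Longrightarrow> y \<in> M \<Longrightarrow> x + y \<in> M"
    and uminus_mem: "x \<in> M \<Longrightarrow> - x \<in> M"
    and act_mem: "x \<in> M \<Longrightarrow> act x a \<in> M"
    and act_add: "x \<in> M \<Longrightarrow> y \<in> M \<Longrightarrow> act (x + y) a = act x a + act y a"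
    and add_act: "x \<in> M \<Longrightarrow> act x (a + b) = act x a + act x b"
    and mult_act: "x \<in> M \<Longrightarrow> act x (a * b) = act (act x a) b"
    and one_act: "x \<in> M \<Longrightarrow> act x 1 = x"

definition left_generates ::
    "'m::ab_group_add set \<Rightarrow> ('a::ring_1 \<Rightarrow> 'm \<Rightarrow> 'm) \<Rightarrow> 'm set \<Rightarrow> bool" where
  "left_generates M act S \<longleftrightarrow> finite S \<and> S \<subseteq> M \<and> M = {\<Sum>m\<in>S. act (a m) m | a. True}"

definition left_finitely_generated ::
    "'m::ab_group_add set \<Rightarrow> ('a::ring_1 \<Rightarrow> 'm \<Rightarrow> 'm) \<Rightarrow> bool" where
  "left_finitely_generated M act \<longleftrightarrow> (\<exists>S. left_generates M act S)"

definition right_generates ::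
    "'m::ab_group_add set \<Rightarrow> ('m \<Rightarrow> 'a::ring_1 \<Rightarrow> 'm) \<Rightarrow> 'm set \<Rightarrow> bool" where
  "right_generates M act S \<longleftrightarrow> finite S \<and> S \<subseteq> M \<and> M = {\<Sum>m\<in>S. act m (a m) | a. True}"

definition right_finitely_generated ::
    "'m::ab_group_add set \<Rightarrow> ('m \<Rightarrow> 'a::ring_1 \<Rightarrow> 'm) \<Rightarrow> bool" where
  "right_finitely_generated M act \<longleftrightarrow> right_module M act \<and> (\<exists>S. right_generates M act S)"


section \<open>Dimension and holonomic modules\<close>

text \<open>
  The vector space structure of a module over the Weyl algebra is the restriction of the action
  to the constants.
\<close>

definition const_scale :: "(('n, 'k::field) weyl \<Rightarrow> 'm \<Rightarrow> 'm) \<Rightarrow> 'k \<Rightarrow> 'm \<Rightarrow> 'm" where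
  "const_scale act c m = act (weyl_const c) m"

definition gamma ::
    "(('n::finite, 'k::field) weyl \<Rightarrow> 'm::ab_group_add \<Rightarrow> 'm) \<Rightarrow> 'm set \<Rightarrow> nat \<Rightarrow> 'm set" where
  "gamma act S i = {\<Sum>m\<in>S. act (b m) m | b. \<forall>m\<in>S. b m \<in> bernstein i}"

definition has_hilbert_poly ::
    "(('n::finite, 'k::field) weyl \<Rightarrow> 'm::ab_group_add \<Rightarrow> 'm) \<Rightarrow> 'm set \<Rightarrow> rat poly \<Rightarrow> bool" where
  "has_hilbert_poly act S p \<longleftrightarrow>
     (\<forall>\<^sub>F i in sequentially.
        of_nat (vector_space.dim (const_scale act) (gamma act S i)) = poly p (of_nat i))"

text \<open>
  The polynomial is determined by the generating set, and its degree does not depend on the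
  generating set; so the dimension may be read off from any one of them.  The relation is
  meant for nonzero modules.
\<close>

definition has_weyl_dim ::
    "'m::ab_group_add set \<Rightarrow> (('n::finite, 'k::field_char_0) weyl \<Rightarrow> 'm \<Rightarrow> 'm) \<Rightarrow> nat \<Rightarrow> bool" where
  "has_weyl_dim M act d \<longleftrightarrow>
     (\<exists>S p. left_generates M act S \<and> has_hilbert_poly act S p \<and> degree p = d)"

definition holonomic ::
    "'m::ab_group_add set \<Rightarrow> (('n::finite, 'k::field_char_0) weyl \<Rightarrow> 'm \<Rightarrow> 'm) \<Rightarrow> bool" where
  "holonomic M act \<longleftrightarrow> left_module M act \<and> left_finitely_generated M act \<and>
     (M = {0} \<or> has_weyl_dim M act CARD('n))"


section \<open>Bimodules\<close>

text \<open>
  Compatibility of both module structures with one and the same vector space structure says that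
  the constants act in the same way from both sides.
\<close>

locale weyl_bimodule =
  left: left_module M l + right: right_module M r
  for M :: "'m::ab_group_add set"
    and l :: "('n, 'k::field) weyl \<Rightarrow> 'm \<Rightarrow> 'm"
    and r :: "'m \<Rightarrow> ('n, 'k) weyl \<Rightarrow> 'm" +
  assumes assoc: "m \<in> M \<Longrightarrow> r (l a m) b = l a (r m b)"
    and const_compatible: "m \<in> M \<Longrightarrow> l (weyl_const c) m = r m (weyl_const c)"

text \<open>
  The Weyl algebra in twice as many variables is indexed by \<^typ>\<open>'n + 'n\<close>: the variables \<open>Inl i\<close> act
  from the left and the variables \<open>Inr i\<close> from the right.  On a bimodule there is exactly one
  action on \<^term>\<open>M\<close> with the property below, because the operators on the right satisfy the defining
  relations, and the constants and the generators generate the algebra.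
\<close>

definition enveloping_action ::
    "'m::ab_group_add set \<Rightarrow> (('n, 'k::field) weyl \<Rightarrow> 'm \<Rightarrow> 'm) \<Rightarrow> ('m \<Rightarrow> ('n, 'k) weyl \<Rightarrow> 'm) \<Rightarrow>
     (('n + 'n, 'k) weyl \<Rightarrow> 'm \<Rightarrow> 'm) \<Rightarrow> bool" where
  "enveloping_action M l r act \<longleftrightarrow> left_module M act \<and>
     (\<forall>m\<in>M. (\<forall>c. act (weyl_const c) m = l (weyl_const c) m) \<and>
       (\<forall>i. act (weyl_x (Inl i)) m = l (weyl_x i) m \<and>
            act (weyl_d (Inl i)) m = l (weyl_d i) m \<and>
            act (weyl_x (Inr i)) m = r m (weyl_x i) \<and>
            act (weyl_d (Inr i)) m = - r m (weyl_d i)))"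

definition holonomic_bimodule ::
    "'m::ab_group_add set \<Rightarrow> (('n::finite, 'k::field_char_0) weyl \<Rightarrow> 'm \<Rightarrow> 'm) \<Rightarrow>
     ('m \<Rightarrow> ('n, 'k) weyl \<Rightarrow> 'm) \<Rightarrow> bool" where
  "holonomic_bimodule M l r \<longleftrightarrow> weyl_bimodule M l r \<and>
     (\<exists>act. enveloping_action M l r act \<and> holonomic M act)"

text \<open>
  The bimodule of left module homomorphisms between bimodules whose carriers are whole types:
  \<open>(a \<phi> s)(x) = \<phi>(x a) s\<close>.
\<close>

definition left_hom ::
    "('a::ring_1 \<Rightarrow> 'm::ab_group_add \<Rightarrow> 'm) \<Rightarrow> ('a \<Rightarrow> 'p::ab_group_add \<Rightarrow> 'p) \<Rightarrow> ('m \<Rightarrow> 'p) set" where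
  "left_hom lM lN =
     {\<phi>. (\<forall>x y. \<phi> (x + y) = \<phi> x + \<phi> y) \<and> (\<forall>a x. \<phi> (lM a x) = lN a (\<phi> x))}"

definition hom_left_act :: "('m \<Rightarrow> 'a \<Rightarrow> 'm) \<Rightarrow> 'a \<Rightarrow> ('m \<Rightarrow> 'p) \<Rightarrow> 'm \<Rightarrow> 'p" where
  "hom_left_act rM a \<phi> = (\<lambda>x. \<phi> (rM x a))"

definition hom_right_act :: "('p \<Rightarrow> 'a \<Rightarrow> 'p) \<Rightarrow> ('m \<Rightarrow> 'p) \<Rightarrow> 'a \<Rightarrow> 'm \<Rightarrow> 'p" where
  "hom_right_act rN \<phi> s = (\<lambda>x. rN (\<phi> x) s)"

end

theory Submission
  imports Defs "HOL-Library.FuncSet"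
begin

text \<open>
  Let \<open>d = 2n\<close>. Since \<open>dim \<Gamma>\<^sub>i(M) = O(i\<^sup>d)\<close> while \<open>dim B\<^sub>i\<close> already grows like \<open>i\<^sup>d\<close>, there is a bound
  on the size of left \<open>A\<close>-independent subsets of \<open>M\<close>. A homomorphism \<open>\<phi> : M \<rightarrow> A\<close> is determined by its
  values on a maximal one, because \<open>A\<close> is a domain. So \<open>Hom(M, A)\<close> embeds into a free right module
  of finite rank, and it is finitely generated over the right noetherian ring \<open>A\<close>.

  If \<open>\<phi>\<^sub>1, \<dots>, \<phi>\<^sub>s\<close> are right generators, then every generator of \<open>A\<close> maps each \<open>\<phi>\<^sub>j\<close> into
  \<open>\<Sum>\<^sub>t \<phi>\<^sub>t B\<^sub>C\<close> from the left, for some constant \<open>C\<close>. Hence the \<open>i\<close>-th piece of the filtration of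
  \<open>Hom(M, A)\<close> lies in \<open>\<Sum>\<^sub>t \<phi>\<^sub>t B\<^bsub>Ci\<^esub>\<close> and has dimension \<open>O(i\<^sup>d)\<close>; it contains a copy of \<open>B\<^sub>i\<close>
  because a nonzero \<open>\<phi>\<close> generates a free right module. So the Hilbert polynomial has degree \<open>d\<close>.
  The existence of Hilbert polynomials, the domain property and the noetherian property all come
  from leading exponents with respect to a monomial order, and Dickson's lemma.
\<close>

section \<open>Exponents\<close>

text \<open>The number 2n plays two roles that meet. It counts the generators of A, so it is the
  growth order of the pieces of A; and it counts the variables of the enveloping algebra, so it is
  the dimension demanded of a holonomic bimodule. Both halves of the proof therefore compare a
  filtration built with the 4n generators of the enveloping algebra with one built with the 2n
  generators of A.

  Dimension is defined by a polynomial, so growth bounds cannot stand alone: a Hilbert polynomial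
  must first exist, and the bounds then fix its degree. Existence is reduced to counting the
  exponents outside a finite union of cones, which inclusion-exclusion expresses by shifted binomial
  coefficients.

  For the dual, the obstacle is that left multiplications ignore the degree of the right factor.
  They commute with right multiplications, so their effect on the finitely many right generators
  controls them; a fixed loss per generator only rescales i and leaves the order of growth
  unchanged.

  Characteristic zero makes the factorials in the action of derivatives on powers nonzero; this
  separates the monomials.\<close>

definition edeg :: "('i::finite \<Rightarrow> nat) \<Rightarrow> nat" where
  "edeg \<gamma> = sum \<gamma> UNIV"

definition eunit :: "'i \<Rightarrow> 'i \<Rightarrow> nat" where
  "eunit i = (\<lambda>j. if j = i then 1 else 0)"

lemma edeg_add [simp]: "edeg (\<gamma> + \<delta>) = edeg \<gamma> + edeg \<delta>"
  by (simp add: edeg_def sum.distrib)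

lemma edeg_zero [simp]: "edeg 0 = 0"
  by (simp add: edeg_def)

lemma edeg_eunit [simp]: "edeg (eunit i) = 1"
  by (simp add: edeg_def eunit_def)

lemma edeg_eq_0_iff: "edeg \<gamma> = 0 \<longleftrightarrow> \<gamma> = 0"
  by (simp add: edeg_def fun_eq_iff)

lemma exponent_diff_add: "\<delta> \<le> \<gamma> \<Longrightarrow> (\<gamma> - \<delta>) + \<delta> = (\<gamma> :: 'i \<Rightarrow> nat)"
  by (simp add: le_fun_def fun_eq_iff)

lemma eunit_le_iff: "eunit i \<le> \<gamma> \<longleftrightarrow> 0 < \<gamma> i"
  by (auto simp: eunit_def le_fun_def dest: spec[of _ i])

lemma exponent_induct [case_names zero add]:
  assumes "P 0" and "\<And>\<gamma> i. P \<gamma> \<Longrightarrow> P (\<gamma> + eunit i)"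
  shows "P (\<gamma> :: 'i::finite \<Rightarrow> nat)"
proof (induction "edeg \<gamma>" arbitrary: \<gamma>)
  case 0
  then show ?case using assms(1) by (metis edeg_eq_0_iff)
next
  case (Suc m)
  then have "\<gamma> \<noteq> 0" by auto
  then obtain i where "0 < \<gamma> i" by (auto simp: fun_eq_iff)
  then have eq: "(\<gamma> - eunit i) + eunit i = \<gamma>"
    by (intro exponent_diff_add) (simp add: eunit_le_iff)
  then have "edeg (\<gamma> - eunit i) + 1 = edeg \<gamma>"
    by (metis edeg_add edeg_eunit)
  then show ?case using Suc assms(2)[of "\<gamma> - eunit i" i] eq by simp
qed

lemma finite_edeg_le [simp]: "finite {\<gamma> :: 'i::finite \<Rightarrow> nat. edeg \<gamma> \<le> m}"
proof (rule finite_subset)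
  show "{\<gamma> :: 'i \<Rightarrow> nat. edeg \<gamma> \<le> m} \<subseteq> PiE UNIV (\<lambda>_. {..m})"
    by (auto simp: edeg_def PiE_def intro: order_trans[OF member_le_sum[of _ UNIV]])
qed (simp add: finite_PiE)

text \<open>
  A translation invariant linear order on exponents refining the degree has order type
  \<open>\<omega>\<close>, so it is given by an injective rank with values in the natural numbers.
\<close>

lemma monomial_rank_exists:
  obtains rk :: "('i::finite \<Rightarrow> nat) \<Rightarrow> nat"
  where "inj rk" "\<And>\<gamma> \<delta>. edeg \<gamma> < edeg \<delta> \<Longrightarrow> rk \<gamma> < rk \<delta>"
    "\<And>\<gamma> \<delta> \<epsilon>. rk \<gamma> < rk \<delta> \<Longrightarrow> rk (\<gamma> + \<epsilon>) < rk (\<delta> + \<epsilon>)"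
proof -
  obtain h :: "'i \<Rightarrow> nat" where h: "inj h"
    using finite_imp_inj_to_nat_seg[of "UNIV :: 'i set"] by auto
  \<comment> \<open>Graded lexicographic order, the variables being compared in the order that
    \<open>h\<close> gives them.\<close>
  define lt :: "('i \<Rightarrow> nat) \<Rightarrow> ('i \<Rightarrow> nat) \<Rightarrow> bool" where
    "lt \<gamma> \<delta> \<longleftrightarrow> edeg \<gamma> < edeg \<delta> \<or>
      edeg \<gamma> = edeg \<delta> \<and> (\<exists>i. \<gamma> i < \<delta> i \<and> (\<forall>j. h j < h i \<longrightarrow> \<gamma> j = \<delta> j))" for \<gamma> \<delta>
  have irrefl: "\<not> lt \<gamma> \<gamma>" for \<gamma>
    by (simp add: lt_def)
  have trans: "lt \<gamma> \<epsilon>" if "lt \<gamma> \<delta>" "lt \<delta> \<epsilon>" for \<gamma> \<delta> \<epsilon>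
  proof (cases "edeg \<gamma> = edeg \<delta> \<and> edeg \<delta> = edeg \<epsilon>")
    case True
    with that obtain i j where i: "\<gamma> i < \<delta> i" "\<And>k. h k < h i \<Longrightarrow> \<gamma> k = \<delta> k"
      and j: "\<delta> j < \<epsilon> j" "\<And>k. h k < h j \<Longrightarrow> \<delta> k = \<epsilon> k"
      by (auto simp: lt_def)
    consider "h i < h j" | "i = j" | "h j < h i"
      using h by (metis injD linorder_neqE_nat)
    then have "\<exists>i. \<gamma> i < \<epsilon> i \<and> (\<forall>j. h j < h i \<longrightarrow> \<gamma> j = \<epsilon> j)"
    proof cases
      case 1
      then show ?thesis using i j by (intro exI[of _ i]) auto
    next
      case 2
      then show ?thesis using i j by (intro exI[of _ i]) auto
    next
      case 3
      then show ?thesis using i j by (intro exI[of _ j]) auto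
    qed
    then show ?thesis using True by (auto simp: lt_def)
  next
    case False
    then show ?thesis using that unfolding lt_def by linarith
  qed
  have total: "lt \<gamma> \<delta> \<or> lt \<delta> \<gamma>" if "\<gamma> \<noteq> \<delta>" for \<gamma> \<delta>
  proof -
    from that obtain i0 where "\<gamma> i0 \<noteq> \<delta> i0" by (auto simp: fun_eq_iff)
    then obtain i where i: "\<gamma> i \<noteq> \<delta> i" and min: "\<And>j. \<gamma> j \<noteq> \<delta> j \<Longrightarrow> h i \<le> h j"
      using ex_has_least_nat[of "\<lambda>i. \<gamma> i \<noteq> \<delta> i" i0 h] by blast
    from min have "\<forall>j. h j < h i \<longrightarrow> \<gamma> j = \<delta> j"
      by (meson leD)
    with i show ?thesis
      unfolding lt_def by (metis linorder_neqE_nat)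
  qed
  have shift: "lt (\<gamma> + \<epsilon>) (\<delta> + \<epsilon>)" if "lt \<gamma> \<delta>" for \<gamma> \<delta> \<epsilon>
    using that by (auto simp: lt_def)
  have fin: "finite {\<delta>. lt \<delta> \<gamma>}" for \<gamma>
    by (rule finite_subset[OF _ finite_edeg_le[of "edeg \<gamma>"]]) (auto simp: lt_def)
  \<comment> \<open>Comparing degrees first leaves only finitely many predecessors, so counting them
    turns the order into a rank.\<close>
  define rk where "rk \<gamma> = card {\<delta>. lt \<delta> \<gamma>}" for \<gamma>
  have mono: "rk \<gamma> < rk \<delta>" if "lt \<gamma> \<delta>" for \<gamma> \<delta>
    unfolding rk_def
    by (rule psubset_card_mono[OF fin]) (use that trans irrefl in blast)
  have rk_iff: "rk \<gamma> < rk \<delta> \<longleftrightarrow> lt \<gamma> \<delta>" for \<gamma> \<delta>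
    using mono total by (metis less_asym less_irrefl)
  show ?thesis
  proof
    show "inj rk"
      by (rule injI) (use mono total in \<open>metis less_irrefl\<close>)
    show "rk \<gamma> < rk \<delta>" if "edeg \<gamma> < edeg \<delta>" for \<gamma> \<delta>
      using that by (simp add: rk_iff lt_def)
    show "rk (\<gamma> + \<epsilon>) < rk (\<delta> + \<epsilon>)" if "rk \<gamma> < rk \<delta>" for \<gamma> \<delta> \<epsilon>
      using that shift by (simp add: rk_iff)
  qed
qed

subsection \<open>Dickson's lemma\<close>

text \<open>Every sequence has a monotone subsequence. A decreasing one of naturals stays at its
  minimum from some point on, and this tail is increasing as well.\<close>

lemma nat_incseq_subseq:
  fixes s :: "nat \<Rightarrow> nat"
  obtains r where "strict_mono r" "incseq (\<lambda>k. s (r k))"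
proof -
  obtain r where r: "strict_mono r" "monoseq (\<lambda>k. s (r k))"
    using seq_monosub[of s] by blast
  show ?thesis
  proof (cases "incseq (\<lambda>k. s (r k))")
    case True
    then show ?thesis using that r by blast
  next
    case False
    with r(2) have dec: "decseq (\<lambda>k. s (r k))"
      using monoseq_iff by blast
    obtain n0 where n0: "\<And>n. s (r n0) \<le> s (r n)"
      using ex_has_least_nat[of "\<lambda>_. True" 0 "\<lambda>k. s (r k)"] by auto
    have "s (r (n + n0)) = s (r n0)" for n
      using n0[of "n + n0"] decseqD[OF dec, of n0 "n + n0"] by simp
    then have "incseq (\<lambda>k. s (r (k + n0)))"
      by (simp add: incseq_def)
    moreover have "strict_mono (\<lambda>k. r (k + n0))"
      using r(1) by (simp add: strict_mono_def)
    ultimately show ?thesis using that by blast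
  qed
qed

text \<open>Thin out the sequence once per coordinate; coordinates treated earlier stay increasing
  on the finer subsequence.\<close>

lemma exponent_incseq_subseq:
  fixes f :: "nat \<Rightarrow> 'i \<Rightarrow> nat"
  assumes "finite I"
  shows "\<exists>r. strict_mono r \<and> (\<forall>i\<in>I. incseq (\<lambda>k. f (r k) i))"
  using assms
proof (induction I rule: finite_induct)
  case empty
  show ?case by (rule exI[of _ id]) (simp add: strict_mono_def)
next
  case (insert i I)
  then obtain r where r: "strict_mono r" "\<And>j. j \<in> I \<Longrightarrow> incseq (\<lambda>k. f (r k) j)"
    by blast
  obtain q where q: "strict_mono q" "incseq (\<lambda>k. f (r (q k)) i)"
    using nat_incseq_subseq[of "\<lambda>k. f (r k) i"] by blast
  have "strict_mono (\<lambda>k. r (q k))"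
    using r(1) q(1) by (simp add: strict_mono_def)
  moreover have "incseq (\<lambda>k. f (r (q k)) j)" if "j \<in> I" for j
    using r(2)[OF that] q(1) by (auto simp: incseq_def strict_mono_less_eq)
  ultimately show ?case using q(2) by (intro exI[of _ "\<lambda>k. r (q k)"]) auto
qed

text \<open>The minimal elements serve as \<open>F\<close>. Below any member of \<open>U\<close>,
  one of least degree is minimal; infinitely many minimal elements would contain a comparable pair
  by the subsequence lemma.\<close>

lemma dickson:
  fixes U :: "('i::finite \<Rightarrow> nat) set"
  obtains F where "finite F" "F \<subseteq> U" "\<And>\<gamma>. \<gamma> \<in> U \<Longrightarrow> \<exists>\<delta>\<in>F. \<delta> \<le> \<gamma>"
proof -
  define F where "F = {\<gamma>\<in>U. \<forall>\<delta>\<in>U. \<delta> \<le> \<gamma> \<longrightarrow> \<delta> = \<gamma>}"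
  have "\<exists>\<delta>\<in>F. \<delta> \<le> \<gamma>" if \<gamma>: "\<gamma> \<in> U" for \<gamma>
  proof -
    obtain \<delta> where \<delta>: "\<delta> \<in> U \<and> \<delta> \<le> \<gamma>" and min: "\<And>\<epsilon>. \<epsilon> \<in> U \<and> \<epsilon> \<le> \<gamma> \<Longrightarrow> edeg \<delta> \<le> edeg \<epsilon>"
      using ex_has_least_nat[of "\<lambda>\<delta>. \<delta> \<in> U \<and> \<delta> \<le> \<gamma>" \<gamma> edeg] \<gamma> by auto
    have "\<epsilon> = \<delta>" if "\<epsilon> \<in> U" "\<epsilon> \<le> \<delta>" for \<epsilon>
    proof -
      have "edeg (\<delta> - \<epsilon>) + edeg \<epsilon> = edeg \<delta>"
        by (metis exponent_diff_add[OF that(2)] edeg_add)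
      with min[of \<epsilon>] that \<delta> have "edeg (\<delta> - \<epsilon>) = 0" by fastforce
      then have "\<delta> - \<epsilon> = 0" by (simp only: edeg_eq_0_iff)
      with exponent_diff_add[OF that(2)] show ?thesis by simp
    qed
    with \<delta> show ?thesis by (auto simp: F_def)
  qed
  moreover have "finite F"
  proof (rule ccontr)
    assume "infinite F"
    then obtain f :: "nat \<Rightarrow> 'i \<Rightarrow> nat" where f: "inj f" "range f \<subseteq> F"
      using infinite_countable_subset by blast
    obtain r where r: "strict_mono r" "\<And>i. incseq (\<lambda>k. f (r k) i)"
      using exponent_incseq_subseq[of UNIV f] by auto
    have "f (r 0) \<le> f (r 1)"
      using r(2) by (auto simp: le_fun_def incseq_def)
    moreover have "f (r 0) \<in> F" "f (r 1) \<in> F"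
      using f(2) by auto
    ultimately have "f (r 0) = f (r 1)"
      by (simp add: F_def)
    with f(1) have "r 0 = r 1" by (rule injD)
    with r(1) show False by (simp add: strict_mono_eq)
  qed
  ultimately show ?thesis using that[of F] by (auto simp: F_def)
qed

subsection \<open>Counting exponents\<close>

text \<open>Induction over the support, which is why exponents vanishing off \<open>F\<close> are
  counted: split by the value \<open>j\<close> at the new variable and add up the counts for
  \<open>m - j\<close> by the hockey-stick identity.\<close>

lemma card_exponents_on:
  assumes "finite F"
  shows "card {\<gamma> :: 'i::finite \<Rightarrow> nat. (\<forall>i. i \<notin> F \<longrightarrow> \<gamma> i = 0) \<and> sum \<gamma> F \<le> m} = (m + card F) choose card F"
  using assms
proof (induction F arbitrary: m rule: finite_induct)
  case empty
  have "{\<gamma> :: 'i \<Rightarrow> nat. \<forall>i. \<gamma> i = 0} = {\<lambda>_. 0}" by auto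
  then show ?case by simp
next
  case (insert a F)
  let ?E = "\<lambda>F m. {\<gamma> :: 'i \<Rightarrow> nat. (\<forall>i. i \<notin> F \<longrightarrow> \<gamma> i = 0) \<and> sum \<gamma> F \<le> m}"
  have fin: "finite (?E F m)" for m
    by (rule card_ge_0_finite) (simp add: insert.IH)
  have sum_upd: "sum (\<gamma>(a := j)) F = sum \<gamma> F" for \<gamma> :: "'i \<Rightarrow> nat" and j
    using insert.hyps by (intro sum.cong) auto
  have "?E (insert a F) m = (\<Union>j\<le>m. (\<lambda>\<gamma>. \<gamma>(a := j)) ` ?E F (m - j))"
  proof (intro equalityI subsetI)
    fix \<gamma> assume "\<gamma> \<in> ?E (insert a F) m"
    then have \<gamma>: "\<And>i. i \<noteq> a \<Longrightarrow> i \<notin> F \<Longrightarrow> \<gamma> i = 0" "\<gamma> a + sum \<gamma> F \<le> m"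
      using insert.hyps by auto
    then have "\<gamma>(a := 0) \<in> ?E F (m - \<gamma> a)" "\<gamma> a \<le> m"
      unfolding mem_Collect_eq sum_upd by auto
    moreover have "\<gamma> = (\<gamma>(a := 0))(a := \<gamma> a)" by simp
    ultimately show "\<gamma> \<in> (\<Union>j\<le>m. (\<lambda>\<gamma>. \<gamma>(a := j)) ` ?E F (m - j))"
      by blast
  next
    fix \<gamma> assume "\<gamma> \<in> (\<Union>j\<le>m. (\<lambda>\<gamma>. \<gamma>(a := j)) ` ?E F (m - j))"
    then obtain j \<delta> where "j \<le> m" "\<delta> \<in> ?E F (m - j)" "\<gamma> = \<delta>(a := j)"
      by blast
    then show "\<gamma> \<in> ?E (insert a F) m"
      using insert.hyps sum_upd[of \<delta> j] by (auto simp del: fun_upd_apply) auto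
  qed
  also have "card \<dots> = (\<Sum>j\<le>m. card ((\<lambda>\<gamma>. \<gamma>(a := j)) ` ?E F (m - j)))"
    by (rule card_UN_disjoint) (auto intro: finite_imageI fin dest: fun_cong[of _ _ a])
  also have "\<dots> = (\<Sum>j\<le>m. card (?E F (m - j)))"
  proof (intro sum.cong refl card_image inj_onI)
    fix j \<gamma> \<delta>
    assume "\<gamma> \<in> ?E F (m - j)" "\<delta> \<in> ?E F (m - j)" "\<gamma>(a := j) = \<delta>(a := j)"
    then show "\<gamma> = \<delta>"
      using insert.hyps by (auto simp: fun_eq_iff fun_upd_def) metis
  qed
  also have "\<dots> = (\<Sum>j\<le>m. (m - j + card F) choose card F)"
    by (simp add: insert.IH)
  also have "\<dots> = (\<Sum>j\<le>m. (card F + j) choose card F)"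
    by (subst sum.nat_diff_reindex[symmetric, where n = "Suc m", unfolded lessThan_Suc_atMost])
      (simp add: add.commute)
  also have "\<dots> = (m + card (insert a F)) choose card (insert a F)"
    unfolding choose_rising_sum(1) card_insert_disjoint[OF insert.hyps] by (simp add: add.commute)
  finally show ?case .
qed

lemma card_edeg_le:
  "card {\<gamma> :: 'i::finite \<Rightarrow> nat. edeg \<gamma> \<le> m} = (m + CARD('i)) choose CARD('i)"
  using card_exponents_on[of "UNIV :: 'i set" m] by (simp add: edeg_def)

section \<open>Counting functions that are eventually polynomial\<close>

text \<open>Rational coefficients, as in \<open>has_hilbert_poly\<close>. The degree is left open
  because growth bounds determine it later.\<close>

definition eventually_poly :: "(nat \<Rightarrow> nat) \<Rightarrow> bool" where
  "eventually_poly f \<longleftrightarrow> (\<exists>p :: rat poly. \<forall>\<^sub>F i in sequentially. of_nat (f i) = poly p (of_nat i))"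

lemma eventually_poly_add:
  assumes "eventually_poly f" "eventually_poly g"
  shows "eventually_poly (\<lambda>i. f i + g i)"
proof -
  obtain p q :: "rat poly" where "\<forall>\<^sub>F i in sequentially. of_nat (f i) = poly p (of_nat i)"
    "\<forall>\<^sub>F i in sequentially. of_nat (g i) = poly q (of_nat i)"
    using assms by (auto simp: eventually_poly_def)
  then have "\<forall>\<^sub>F i in sequentially. of_nat (f i + g i) = poly (p + q) (of_nat i)"
    by eventually_elim simp
  then show ?thesis unfolding eventually_poly_def by blast
qed

text \<open>The relation is stated additively because subtraction of natural numbers
  truncates.\<close>

lemma eventually_poly_diff:
  assumes "eventually_poly f" "eventually_poly g" "\<And>i. h i + g i = f i"
  shows "eventually_poly h"
proof -
  obtain p q :: "rat poly" where "\<forall>\<^sub>F i in sequentially. of_nat (f i) = poly p (of_nat i)"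
    "\<forall>\<^sub>F i in sequentially. of_nat (g i) = poly q (of_nat i)"
    using assms(1,2) by (auto simp: eventually_poly_def)
  then have "\<forall>\<^sub>F i in sequentially. of_nat (h i) = poly (p - q) (of_nat i)"
  proof eventually_elim
    case (elim i)
    have "(of_nat (h i) :: rat) + of_nat (g i) = of_nat (f i)"
      using assms(3)[of i] by (metis of_nat_add)
    with elim show ?case by simp
  qed
  then show ?thesis unfolding eventually_poly_def by blast
qed

lemma eventually_poly_sum:
  assumes "finite S" "\<And>s. s \<in> S \<Longrightarrow> eventually_poly (f s)"
  shows "eventually_poly (\<lambda>i. \<Sum>s\<in>S. f s i)"
  using assms
proof (induction S rule: finite_induct)
  case empty
  show ?case by (auto simp: eventually_poly_def intro: exI[of _ 0])
next
  case (insert s S)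
  then show ?case by (simp add: eventually_poly_add)
qed

text \<open>Subtracting \<open>\<delta>\<close> moves the cone to the origin and lowers the degree
  bound by \<open>edeg \<delta>\<close>.\<close>

lemma eventually_poly_card_above:
  fixes \<delta> :: "'i::finite \<Rightarrow> nat"
  shows "eventually_poly (\<lambda>m. card {\<gamma>. edeg \<gamma> \<le> m \<and> \<delta> \<le> \<gamma>})"
proof -
  let ?N = "CARD('i)"
  \<comment> \<open>The binomial coefficient of \<open>m - edeg \<delta> + ?N\<close> over
    \<open>?N\<close>, written as a polynomial in \<open>m\<close>; it gives the count as soon as
    \<open>m\<close> reaches \<open>edeg \<delta>\<close>.\<close>
  define p :: "rat poly" where
    "p = smult (1 / fact ?N) (\<Prod>k<?N. [:1 + of_nat k - of_nat (edeg \<delta>), 1:])"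
  have "of_nat (card {\<gamma>. edeg \<gamma> \<le> m \<and> \<delta> \<le> \<gamma>}) = poly p (of_nat m)" if "edeg \<delta> \<le> m" for m
  proof -
    have "{\<gamma>. edeg \<gamma> \<le> m \<and> \<delta> \<le> \<gamma>} = (\<lambda>\<gamma>. \<gamma> + \<delta>) ` {\<gamma>. edeg \<gamma> \<le> m - edeg \<delta>}"
    proof (intro equalityI subsetI)
      fix \<gamma> assume \<gamma>: "\<gamma> \<in> {\<gamma>. edeg \<gamma> \<le> m \<and> \<delta> \<le> \<gamma>}"
      then have eq: "\<gamma> = (\<gamma> - \<delta>) + \<delta>" by (simp add: exponent_diff_add)
      then have "edeg \<gamma> = edeg (\<gamma> - \<delta>) + edeg \<delta>" by (metis edeg_add)
      moreover have "edeg \<gamma> \<le> m" using \<gamma> by simp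
      ultimately have "\<gamma> - \<delta> \<in> {\<gamma>. edeg \<gamma> \<le> m - edeg \<delta>}"
        unfolding mem_Collect_eq by linarith
      with eq show "\<gamma> \<in> (\<lambda>\<gamma>. \<gamma> + \<delta>) ` {\<gamma>. edeg \<gamma> \<le> m - edeg \<delta>}" by blast
    qed (use that in \<open>auto simp: le_fun_def\<close>)
    moreover have "inj_on (\<lambda>\<gamma>. \<gamma> + \<delta>) X" for X
      by (rule inj_onI) simp
    ultimately have "card {\<gamma>. edeg \<gamma> \<le> m \<and> \<delta> \<le> \<gamma>} = ((m - edeg \<delta>) + ?N) choose ?N"
      by (simp add: card_image card_edeg_le)
    then have "(of_nat (card {\<gamma>. edeg \<gamma> \<le> m \<and> \<delta> \<le> \<gamma>}) :: rat)
        = (of_nat (m - edeg \<delta>) + of_nat ?N) gchoose ?N"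
      by (simp add: binomial_gbinomial)
    also have "\<dots> = poly p (of_nat m)"
      using that
      by (simp add: p_def poly_prod gbinomial_pochhammer' pochhammer_prod atLeast0LessThan of_nat_diff
          algebra_simps)
    finally show ?thesis .
  qed
  then show ?thesis
    unfolding eventually_poly_def eventually_sequentially by blast
qed

text \<open>Inclusion-exclusion on the first cone. Its intersection with the other cones is
  generated by the joins with \<open>\<delta>\<close>, a different list of the same length, so the
  induction is on the length.\<close>

lemma eventually_poly_card_upset_list:
  fixes xs :: "('i::finite \<Rightarrow> nat) list"
  shows "eventually_poly (\<lambda>m. card {\<gamma>. edeg \<gamma> \<le> m \<and> (\<exists>\<delta>\<in>set xs. \<delta> \<le> \<gamma>)})"
proof (induction "length xs" arbitrary: xs)
  case 0
  then show ?case by (auto simp: eventually_poly_def intro: exI[of _ 0])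
next
  case (Suc n)
  then obtain \<delta> ys where xs: "xs = \<delta> # ys" "length ys = n"
    by (metis length_Suc_conv)
  let ?A = "\<lambda>m. {\<gamma>. edeg \<gamma> \<le> m \<and> \<delta> \<le> \<gamma>}"
  let ?U = "\<lambda>ys m. {\<gamma>. edeg \<gamma> \<le> m \<and> (\<exists>\<delta>\<in>set ys. \<delta> \<le> \<gamma>)}"
  have fin: "finite {\<gamma> :: 'i \<Rightarrow> nat. edeg \<gamma> \<le> m \<and> Q \<gamma>}" for m Q
    by (rule finite_subset[OF _ finite_edeg_le[of m]]) auto
  have "card (?U xs m) + card (?U (map (sup \<delta>) ys) m) = card (?A m) + card (?U ys m)" for m
  proof -
    have "?U xs m = ?A m \<union> ?U ys m"
      by (auto simp: xs)
    moreover have "?U (map (sup \<delta>) ys) m = ?A m \<inter> ?U ys m"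
      by auto
    ultimately show ?thesis
      using card_Un_Int[OF fin fin, of m "\<lambda>\<gamma>. \<delta> \<le> \<gamma>" m "\<lambda>\<gamma>. \<exists>\<delta>\<in>set ys. \<delta> \<le> \<gamma>"] by simp
  qed
  moreover have "n = length (map (sup \<delta>) ys)" "n = length ys"
    by (simp_all add: xs)
  ultimately show ?case
    by (intro eventually_poly_diff[OF eventually_poly_add[OF eventually_poly_card_above
          Suc.hyps(1)[of ys]] Suc.hyps(1)[of "map (sup \<delta>) ys"], of _ \<delta>])
qed

text \<open>The complement is closed upwards, so Dickson's lemma writes it as a finite union of
  cones.\<close>

lemma eventually_poly_card_downset:
  fixes D :: "('i::finite \<Rightarrow> nat) set"
  assumes "\<And>\<gamma> \<delta>. \<delta> \<in> D \<Longrightarrow> \<gamma> \<le> \<delta> \<Longrightarrow> \<gamma> \<in> D"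
  shows "eventually_poly (\<lambda>m. card {\<gamma>\<in>D. edeg \<gamma> \<le> m})"
proof -
  obtain F where F: "finite F" "F \<subseteq> - D" "\<And>\<gamma>. \<gamma> \<in> - D \<Longrightarrow> \<exists>\<delta>\<in>F. \<delta> \<le> \<gamma>"
    using dickson[of "- D"] by blast
  obtain xs where xs: "set xs = F"
    using finite_list[OF F(1)] by blast
  let ?U = "\<lambda>m. {\<gamma>. edeg \<gamma> \<le> m \<and> (\<exists>\<delta>\<in>set xs. \<delta> \<le> \<gamma>)}"
  have U: "?U m = {\<gamma>. edeg \<gamma> \<le> m} - {\<gamma>\<in>D. edeg \<gamma> \<le> m}" for m
    using F assms by (fastforce simp: xs)
  \<comment> \<open>The condition \<open>0 \<le> \<gamma>\<close> presents the set of all exponents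
    as a cone, so that the count above a point applies to it.\<close>
  have "card {\<gamma>\<in>D. edeg \<gamma> \<le> m} + card (?U m) = card {\<gamma> :: 'i \<Rightarrow> nat. edeg \<gamma> \<le> m \<and> 0 \<le> \<gamma>}" for m
  proof -
    have "card {\<gamma>\<in>D. edeg \<gamma> \<le> m} \<le> card {\<gamma> :: 'i \<Rightarrow> nat. edeg \<gamma> \<le> m}"
      by (rule card_mono) auto
    moreover have "finite {\<gamma>\<in>D. edeg \<gamma> \<le> m}"
      by (rule finite_subset[OF _ finite_edeg_le[of m]]) auto
    moreover have "{\<gamma> :: 'i \<Rightarrow> nat. edeg \<gamma> \<le> m \<and> 0 \<le> \<gamma>} = {\<gamma>. edeg \<gamma> \<le> m}"
      by (auto simp: le_fun_def)
    ultimately show ?thesis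
      unfolding U by (subst card_Diff_subset) auto
  qed
  then show ?thesis
    by (rule eventually_poly_diff[OF eventually_poly_card_above eventually_poly_card_upset_list])
qed

section \<open>Hilbert polynomials\<close>

text \<open>The families below are indexed by exponents while \<open>independent\<close> concerns
  sets, so distinctness of the members has to be obtained along with independence.\<close>

lemma (in vector_space) family_independent:
  assumes "finite P" and "\<And>c. (\<Sum>p\<in>P. c p *s v p) = 0 \<Longrightarrow> \<forall>p\<in>P. c p = 0"
  shows "inj_on v P" and "independent (v ` P)"
proof -
  show inj: "inj_on v P"
  proof (rule inj_onI, rule ccontr)
    fix p q assume pq: "p \<in> P" "q \<in> P" "v p = v q" "p \<noteq> q"
    let ?c = "\<lambda>x. if x = p then 1 else if x = q then - 1 else (0 :: 'a)"
    have "(\<Sum>x\<in>P. ?c x *s v x) = (\<Sum>x\<in>{p, q}. ?c x *s v x)"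
      by (rule sum.mono_neutral_right) (use assms(1) pq in auto)
    also have "\<dots> = 0"
      using pq by simp
    finally have "\<forall>x\<in>P. ?c x = 0" by (rule assms(2))
    then have "?c p = 0" using pq(1) by (rule bspec)
    then show False by simp
  qed
  show "independent (v ` P)"
    unfolding dependent_finite[OF finite_imageI[OF assms(1)]]
  proof (intro notI, elim exE conjE bexE)
    fix u y assume "y \<in> v ` P" "u y \<noteq> 0" "(\<Sum>x\<in>v ` P. u x *s x) = 0"
    then show False
      using assms(2)[of "\<lambda>p. u (v p)"] inj by (auto simp: sum.reindex)
  qed
qed

lemma (in vector_space) family_card_le_dim:
  assumes "finite P" and "\<And>c. (\<Sum>p\<in>P. c p *s v p) = 0 \<Longrightarrow> \<forall>p\<in>P. c p = 0"
    and "v ` P \<subseteq> span T" "finite T"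
  shows "card P \<le> dim T"
proof -
  obtain B where B: "B \<subseteq> T" "independent B" "T \<subseteq> span B" "card B = dim T"
    using basis_exists by blast
  have "finite B"
    using B(1) assms(4) finite_subset by blast
  moreover have "v ` P \<subseteq> span B"
    using assms(3) B(3) span_minimal[OF _ subspace_span] by blast
  moreover have "independent (v ` P)" "inj_on v P"
    using family_independent[of P v] assms(1,2) by auto
  ultimately have "card (v ` P) \<le> card B"
    using independent_span_bound by blast
  with \<open>inj_on v P\<close> B(4) show ?thesis by (simp add: card_image)
qed

lemma (in vector_space) span_insert_cong: "span A = span B \<Longrightarrow> span (insert a A) = span (insert a B)"
  by (simp add: span_insert)

text \<open>
  Call \<open>v \<gamma> s\<close> reducible if it is a combination of smaller members of the family. The
  irreducible members form a basis of every initial segment of the family, and the exponents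
  of the reducible ones are closed under addition.
\<close>

lemma (in vector_space) eventually_poly_dim_filtration:
  fixes v :: "('i::finite \<Rightarrow> nat) \<Rightarrow> 's \<Rightarrow> 'b" and X :: "'i \<Rightarrow> 'b \<Rightarrow> 'b"
  assumes S: "finite S" and W: "subspace W"
    and v_mem: "\<And>\<gamma> s. s \<in> S \<Longrightarrow> v \<gamma> s \<in> W"
    and X_add: "\<And>i x y. x \<in> W \<Longrightarrow> y \<in> W \<Longrightarrow> X i (x + y) = X i x + X i y"
    and X_scale: "\<And>i c x. x \<in> W \<Longrightarrow> X i (c *s x) = c *s X i x"
    and X_v: "\<And>i \<gamma> s. s \<in> S \<Longrightarrow>
      X i (v \<gamma> s) - v (\<gamma> + eunit i) s \<in> span {v \<delta> t | \<delta> t. edeg \<delta> \<le> edeg \<gamma> \<and> t \<in> S}"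
  shows "eventually_poly (\<lambda>m. dim {v \<gamma> s | \<gamma> s. edeg \<gamma> \<le> m \<and> s \<in> S})"
proof -
  obtain rk :: "('i \<Rightarrow> nat) \<Rightarrow> nat" where rk: "inj rk" "\<And>\<gamma> \<delta>. edeg \<gamma> < edeg \<delta> \<Longrightarrow> rk \<gamma> < rk \<delta>"
    "\<And>\<gamma> \<delta> \<epsilon>. rk \<gamma> < rk \<delta> \<Longrightarrow> rk (\<gamma> + \<epsilon>) < rk (\<delta> + \<epsilon>)"
    using monomial_rank_exists by metis
  obtain idx where idx: "bij_betw idx S {0..<card S}"
    using ex_bij_betw_finite_nat[OF S] by blast
  then have idx_less: "idx s < card S" if "s \<in> S" for s
    using that by (auto dest: bij_betwE)
  \<comment> \<open>A number in base \<open>card S\<close> with leading part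
    \<open>rk \<gamma>\<close> and last digit \<open>idx s\<close>: pairs are ordered by exponent
    first and by generator second.\<close>
  define \<rho> where "\<rho> \<gamma> s = rk \<gamma> * card S + idx s" for \<gamma> s
  have \<rho>_less: "\<rho> \<gamma> s < \<rho> \<delta> t \<longleftrightarrow> rk \<gamma> < rk \<delta> \<or> rk \<gamma> = rk \<delta> \<and> idx s < idx t"
    if "s \<in> S" "t \<in> S" for \<gamma> \<delta> s t
  proof -
    have less: "\<rho> \<gamma> s < \<rho> \<delta> t" if "rk \<gamma> < rk \<delta>" "s \<in> S" for \<gamma> \<delta> s t
    proof -
      have "\<rho> \<gamma> s < Suc (rk \<gamma>) * card S"
        using idx_less[OF that(2)] by (simp add: \<rho>_def)
      also have "\<dots> \<le> rk \<delta> * card S"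
        using that(1) by (intro mult_right_mono) auto
      finally show ?thesis by (simp add: \<rho>_def)
    qed
    show ?thesis
      using less[of \<gamma> \<delta> s t] less[of \<delta> \<gamma> t s] that
      by (cases "rk \<gamma>" "rk \<delta>" rule: linorder_cases) (auto simp: \<rho>_def)
  qed
  have \<rho>_inj: "\<gamma> = \<delta> \<and> s = t" if "\<rho> \<gamma> s = \<rho> \<delta> t" "s \<in> S" "t \<in> S" for \<gamma> \<delta> s t
  proof -
    have "rk \<gamma> = rk \<delta>" "idx s = idx t"
      using \<rho>_less[of s t \<gamma> \<delta>] \<rho>_less[of t s \<delta> \<gamma>] that by (metis less_irrefl linorder_neqE_nat)+
    then show ?thesis
      using rk(1) idx that by (auto simp: inj_eq bij_betw_def inj_on_eq_iff)
  qed
  have \<rho>_shift: "\<rho> (\<gamma> + \<epsilon>) s < \<rho> (\<delta> + \<epsilon>) t" if "\<rho> \<gamma> s < \<rho> \<delta> t" "s \<in> S" "t \<in> S" for \<gamma> \<delta> \<epsilon> s t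
    using that rk(1,3) by (auto simp: \<rho>_less inj_eq)
  have \<rho>_edeg: "\<rho> \<gamma> s < \<rho> \<delta> t" if "edeg \<gamma> < edeg \<delta>" "s \<in> S" "t \<in> S" for \<gamma> \<delta> s t
    using that rk(2) by (auto simp: \<rho>_less)

  define L where "L r = {v \<gamma> s | \<gamma> s. s \<in> S \<and> \<rho> \<gamma> s < r}" for r
  define Red where "Red \<gamma> s \<longleftrightarrow> v \<gamma> s \<in> span (L (\<rho> \<gamma> s))" for \<gamma> s
  have L_mono: "span (L r) \<subseteq> span (L r')" if "r \<le> r'" for r r'
    by (rule span_mono) (use that in \<open>unfold L_def, blast intro: less_le_trans\<close>)
  have L_edeg: "span {v \<delta> t | \<delta> t. edeg \<delta> \<le> edeg \<gamma> \<and> t \<in> S} \<subseteq> span (L (\<rho> (\<gamma> + eunit i) s))"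
    if "s \<in> S" for \<gamma> i s
  proof (rule span_mono, rule subsetI)
    fix x assume "x \<in> {v \<delta> t | \<delta> t. edeg \<delta> \<le> edeg \<gamma> \<and> t \<in> S}"
    then obtain \<delta> t where x: "x = v \<delta> t" "edeg \<delta> \<le> edeg \<gamma>" "t \<in> S"
      by blast
    then have "\<rho> \<delta> t < \<rho> (\<gamma> + eunit i) s"
      using that by (intro \<rho>_edeg) auto
    with x show "x \<in> L (\<rho> (\<gamma> + eunit i) s)"
      by (auto simp: L_def)
  qed
  \<comment> \<open>Apply \<open>X i\<close> to a relation expressing \<open>v \<gamma> s\<close> by
    earlier members: all exponents shift by \<open>eunit i\<close>, and the errors are of lower
    degree, hence earlier still. Membership in \<open>W\<close> is carried along because
    \<open>X i\<close> is linear only there.\<close>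
  have Red_unit: "Red (\<gamma> + eunit i) s" if "Red \<gamma> s" "s \<in> S" for \<gamma> i s
  proof -
    have "x \<in> W \<and> X i x \<in> span (L (\<rho> (\<gamma> + eunit i) s))" if "x \<in> span (L (\<rho> \<gamma> s))" for x
      using that
    proof (induction rule: span_induct_alt)
      case base
      have "X i 0 = 0"
        using X_scale[of 0 i 0] subspace_0[OF W] by simp
      then show ?case using subspace_0[OF W] by (simp add: span_zero)
    next
      case (step c x y)
      then obtain \<delta> t where x: "x = v \<delta> t" "t \<in> S" "\<rho> \<delta> t < \<rho> \<gamma> s"
        by (auto simp: L_def)
      have less: "\<rho> (\<delta> + eunit i) t < \<rho> (\<gamma> + eunit i) s"
        using \<rho>_shift x \<open>s \<in> S\<close> by blast
      have "v (\<delta> + eunit i) t \<in> span (L (\<rho> (\<gamma> + eunit i) s))"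
        by (rule span_base) (use less x in \<open>auto simp: L_def\<close>)
      moreover have "X i x - v (\<delta> + eunit i) t \<in> span (L (\<rho> (\<gamma> + eunit i) s))"
        using X_v[OF x(2), of i \<delta>] L_edeg[OF x(2), of \<delta> i] L_mono[OF less_imp_le[OF less]]
        unfolding x by blast
      ultimately have "X i x \<in> span (L (\<rho> (\<gamma> + eunit i) s))"
        using span_add by fastforce
      moreover have "x \<in> W" "c *s x \<in> W"
        using v_mem x W subspace_scale by auto
      ultimately show ?case
        using step.IH W X_add X_scale \<open>x \<in> W\<close> by (metis span_add span_scale subspace_add)
    qed
    then have "X i (v \<gamma> s) \<in> span (L (\<rho> (\<gamma> + eunit i) s))"
      using \<open>Red \<gamma> s\<close> by (simp add: Red_def)
    moreover have "X i (v \<gamma> s) - v (\<gamma> + eunit i) s \<in> span (L (\<rho> (\<gamma> + eunit i) s))"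
      using X_v[OF \<open>s \<in> S\<close>] L_edeg[OF \<open>s \<in> S\<close>] by blast
    ultimately show ?thesis
      unfolding Red_def using span_diff by fastforce
  qed
  have Red_up: "Red \<delta> s" if "Red \<gamma> s" "s \<in> S" "\<gamma> \<le> \<delta>" for \<gamma> \<delta> s
  proof -
    have "Red (\<gamma> + \<epsilon>) s" for \<epsilon>
    proof (induction \<epsilon> rule: exponent_induct)
      case zero
      show ?case using that by simp
    next
      case (add \<epsilon> i)
      then show ?case unfolding add.assoc[symmetric] by (rule Red_unit[OF _ that(2)])
    qed
    then show ?thesis
      using exponent_diff_add[OF that(3)] by (metis add.commute)
  qed

  define K where "K r = {(s, \<gamma>). s \<in> S \<and> \<rho> \<gamma> s < r \<and> \<not> Red \<gamma> s}" for r
  let ?v = "\<lambda>(s, \<gamma>). v \<gamma> s"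
  \<comment> \<open>Each step of \<open>r\<close> meets at most one pair. A reducible one leaves the
    span alone; an irreducible one lies outside it and keeps the set independent.\<close>
  have K: "inj_on ?v (K r) \<and> independent (?v ` K r) \<and> span (?v ` K r) = span (L r)" for r
  proof (induction r)
    case 0
    have "K 0 = {}" "L 0 = {}"
      by (auto simp: K_def L_def)
    then show ?case by (simp add: independent_empty)
  next
    case (Suc r)
    show ?case
    proof (cases "\<exists>\<gamma> s. s \<in> S \<and> \<rho> \<gamma> s = r")
      case False
      then have "K (Suc r) = K r" "L (Suc r) = L r"
        by (auto simp: K_def L_def less_Suc_eq)
      with Suc show ?thesis by simp
    next
      case True
      then obtain \<gamma> s where \<gamma>s: "s \<in> S" "\<rho> \<gamma> s = r"
        by blast
      have uniq: "\<delta> = \<gamma> \<and> t = s" if "\<rho> \<delta> t = r" "t \<in> S" for \<delta> t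
        using \<rho>_inj that \<gamma>s by blast
      have L: "L (Suc r) = insert (v \<gamma> s) (L r)"
        unfolding L_def less_Suc_eq using \<gamma>s uniq by blast
      show ?thesis
      proof (cases "Red \<gamma> s")
        case True
        then have "K (Suc r) = K r"
          using uniq by (auto simp: K_def less_Suc_eq)
        moreover have "span (L (Suc r)) = span (L r)"
          using True by (simp add: L span_redundant Red_def \<gamma>s)
        ultimately show ?thesis using Suc by simp
      next
        case False
        then have K_Suc: "K (Suc r) = insert (s, \<gamma>) (K r)"
        proof (intro set_eqI, clarify)
          fix t \<delta>
          have "(t, \<delta>) \<in> K (Suc r) \<longleftrightarrow> (t, \<delta>) \<in> K r \<or> (t \<in> S \<and> \<rho> \<delta> t = r \<and> \<not> Red \<delta> t)"
            by (auto simp: K_def less_Suc_eq)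
          also have "(t \<in> S \<and> \<rho> \<delta> t = r \<and> \<not> Red \<delta> t) \<longleftrightarrow> (t, \<delta>) = (s, \<gamma>)"
            using \<gamma>s uniq False by blast
          finally show "(t, \<delta>) \<in> K (Suc r) \<longleftrightarrow> (t, \<delta>) \<in> insert (s, \<gamma>) (K r)"
            by auto
        qed
        have notin: "v \<gamma> s \<notin> span (?v ` K r)"
          using False Suc by (simp add: Red_def \<gamma>s)
        then have notin_image: "v \<gamma> s \<notin> ?v ` K r"
          using span_base by blast
        then have "v \<gamma> s \<notin> ?v ` (K r - {(s, \<gamma>)})"
          by (meson Diff_subset image_mono subsetD)
        moreover have "inj_on ?v (K r)"
          using Suc by simp
        ultimately have "inj_on ?v (K (Suc r))"
          unfolding K_Suc inj_on_insert prod.case by simp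
        moreover have "independent (?v ` K (Suc r))"
          using Suc notin by (simp add: K_Suc independent_insertI)
        moreover have "span (?v ` K (Suc r)) = span (L (Suc r))"
          unfolding K_Suc L image_insert prod.case using Suc by (intro span_insert_cong) simp
        ultimately show ?thesis by blast
      qed
    qed
  qed
  have dim_eq: "dim {v \<gamma> s | \<gamma> s. edeg \<gamma> \<le> m \<and> s \<in> S}
      = (\<Sum>s\<in>S. card {\<gamma>\<in>{\<gamma>. \<not> Red \<gamma> s}. edeg \<gamma> \<le> m})" for m
  proof -
    let ?Q = "S \<times> {\<gamma> :: 'i \<Rightarrow> nat. edeg \<gamma> \<le> m}"
    \<comment> \<open>The ranking refines the degree, so the pairs of degree at most
      \<open>m\<close> form an initial segment; \<open>r\<close> is one past its last position, or 0
      if there are no pairs.\<close>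
    define r where "r = Max (insert 0 ((\<lambda>(s, \<gamma>). Suc (\<rho> \<gamma> s)) ` ?Q))"
    have fin: "finite (insert 0 ((\<lambda>(s, \<gamma>). Suc (\<rho> \<gamma> s)) ` ?Q))"
      using S by simp
    have r_iff: "\<rho> \<gamma> s < r \<longleftrightarrow> edeg \<gamma> \<le> m" if "s \<in> S" for \<gamma> s
    proof
      assume "edeg \<gamma> \<le> m"
      then have "Suc (\<rho> \<gamma> s) \<le> r"
        unfolding r_def using that by (intro Max_ge[OF fin]) auto
      then show "\<rho> \<gamma> s < r" by simp
    next
      assume less: "\<rho> \<gamma> s < r"
      have "r \<in> insert 0 ((\<lambda>(s, \<gamma>). Suc (\<rho> \<gamma> s)) ` ?Q)"
        unfolding r_def by (rule Max_in[OF fin]) simp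
      with less obtain \<delta> t where "t \<in> S" "edeg \<delta> \<le> m" "\<rho> \<gamma> s \<le> \<rho> \<delta> t"
        by auto
      then show "edeg \<gamma> \<le> m"
        using \<rho>_edeg[of \<delta> \<gamma> t s] that by fastforce
    qed
    have "{v \<gamma> s | \<gamma> s. edeg \<gamma> \<le> m \<and> s \<in> S} = L r"
      using r_iff by (auto simp: L_def)
    moreover have "dim (L r) = card (?v ` K r)"
      using K[of r] by (intro dim_eq_card) auto
    moreover have "card (?v ` K r) = card (K r)"
      using K[of r] by (intro card_image) auto
    moreover have "K r = Sigma S (\<lambda>s. {\<gamma>\<in>{\<gamma>. \<not> Red \<gamma> s}. edeg \<gamma> \<le> m})"
      using r_iff by (auto simp: K_def)
    moreover have "finite {\<gamma>\<in>{\<gamma>. \<not> Red \<gamma> s}. edeg \<gamma> \<le> m}" for s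
      by (rule finite_subset[OF _ finite_edeg_le[of m]]) auto
    ultimately show ?thesis using S by (simp add: card_SigmaI)
  qed
  show ?thesis
    unfolding dim_eq
  proof (rule eventually_poly_sum[OF S])
    fix s assume "s \<in> S"
    show "eventually_poly (\<lambda>m. card {\<gamma>\<in>{\<gamma>. \<not> Red \<gamma> s}. edeg \<gamma> \<le> m})"
      by (rule eventually_poly_card_downset) (use Red_up \<open>s \<in> S\<close> in blast)
  qed
qed

subsection \<open>Growth and degree\<close>

text \<open>Horner form: the bound for the quotient polynomial gets multiplied by the variable,
  which soon absorbs the constant term.\<close>

lemma poly_of_nat_ge_lead_coeff:
  fixes p :: "rat poly"
  assumes "0 < lead_coeff p"
  shows "\<forall>\<^sub>F i in sequentially. lead_coeff p \<le> poly p (of_nat i)"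
  using assms
proof (induction p)
  case 0
  then show ?case by simp
next
  case (pCons a q)
  show ?case
  proof (cases "q = 0")
    case True
    then show ?thesis by simp
  next
    case False
    let ?l = "lead_coeff q"
    have l: "lead_coeff (pCons a q) = ?l" "0 < ?l"
      using False pCons.prems by simp_all
    \<comment> \<open>Chosen so that \<open>i * ?l\<close> is at least
      \<open>?l + \<bar>a\<bar>\<close> for all \<open>i \<ge> k\<close>.\<close>
    obtain k :: nat where k: "1 + \<bar>a\<bar> / ?l \<le> of_nat k"
      using real_arch_simple by blast
    have "\<forall>\<^sub>F i in sequentially. k \<le> i"
      by (rule eventually_ge_at_top)
    moreover have "\<forall>\<^sub>F i in sequentially. ?l \<le> poly q (of_nat i)"
      using pCons l by simp
    ultimately show ?thesis
    proof eventually_elim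
      case (elim i)
      have "1 + \<bar>a\<bar> / ?l \<le> (of_nat i :: rat)"
        using k elim(1) by (meson of_nat_le_iff order_trans)
      then have "(1 + \<bar>a\<bar> / ?l) * ?l \<le> of_nat i * ?l"
        using l(2) by (intro mult_right_mono) auto
      then have "?l + \<bar>a\<bar> \<le> of_nat i * ?l"
        using l(2) by (simp add: distrib_right False)
      also have "\<dots> \<le> of_nat i * poly q (of_nat i)"
        by (rule mult_left_mono) (use elim in auto)
      finally show ?case using l(1) by simp
    qed
  qed
qed

lemma poly_of_nat_le_power:
  fixes p :: "rat poly"
  obtains C where "0 \<le> C" "\<And>i. 1 \<le> i \<Longrightarrow> poly p (of_nat i) \<le> C * of_nat i ^ degree p"
proof
  show "0 \<le> (\<Sum>k\<le>degree p. \<bar>coeff p k\<bar>)"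
    by (simp add: sum_nonneg)
  show "poly p (of_nat i) \<le> (\<Sum>k\<le>degree p. \<bar>coeff p k\<bar>) * of_nat i ^ degree p" if "1 \<le> i" for i
    unfolding poly_altdef sum_distrib_right
    by (intro sum_mono mult_mono power_increasing) (use that in auto)
qed

lemma power_bound_imp_le:
  fixes c C :: rat
  assumes "0 < c" "\<forall>\<^sub>F i in sequentially. c * of_nat i ^ a \<le> C * of_nat i ^ b"
  shows "a \<le> b"
proof (rule ccontr)
  assume "\<not> a \<le> b"
  obtain k :: nat where k: "\<bar>C\<bar> / c + 1 \<le> of_nat k"
    using real_arch_simple by blast
  obtain n where n: "\<And>i. n \<le> i \<Longrightarrow> c * of_nat i ^ a \<le> C * of_nat i ^ b"
    using assms(2) by (auto simp: eventually_sequentially)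
  define i where "i = max 1 (max n k)"
  have i: "1 \<le> i" "n \<le> i" "\<bar>C\<bar> / c + 1 \<le> of_nat i"
    using k by (auto simp: i_def max_def intro: order_trans)
  have "c * of_nat i ^ Suc b \<le> c * of_nat i ^ a"
    using \<open>\<not> a \<le> b\<close> i(1) assms(1) by (intro mult_left_mono power_increasing) auto
  also have "\<dots> \<le> C * of_nat i ^ b"
    by (rule n) (fact i)
  finally have "(c * of_nat i) * of_nat i ^ b \<le> C * of_nat i ^ b"
    by (simp add: mult.assoc)
  then have "c * of_nat i \<le> C"
    using i(1) by simp
  also have "C \<le> \<bar>C\<bar>"
    by simp
  also have "\<dots> < (\<bar>C\<bar> / c + 1) * c"
    using assms(1) by (simp add: distrib_right)
  also have "\<dots> \<le> of_nat i * c"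
    using i(3) assms(1) by (intro mult_right_mono) auto
  finally show False
    by (simp add: mult.commute)
qed

lemma degree_eq_growth:
  fixes p :: "rat poly"
  assumes c: "0 < c" and lower: "\<forall>\<^sub>F i in sequentially. c * of_nat i ^ N \<le> poly p (of_nat i)"
    and upper: "\<forall>\<^sub>F i in sequentially. poly p (of_nat i) \<le> C * of_nat i ^ N"
  shows "degree p = N"
proof (rule antisym)
  obtain K where K: "\<And>i. 1 \<le> i \<Longrightarrow> poly p (of_nat i) \<le> K * of_nat i ^ degree p"
    using poly_of_nat_le_power by blast
  have "\<forall>\<^sub>F i in sequentially. c * of_nat i ^ N \<le> K * of_nat i ^ degree p"
    using lower eventually_ge_at_top[of 1]
    by eventually_elim (use K order_trans in blast)
  then show "N \<le> degree p"
    by (rule power_bound_imp_le[OF c])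
  show "degree p \<le> N"
  proof (rule ccontr)
    assume "\<not> degree p \<le> N"
    then have N: "N < degree p" by simp
    then have p: "p \<noteq> 0" by auto
    \<comment> \<open>If the degree exceeded \<open>N\<close>, subtracting this monomial would keep
      the leading coefficient. A positive one makes \<open>q\<close> eventually positive, against
      the upper bound; a negative one contradicts the lower bound.\<close>
    define q where "q = p - monom (\<bar>C\<bar> + 1) N"
    have deg_mon: "degree (monom (\<bar>C\<bar> + 1) N) < degree p"
      using N degree_monom_le order_le_less_trans by blast
    have "degree q = degree p"
      using degree_add_eq_left[of "- monom (\<bar>C\<bar> + 1) N" p] deg_mon by (simp add: q_def)
    moreover have "coeff q (degree p) = lead_coeff p"
      using N by (simp add: q_def)
    ultimately have lead: "lead_coeff q = lead_coeff p"
      by simp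
    show False
    proof (cases "0 < lead_coeff p")
      case True
      then have "\<forall>\<^sub>F i in sequentially. lead_coeff q \<le> poly q (of_nat i)"
        using lead by (intro poly_of_nat_ge_lead_coeff) simp
      then have "\<forall>\<^sub>F i in sequentially. False"
        using upper eventually_ge_at_top[of 1]
      proof eventually_elim
        case (elim i)
        have "(\<bar>C\<bar> + 1) * of_nat i ^ N < poly p (of_nat i)"
          using elim(1) True lead by (simp add: q_def poly_monom)
        also have "\<dots> \<le> C * of_nat i ^ N"
          by (fact elim)
        also have "\<dots> \<le> (\<bar>C\<bar> + 1) * of_nat i ^ N"
          by (rule mult_right_mono) auto
        finally show False by simp
      qed
      then show False by simp
    next
      case False
      then have "0 < lead_coeff (- p)"
        using p by (simp add: less_le not_less)
      then have "\<forall>\<^sub>F i in sequentially. lead_coeff (- p) \<le> poly (- p) (of_nat i)"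
        by (rule poly_of_nat_ge_lead_coeff)
      then have "\<forall>\<^sub>F i in sequentially. False"
        using lower
      proof eventually_elim
        case (elim i)
        have "0 \<le> c * of_nat i ^ N"
          using c by simp
        with elim \<open>0 < lead_coeff (- p)\<close> show False by simp
      qed
      then show False by simp
    qed
  qed
qed

text \<open>With \<open>binomial_le_power\<close> this shows that the number of exponents of degree
  at most \<open>i\<close> in \<open>N\<close> variables is \<open>i ^ N\<close> up to constant
  factors.\<close>

lemma power_le_binomial: "i ^ N \<le> fact N * ((i + N) choose N)"
proof (induction N)
  case (Suc N)
  have "i ^ Suc N \<le> (i + Suc N) * (fact N * ((i + N) choose N))"
    unfolding power_Suc using Suc by (intro mult_le_mono) simp_all
  also have "\<dots> = fact N * (Suc (i + N) * ((i + N) choose N))"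
    by (simp add: algebra_simps)
  also have "\<dots> = fact N * (Suc N * (Suc (i + N) choose Suc N))"
    by (simp only: Suc_times_binomial)
  finally show ?case by (simp add: algebra_simps)
qed simp

lemma binomial_le_power:
  assumes "1 \<le> i"
  shows "(i + N) choose N \<le> (Suc N * i) ^ N"
proof -
  have "(i + N) choose N \<le> (i + N) ^ N"
    by (rule binomial_le_pow) simp
  also have "\<dots> \<le> (Suc N * i) ^ N"
    using assms by (intro power_mono) (auto simp: algebra_simps)
  finally show ?thesis .
qed

section \<open>Monomials of the Weyl algebra\<close>

text \<open>
  As rewrite rules these two also apply to eta-expanded terms, so that they turn exponents
  \<open>\<gamma> + \<delta>\<close> and \<open>0\<close> in argument position into abstractions.
\<close>

declare plus_fun_apply [simp del] zero_fun_apply [simp del]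

text \<open>Stated for any family \<open>g\<close>, so that the x-part and the d-part of a monomial
  are covered at once.\<close>

definition gen_power :: "('i::finite \<Rightarrow> 'a::ring_1) \<Rightarrow> ('i \<Rightarrow> nat) \<Rightarrow> 'a" where
  "gen_power g \<alpha> = Finite_Set.fold (\<lambda>i a. g i ^ \<alpha> i * a) 1 UNIV"

text \<open>Commuting factors may be folded in any order, so the factor belonging to
  \<open>i\<close> can be taken out first.\<close>

lemma gen_power_eunit:
  fixes g :: "'i::finite \<Rightarrow> 'a::ring_1"
  assumes comm: "\<And>i j. g i * g j = g j * g i"
  shows "gen_power g (\<alpha> + eunit i) = g i * gen_power g \<alpha>"
proof -
  have cfc: "comp_fun_commute_on UNIV (\<lambda>i a. g i ^ \<beta> i * a)" for \<beta>
    unfolding comp_fun_commute_def'[symmetric]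
    by (unfold_locales, rule ext, unfold o_apply, rule power_left_commute, rule comm)
  have split: "gen_power g \<beta> = g i ^ \<beta> i * Finite_Set.fold (\<lambda>i a. g i ^ \<beta> i * a) 1 (UNIV - {i})" for \<beta>
    unfolding gen_power_def by (rule comp_fun_commute_on.fold_rec[OF cfc]) auto
  have "Finite_Set.fold (\<lambda>j a. g j ^ (\<alpha> + eunit i) j * a) 1 (UNIV - {i})
      = Finite_Set.fold (\<lambda>j a. g j ^ \<alpha> j * a) 1 (UNIV - {i})"
    by (rule Finite_Set.fold_cong[OF cfc cfc]) (auto simp: eunit_def plus_fun_apply)
  then show ?thesis
    by (simp add: split eunit_def mult.assoc plus_fun_apply)
qed

lemma gen_power_zero [simp]: "gen_power (g :: 'b::finite \<Rightarrow> 'a::ring_1) 0 = 1"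
proof -
  have cfc: "comp_fun_commute_on UNIV (\<lambda>i a :: 'a. a)"
    by unfold_locales simp
  have "Finite_Set.fold (\<lambda>i a :: 'a. a) 1 F = 1" if "finite F" for F :: "'b set"
    using that by (induction F rule: finite_induct)
      (simp_all add: comp_fun_commute_on.fold_insert[OF cfc])
  then show ?thesis by (simp add: gen_power_def zero_fun_apply)
qed

lemma gen_power_commute:
  assumes "\<And>i j. g i * g j = g j * g i"
  shows "gen_power g \<alpha> * g i = g i * gen_power g \<alpha>"
proof (induction \<alpha> rule: exponent_induct)
  case (add \<alpha> j)
  have "g j * gen_power g \<alpha> * g i = g i * (g j * gen_power g \<alpha>)"
    using add assms by (metis mult.assoc)
  then show ?case
    by (simp only: gen_power_eunit[OF assms])
qed simp

text \<open>The commutator with \<open>y\<close> is a derivation that sends \<open>g j\<close> to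
  \<open>c\<close> and kills the other \<open>g i\<close>. It is used with \<open>c = 1\<close> for
  a derivative crossing the variables and with \<open>c = -1\<close> for a variable crossing the
  derivatives.\<close>

lemma gen_power_commutator:
  fixes g :: "'i::finite \<Rightarrow> 'a::ring_1"
  assumes comm: "\<And>i j. g i * g j = g j * g i"
    and y: "\<And>i. y * g i = g i * y + (if i = j then of_int c else 0)"
  shows "y * gen_power g \<alpha>
    = gen_power g \<alpha> * y + of_int (c * int (\<alpha> j)) * gen_power g (\<alpha> - eunit j)"
proof (induction \<alpha> rule: exponent_induct)
  case (add \<alpha> i)
  let ?P = "gen_power g"
  \<comment> \<open>Subtraction of exponents truncates, but wherever it does so the coefficient
    \<open>\<alpha> j\<close> is 0.\<close>
  have gP: "of_int (c * int (\<alpha> j)) * (g i * ?P (\<alpha> - eunit j))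
      = of_int (c * int (\<alpha> j)) * ?P (\<alpha> + eunit i - eunit j)"
  proof (cases "\<alpha> j = 0")
    case False
    then have "\<alpha> + eunit i - eunit j = \<alpha> - eunit j + eunit i"
      by (auto simp: fun_eq_iff eunit_def plus_fun_apply)
    then show ?thesis by (simp only: gen_power_eunit[OF comm])
  qed simp
  have "y * ?P (\<alpha> + eunit i) = (g i * y + (if i = j then of_int c else 0)) * ?P \<alpha>"
    by (simp only: gen_power_eunit[OF comm] mult.assoc[symmetric] y)
  also have "\<dots> = g i * (y * ?P \<alpha>) + (if i = j then of_int c else 0) * ?P \<alpha>"
    by (simp only: distrib_right mult.assoc)
  also have "g i * (y * ?P \<alpha>)
      = g i * ?P \<alpha> * y + g i * of_int (c * int (\<alpha> j)) * ?P (\<alpha> - eunit j)"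
    by (simp only: add.IH distrib_left mult.assoc)
  also have "g i * of_int (c * int (\<alpha> j)) * ?P (\<alpha> - eunit j)
      = of_int (c * int (\<alpha> j)) * ?P (\<alpha> + eunit i - eunit j)"
    by (simp only: mult_of_int_commute[symmetric] mult.assoc gP)
  finally have eq: "y * ?P (\<alpha> + eunit i) = ?P (\<alpha> + eunit i) * y
      + of_int (c * int (\<alpha> j)) * ?P (\<alpha> + eunit i - eunit j)
      + (if i = j then of_int c else 0) * ?P \<alpha>"
    by (simp only: gen_power_eunit[OF comm])
  show ?case
  proof (cases "i = j")
    case True
    have "\<alpha> + eunit j - eunit j = \<alpha>" "(\<alpha> + eunit j) j = Suc (\<alpha> j)"
      by (simp_all add: eunit_def plus_fun_apply)
    then show ?thesis
      unfolding eq unfolding True by (simp add: algebra_simps)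
  next
    case False
    then have "(\<alpha> + eunit i) j = \<alpha> j"
      by (simp add: eunit_def plus_fun_apply)
    then show ?thesis
      using False by (simp only: eq if_False mult_zero_left add_0_right)
  qed
next
  case zero
  have "(0 :: 'i \<Rightarrow> nat) j = 0" by (rule zero_fun_apply)
  then show ?case by simp
qed

text \<open>Here the sum type separates the two kinds of generators. In the enveloping algebra
  \<open>'n + 'n\<close> indexes the variables, so its generators are indexed by nested
  sums.\<close>

definition wgen :: "'n + 'n \<Rightarrow> ('n, 'k::field) weyl" where
  "wgen = case_sum weyl_x weyl_d"

lemma wgen_simps [simp]: "wgen (Inl i) = weyl_x i" "wgen (Inr i) = weyl_d i"
  by (simp_all add: wgen_def)

definition wmon :: "('n::finite + 'n \<Rightarrow> nat) \<Rightarrow> ('n, 'k::field) weyl" where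
  "wmon \<gamma> = weyl_monomial (\<gamma> \<circ> Inl) (\<gamma> \<circ> Inr)"

lemma wmon_eq: "wmon \<gamma> = gen_power weyl_x (\<gamma> \<circ> Inl) * gen_power weyl_d (\<gamma> \<circ> Inr)"
  by (simp add: wmon_def weyl_monomial_def gen_power_def)

lemma wmon_zero [simp]: "wmon 0 = 1"
proof -
  have "(0 :: 'a + 'a \<Rightarrow> nat) \<circ> Inl = 0" "(0 :: 'a + 'a \<Rightarrow> nat) \<circ> Inr = 0"
    by (simp_all add: fun_eq_iff zero_fun_apply)
  then show ?thesis by (simp add: wmon_eq)
qed

lemma exponent_sum_comp:
  fixes \<gamma> :: "'n + 'n \<Rightarrow> nat"
  shows "(\<gamma> + eunit (Inl i)) \<circ> Inl = (\<gamma> \<circ> Inl) + eunit i" "(\<gamma> + eunit (Inl i)) \<circ> Inr = \<gamma> \<circ> Inr"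
    "(\<gamma> + eunit (Inr i)) \<circ> Inl = \<gamma> \<circ> Inl" "(\<gamma> + eunit (Inr i)) \<circ> Inr = (\<gamma> \<circ> Inr) + eunit i"
    "(\<gamma> - eunit (Inl i)) \<circ> Inl = (\<gamma> \<circ> Inl) - eunit i" "(\<gamma> - eunit (Inl i)) \<circ> Inr = \<gamma> \<circ> Inr"
    "(\<gamma> - eunit (Inr i)) \<circ> Inl = \<gamma> \<circ> Inl" "(\<gamma> - eunit (Inr i)) \<circ> Inr = (\<gamma> \<circ> Inr) - eunit i"
  by (auto simp: fun_eq_iff eunit_def plus_fun_apply)

lemma weyl_x_wmon: "weyl_x i * wmon \<gamma> = wmon (\<gamma> + eunit (Inl i))"
  by (simp only: wmon_eq exponent_sum_comp gen_power_eunit[OF weyl_x_commute] mult.assoc)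

lemma wmon_weyl_d: "wmon \<gamma> * weyl_d i = wmon (\<gamma> + eunit (Inr i))"
  unfolding wmon_eq exponent_sum_comp gen_power_eunit[OF weyl_d_commute] mult.assoc
  by (intro arg_cong[where f = "(*) _"] gen_power_commute weyl_d_commute)

lemma weyl_d_wmon:
  "weyl_d i * wmon \<gamma> = wmon (\<gamma> + eunit (Inr i)) + of_nat (\<gamma> (Inl i)) * wmon (\<gamma> - eunit (Inl i))"
proof -
  have y: "weyl_d i * weyl_x j = weyl_x j * weyl_d i + (if j = i then of_int 1 else 0)"
    for j :: 'a
    using weyl_d_x[of i j] by (cases "j = i") (simp_all add: diff_eq_eq add.commute)
  have "weyl_d i * gen_power weyl_x (\<gamma> \<circ> Inl) = gen_power weyl_x (\<gamma> \<circ> Inl) * weyl_d i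
      + of_nat (\<gamma> (Inl i)) * gen_power weyl_x ((\<gamma> \<circ> Inl) - eunit i)"
    using gen_power_commutator[OF weyl_x_commute y, of "\<gamma> \<circ> Inl"] by simp
  then have "weyl_d i * wmon \<gamma> = (gen_power weyl_x (\<gamma> \<circ> Inl) * weyl_d i
      + of_nat (\<gamma> (Inl i)) * gen_power weyl_x ((\<gamma> \<circ> Inl) - eunit i)) * gen_power weyl_d (\<gamma> \<circ> Inr)"
    unfolding wmon_eq mult.assoc[symmetric] by (rule arg_cong)
  then show ?thesis
    by (simp only: wmon_eq distrib_right exponent_sum_comp gen_power_eunit[OF weyl_d_commute] mult.assoc)
qed

lemma wmon_weyl_x:
  "(wmon \<gamma> :: ('n::finite, 'k::field) weyl) * weyl_x i = wmon (\<gamma> + eunit (Inl i)) + of_nat (\<gamma> (Inr i)) * wmon (\<gamma> - eunit (Inr i))"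
proof -
  have y: "(weyl_x i :: ('n, 'k) weyl) * weyl_d j = weyl_d j * weyl_x i + (if j = i then of_int (- 1) else 0)"
    for j :: 'n
  proof -
    have *: "(weyl_d j :: ('n, 'k) weyl) * weyl_x i = (if j = i then 1 else 0) + weyl_x i * weyl_d j"
      using weyl_d_x[of j i] by (simp add: diff_eq_eq)
    show ?thesis unfolding * by simp
  qed
  have "(weyl_x i :: ('n, 'k) weyl) * gen_power weyl_d (\<gamma> \<circ> Inr) = gen_power weyl_d (\<gamma> \<circ> Inr) * weyl_x i
      - of_nat (\<gamma> (Inr i)) * gen_power weyl_d ((\<gamma> \<circ> Inr) - eunit i)"
    using gen_power_commutator[OF weyl_d_commute y, of "\<gamma> \<circ> Inr"] by simp
  then have "(gen_power weyl_d (\<gamma> \<circ> Inr) :: ('n, 'k) weyl) * weyl_x i = weyl_x i * gen_power weyl_d (\<gamma> \<circ> Inr)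
      + of_nat (\<gamma> (Inr i)) * gen_power weyl_d ((\<gamma> \<circ> Inr) - eunit i)"
    by (metis diff_add_cancel)
  then have "(wmon \<gamma> :: ('n, 'k) weyl) * weyl_x i = gen_power weyl_x (\<gamma> \<circ> Inl) * weyl_x i * gen_power weyl_d (\<gamma> \<circ> Inr)
      + gen_power weyl_x (\<gamma> \<circ> Inl) * of_nat (\<gamma> (Inr i)) * gen_power weyl_d ((\<gamma> \<circ> Inr) - eunit i)"
    unfolding wmon_eq mult.assoc distrib_left[symmetric] by (rule arg_cong)
  moreover have "(gen_power weyl_x (\<gamma> \<circ> Inl) :: ('n, 'k) weyl) * (weyl_x i * gen_power weyl_d (\<gamma> \<circ> Inr))
      = weyl_x i * (gen_power weyl_x (\<gamma> \<circ> Inl) * gen_power weyl_d (\<gamma> \<circ> Inr))"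
    unfolding mult.assoc[symmetric]
    by (intro arg_cong[where f = "\<lambda>a. a * _"] gen_power_commute weyl_x_commute)
  ultimately show ?thesis
    by (simp only: wmon_eq distrib_right exponent_sum_comp gen_power_eunit[OF weyl_x_commute]
        mult.assoc mult_of_nat_commute[symmetric])
qed

text \<open>A derivative multiplied from the left creates a correction term if variables are
  present. Variables are therefore removed first and derivatives only when no variable is left, so
  that the step comes with an exact product.\<close>

lemma wmon_induct_left [case_names zero add]:
  assumes "P 0"
    and "\<And>\<gamma> i. P \<gamma> \<Longrightarrow> (wmon (\<gamma> + eunit i) :: ('n::finite, 'k::field) weyl) = wgen i * wmon \<gamma> \<Longrightarrow>
      P (\<gamma> + eunit i)"
  shows "P \<gamma>"
proof (induction "edeg \<gamma>" arbitrary: \<gamma>)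
  case 0
  then show ?case using assms(1) by (metis edeg_eq_0_iff)
next
  case (Suc m)
  have *: "P \<gamma>" if "0 < \<gamma> i" "(wmon (\<gamma> - eunit i + eunit i) :: ('n, 'k) weyl) = wgen i * wmon (\<gamma> - eunit i)" for i
  proof -
    have eq: "\<gamma> - eunit i + eunit i = \<gamma>"
      using that by (intro exponent_diff_add) (simp add: eunit_le_iff)
    then have "edeg (\<gamma> - eunit i) + 1 = edeg \<gamma>"
      by (metis edeg_add edeg_eunit)
    then show ?thesis
      using Suc assms(2)[OF _ that(2)] eq by simp
  qed
  show ?case
  proof (cases "\<exists>i. 0 < \<gamma> (Inl i)")
    case True
    then show ?thesis using * by (force simp only: wgen_simps weyl_x_wmon)
  next
    case False
    have "\<gamma> \<noteq> 0" using Suc.hyps(2) by auto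
    then obtain j where j: "0 < \<gamma> j" by (auto simp: fun_eq_iff zero_fun_apply)
    with False obtain i where i: "j = Inr i" by (cases j) auto
    have "wgen j * (wmon (\<gamma> - eunit j) :: ('n, 'k) weyl) = wmon (\<gamma> - eunit j + eunit j)"
      using False by (simp only: i wgen_simps weyl_d_wmon) (simp add: eunit_def)
    with * j show ?thesis by metis
  qed
qed

text \<open>The mirror image: derivatives are removed first, and variables only when no derivative
  is left.\<close>

lemma wmon_induct_right [case_names zero add]:
  assumes "P 0"
    and "\<And>\<gamma> i. P \<gamma> \<Longrightarrow> (wmon (\<gamma> + eunit i) :: ('n::finite, 'k::field) weyl) = wmon \<gamma> * wgen i \<Longrightarrow>
      P (\<gamma> + eunit i)"
  shows "P \<gamma>"
proof (induction "edeg \<gamma>" arbitrary: \<gamma>)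
  case 0
  then show ?case using assms(1) by (metis edeg_eq_0_iff)
next
  case (Suc m)
  have *: "P \<gamma>" if "0 < \<gamma> i" "(wmon (\<gamma> - eunit i + eunit i) :: ('n, 'k) weyl) = wmon (\<gamma> - eunit i) * wgen i" for i
  proof -
    have eq: "\<gamma> - eunit i + eunit i = \<gamma>"
      using that by (intro exponent_diff_add) (simp add: eunit_le_iff)
    then have "edeg (\<gamma> - eunit i) + 1 = edeg \<gamma>"
      by (metis edeg_add edeg_eunit)
    then show ?thesis
      using Suc assms(2)[OF _ that(2)] eq by simp
  qed
  show ?case
  proof (cases "\<exists>i. 0 < \<gamma> (Inr i)")
    case True
    then show ?thesis using * by (force simp only: wgen_simps wmon_weyl_d)
  next
    case False
    have "\<gamma> \<noteq> 0" using Suc.hyps(2) by auto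
    then obtain j where j: "0 < \<gamma> j" by (auto simp: fun_eq_iff zero_fun_apply)
    with False obtain i where i: "j = Inl i" by (cases j) auto
    have "(wmon (\<gamma> - eunit j) :: ('n, 'k) weyl) * wgen j = wmon (\<gamma> - eunit j + eunit j)"
      using False by (simp only: i wgen_simps wmon_weyl_x) (simp add: eunit_def)
    with * j show ?thesis by metis
  qed
qed

subsection \<open>Constants and generators\<close>

lemma weyl_const_commute: "weyl_const c * a = a * weyl_const c"
proof transfer
  fix c :: 'b and p :: "('a gen, 'b) free_algebra"
  have "free_const c * p = p * free_const c"
    by (induction p rule: free_algebra_induct)
      (simp_all add: free_const_def mult_single algebra_simps)
  then show "free_const c * p - p * free_const c \<in> weyl_ideal"
    by (simp add: weyl_ideal.zero)
qed

lemma weyl_scale_mult_right: "a * weyl_scale c b = weyl_scale c (a * b)"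
  unfolding weyl_scale_def by (metis mult.assoc weyl_const_commute)

lemma weyl_scale_mult_left: "weyl_scale c a * b = weyl_scale c (a * b)"
  by (simp add: weyl_scale_def mult.assoc)

lemma of_nat_weyl: "of_nat k = weyl_const (of_nat k)"
  by (induction k) simp_all

lemma of_nat_mult_weyl: "of_nat k * a = weyl_scale (of_nat k) a"
  by (simp add: of_nat_weyl weyl_scale_def)

lemma weyl_induct [case_names one gen scale add]:
  assumes "P 1" and gen: "\<And>a i. P a \<Longrightarrow> P (wgen i * a)"
    and scale: "\<And>a c. P a \<Longrightarrow> P (weyl_scale c a)"
    and add: "\<And>a b. P a \<Longrightarrow> P b \<Longrightarrow> P (a + b)"
  shows "P (a :: ('n, 'k::field) weyl)"
proof -
  have gen': "P (abs_weyl (free_gen g) * a)" if "P a" for g a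
    using gen[OF that, of "Inl i" for i] gen[OF that, of "Inr i" for i]
    by (cases g) (simp_all add: weyl_x.abs_eq weyl_d.abs_eq)
  have word: "P (abs_weyl (Poly_Mapping.single (Word gs) 1))" for gs :: "'n gen list"
  proof (induction gs)
    case Nil
    have "Poly_Mapping.single (Word []) 1 = (1 :: ('n gen, 'k) free_algebra)"
      by (simp flip: zero_word_def)
    then show ?case using assms(1) by (simp add: one_weyl.abs_eq)
  next
    case (Cons g gs)
    have "Poly_Mapping.single (Word (g # gs)) (1 :: 'k) = free_gen g * Poly_Mapping.single (Word gs) 1"
      by (simp add: free_gen_def mult_single plus_word_def)
    then show ?case using gen'[OF Cons] by (simp add: times_weyl.abs_eq)
  qed
  have "P (abs_weyl p)" for p :: "('n gen, 'k) free_algebra"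
  proof (induction p rule: free_algebra_induct)
    case zero
    \<comment> \<open>Zero is covered as the scalar multiple of one by 0.\<close>
    have "weyl_scale 0 1 = (abs_weyl 0 :: ('n, 'k) weyl)"
      by (simp add: weyl_scale_def zero_weyl.abs_eq[symmetric])
    then show ?case using scale[OF assms(1), of 0] by simp
  next
    case (single w c)
    have "Poly_Mapping.single w c = free_const c * Poly_Mapping.single (Word (letters w)) 1"
      by (simp add: free_const_def mult_single)
    then have "abs_weyl (Poly_Mapping.single w c)
        = weyl_scale c (abs_weyl (Poly_Mapping.single (Word (letters w)) 1))"
      by (simp add: times_weyl.abs_eq weyl_scale_def weyl_const.abs_eq)
    then show ?case using scale[OF word[of "letters w"], of c] by simp
  next
    case (add p q)
    then show ?case using assms(4) by (simp add: plus_weyl.abs_eq[symmetric])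
  qed
  then show ?thesis by (rule weyl.abs_induct)
qed

interpretation weyl: vector_space weyl_scale
  by (rule vector_space_weyl_scale)

subsection \<open>The Bernstein filtration\<close>

lemma edeg_comp_sum: "(\<Sum>i\<in>UNIV. (\<gamma> \<circ> Inl) i) + (\<Sum>i\<in>UNIV. (\<gamma> \<circ> Inr) i) = edeg \<gamma>"
  unfolding edeg_def UNIV_Plus_UNIV[symmetric] by (subst sum.Plus) (auto simp: comp_def)

lemma bernstein_eq: "bernstein m = weyl.span (wmon ` {\<gamma>. edeg \<gamma> \<le> m})"
proof -
  have "{weyl_monomial \<alpha> \<beta> | \<alpha> \<beta>. (\<Sum>i\<in>UNIV. \<alpha> i) + (\<Sum>i\<in>UNIV. \<beta> i) \<le> m}
      = (wmon ` {\<gamma>. edeg \<gamma> \<le> m} :: ('a::finite, 'b::field) weyl set)"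
  proof (intro equalityI subsetI)
    fix a :: "('a, 'b) weyl"
    assume "a \<in> {weyl_monomial \<alpha> \<beta> | \<alpha> \<beta>. (\<Sum>i\<in>UNIV. \<alpha> i) + (\<Sum>i\<in>UNIV. \<beta> i) \<le> m}"
    then obtain \<alpha> \<beta> where a: "a = weyl_monomial \<alpha> \<beta>" "(\<Sum>i\<in>UNIV. \<alpha> i) + (\<Sum>i\<in>UNIV. \<beta> i) \<le> m"
      by blast
    have "case_sum \<alpha> \<beta> \<circ> Inl = \<alpha>" "case_sum \<alpha> \<beta> \<circ> Inr = \<beta>"
      by (simp_all add: fun_eq_iff)
    with a edeg_comp_sum[of "case_sum \<alpha> \<beta>"] show "a \<in> wmon ` {\<gamma>. edeg \<gamma> \<le> m}"
      by (intro image_eqI[of _ _ "case_sum \<alpha> \<beta>"]) (simp_all add: wmon_def)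
  next
    fix a :: "('a, 'b) weyl"
    assume "a \<in> wmon ` {\<gamma>. edeg \<gamma> \<le> m}"
    then obtain \<gamma> where "a = weyl_monomial (\<gamma> \<circ> Inl) (\<gamma> \<circ> Inr)" "edeg \<gamma> \<le> m"
      by (auto simp: wmon_def)
    then show "a \<in> {weyl_monomial \<alpha> \<beta> | \<alpha> \<beta>. (\<Sum>i\<in>UNIV. \<alpha> i) + (\<Sum>i\<in>UNIV. \<beta> i) \<le> m}"
      using edeg_comp_sum[of \<gamma>]
      by (intro CollectI exI[of _ "\<gamma> \<circ> Inl"] exI[of _ "\<gamma> \<circ> Inr"]) simp
  qed
  then show ?thesis by (simp add: bernstein_def)
qed

text \<open>The strict bound describes error terms uniformly, including degree 0, where it gives the
  zero space.\<close>

definition weyl_less :: "nat \<Rightarrow> ('n::finite, 'k::field) weyl set" where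
  "weyl_less m = weyl.span (wmon ` {\<gamma>. edeg \<gamma> < m})"

lemma bernstein_weyl_less: "bernstein m = weyl_less (Suc m)"
  by (simp add: bernstein_eq weyl_less_def less_Suc_eq_le)

lemma weyl_less_mono: "m \<le> m' \<Longrightarrow> weyl_less m \<subseteq> weyl_less m'"
  unfolding weyl_less_def by (intro weyl.span_mono image_mono) auto

lemma bernstein_mono: "m \<le> m' \<Longrightarrow> bernstein m \<subseteq> bernstein m'"
  by (simp add: bernstein_weyl_less weyl_less_mono)

lemma subspace_bernstein: "weyl.subspace (bernstein m)"
  by (simp add: bernstein_eq)

lemma wmon_weyl_less: "edeg \<gamma> < m \<Longrightarrow> wmon \<gamma> \<in> weyl_less m"
  unfolding weyl_less_def by (rule weyl.span_base) simp

lemma wmon_bernstein: "edeg \<gamma> \<le> m \<Longrightarrow> wmon \<gamma> \<in> bernstein m"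
  by (simp add: bernstein_weyl_less wmon_weyl_less)

lemma of_nat_wmon_lower: "of_nat (\<gamma> i) * wmon (\<gamma> - eunit i) \<in> weyl_less (edeg \<gamma>)"
proof (cases "\<gamma> i = 0")
  case True
  then show ?thesis by (simp add: weyl_less_def weyl.span_zero)
next
  case False
  then have "\<gamma> - eunit i + eunit i = \<gamma>"
    by (intro exponent_diff_add) (simp add: eunit_le_iff)
  then have "edeg (\<gamma> - eunit i) < edeg \<gamma>"
    by (metis edeg_add edeg_eunit less_add_one)
  then have "weyl_scale (of_nat (\<gamma> i)) (wmon (\<gamma> - eunit i)) \<in> weyl_less (edeg \<gamma>)"
    unfolding weyl_less_def by (intro weyl.span_scale weyl.span_base) simp
  then show ?thesis by (simp add: of_nat_mult_weyl)
qed

text \<open>The generators commute up to lower order: moving a derivative across variables costs one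
  variable and the derivative itself.\<close>

lemma wgen_wmon: "wgen i * wmon \<gamma> - wmon (\<gamma> + eunit i) \<in> weyl_less (edeg \<gamma>)"
proof (cases i)
  case (Inl j)
  then show ?thesis by (simp add: weyl_x_wmon weyl_less_def weyl.span_zero)
next
  case (Inr j)
  then show ?thesis using of_nat_wmon_lower by (simp add: weyl_d_wmon)
qed

lemma wmon_wgen: "wmon \<gamma> * wgen i - wmon (\<gamma> + eunit i) \<in> weyl_less (edeg \<gamma>)"
proof (cases i)
  case (Inr j)
  then show ?thesis by (simp add: wmon_weyl_d weyl_less_def weyl.span_zero)
next
  case (Inl j)
  then show ?thesis using of_nat_wmon_lower by (simp add: wmon_weyl_x)
qed

lemma weyl_span_left_mult:
  assumes "a \<in> weyl.span S" "\<And>s. s \<in> S \<Longrightarrow> b * s \<in> weyl.span T"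
  shows "b * a \<in> weyl.span T"
  using assms(1)
  by (induction rule: weyl.span_induct_alt)
    (auto simp: distrib_left weyl_scale_mult_right
      intro: weyl.span_zero weyl.span_add weyl.span_scale assms(2))

lemma weyl_span_right_mult:
  assumes "a \<in> weyl.span S" "\<And>s. s \<in> S \<Longrightarrow> s * b \<in> weyl.span T"
  shows "a * b \<in> weyl.span T"
  using assms(1)
  by (induction rule: weyl.span_induct_alt)
    (auto simp: distrib_right weyl_scale_mult_left
      intro: weyl.span_zero weyl.span_add weyl.span_scale assms(2))

lemma weyl_less_add: "a \<in> weyl_less m \<Longrightarrow> b \<in> weyl_less m \<Longrightarrow> a + b \<in> weyl_less m"
  unfolding weyl_less_def by (rule weyl.span_add)

lemma wgen_weyl_less:
  assumes "a \<in> weyl_less m"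
  shows "wgen i * a \<in> weyl_less (Suc m)"
  unfolding weyl_less_def
proof (rule weyl_span_left_mult[OF assms[unfolded weyl_less_def]], elim imageE CollectE)
  fix s \<gamma> assume s: "s = (wmon \<gamma> :: ('a, 'b) weyl)" "edeg \<gamma> < m"
  then have "wgen i * wmon \<gamma> - wmon (\<gamma> + eunit i) \<in> weyl_less (Suc m)"
    using wgen_wmon[of i \<gamma>] weyl_less_mono[of "edeg \<gamma>" "Suc m"] by auto
  moreover have "wmon (\<gamma> + eunit i) \<in> weyl_less (Suc m)"
    using s by (intro wmon_weyl_less) simp
  ultimately show "wgen i * s \<in> weyl.span (wmon ` {\<gamma>. edeg \<gamma> < Suc m})"
    unfolding s(1) weyl_less_def using weyl.span_add by fastforce
qed

lemma weyl_less_wgen: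
  assumes "a \<in> weyl_less m"
  shows "a * wgen i \<in> weyl_less (Suc m)"
  unfolding weyl_less_def
proof (rule weyl_span_right_mult[OF assms[unfolded weyl_less_def]], elim imageE CollectE)
  fix s \<gamma> assume s: "s = (wmon \<gamma> :: ('a, 'b) weyl)" "edeg \<gamma> < m"
  then have "wmon \<gamma> * wgen i - wmon (\<gamma> + eunit i) \<in> weyl_less (Suc m)"
    using wmon_wgen[of \<gamma> i] weyl_less_mono[of "edeg \<gamma>" "Suc m"] by auto
  moreover have "wmon (\<gamma> + eunit i) \<in> weyl_less (Suc m)"
    using s by (intro wmon_weyl_less) simp
  ultimately show "s * wgen i \<in> weyl.span (wmon ` {\<gamma>. edeg \<gamma> < Suc m})"
    unfolding s(1) weyl_less_def using weyl.span_add by fastforce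
qed

text \<open>Building \<open>\<gamma>\<close> from the left keeps \<open>\<delta>\<close> fixed. Each
  step adds the error of \<open>wgen_wmon\<close> and raises the old error by one degree.\<close>

lemma wmon_mult: "wmon \<gamma> * wmon \<delta> - wmon (\<gamma> + \<delta>) \<in> (weyl_less (edeg \<gamma> + edeg \<delta>) :: ('n::finite, 'k::field) weyl set)"
proof (induction \<gamma> rule: wmon_induct_left[where 'n = 'n and 'k = 'k])
  case zero
  then show ?case by (simp add: weyl_less_def weyl.span_zero)
next
  case (add \<gamma> i)
  let ?l = "wmon \<gamma> * wmon \<delta> - wmon (\<gamma> + \<delta>) :: ('n, 'k) weyl"
  have "wgen i * wmon (\<gamma> + \<delta>) - (wmon (\<gamma> + \<delta> + eunit i) :: ('n, 'k) weyl)
      \<in> weyl_less (Suc (edeg \<gamma> + edeg \<delta>))"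
    using wgen_wmon[of i "\<gamma> + \<delta>"] weyl_less_mono[of "edeg (\<gamma> + \<delta>)" "Suc (edeg \<gamma> + edeg \<delta>)"] by auto
  moreover have "wgen i * ?l \<in> weyl_less (Suc (edeg \<gamma> + edeg \<delta>))"
    by (rule wgen_weyl_less[OF add(1)])
  moreover have "wgen i * wmon \<gamma> * wmon \<delta> - wmon (\<gamma> + \<delta> + eunit i)
      = (wgen i * wmon (\<gamma> + \<delta>) - wmon (\<gamma> + \<delta> + eunit i)) + wgen i * ?l"
    by (simp only: right_diff_distrib mult.assoc) simp
  ultimately have "wgen i * wmon \<gamma> * wmon \<delta> - (wmon (\<gamma> + \<delta> + eunit i) :: ('n, 'k) weyl)
      \<in> weyl_less (Suc (edeg \<gamma> + edeg \<delta>))"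
    by (simp only: weyl_less_add)
  moreover have "\<gamma> + eunit i + \<delta> = \<gamma> + \<delta> + eunit i"
    by (simp only: add.assoc add.commute[of \<delta>])
  ultimately show ?case
    by (simp only: add(2) edeg_add edeg_eunit) simp
qed

lemma bernstein_mult:
  assumes "a \<in> bernstein i" "b \<in> bernstein j"
  shows "a * b \<in> (bernstein (i + j) :: ('n::finite, 'k::field) weyl set)"
proof -
  have "a * wmon \<gamma> \<in> bernstein (i + edeg \<gamma>)" for \<gamma>
  proof (induction \<gamma> rule: wmon_induct_right[where 'n = 'n and 'k = 'k])
    case zero
    show ?case using assms(1) by simp
  next
    case (add \<gamma> k)
    then show ?case
      using weyl_less_wgen by (simp only: bernstein_weyl_less mult.assoc[symmetric] edeg_add edeg_eunit) simp
  qed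
  then have "a * wmon \<gamma> \<in> bernstein (i + j)" if "edeg \<gamma> \<le> j" for \<gamma>
    using bernstein_mono[of "i + edeg \<gamma>" "i + j"] that by auto
  then show ?thesis
    using assms(2) unfolding bernstein_eq by (elim weyl_span_left_mult imageE CollectE) simp
qed

lemma ex_bernstein: "\<exists>m. a \<in> (bernstein m :: ('n::finite, 'k::field) weyl set)"
proof (induction a rule: weyl_induct)
  case one
  show ?case using wmon_bernstein[of 0 0] by auto
next
  case (gen a i)
  then show ?case using wgen_weyl_less unfolding bernstein_weyl_less by blast
next
  case (scale a c)
  then show ?case using weyl.subspace_scale[OF subspace_bernstein] by blast
next
  case (add a b)
  then obtain m m' where "a \<in> bernstein m" "b \<in> bernstein m'" by blast
  then have "a \<in> bernstein (max m m')" "b \<in> bernstein (max m m')"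
    using bernstein_mono[of m "max m m'"] bernstein_mono[of m' "max m m'"] by auto
  then show ?case using weyl.subspace_add[OF subspace_bernstein] by blast
qed

subsection \<open>Linear independence of the monomials\<close>

text \<open>The representation on power series descends to the quotient; independence of the
  monomials is tested in it.\<close>

lift_definition weyl_series ::
    "('n, 'k::field) weyl \<Rightarrow> (('n \<Rightarrow> nat) \<Rightarrow> 'k) \<Rightarrow> ('n \<Rightarrow> nat) \<Rightarrow> 'k" is series_act
proof -
  fix p q :: "('n gen, 'k) free_algebra"
  assume "p - q \<in> weyl_ideal"
  then have "series_act p f \<alpha> = series_act q f \<alpha>" for f \<alpha>
    using series_act_weyl_ideal[of "p - q" f] by (simp add: series_act_diff fun_eq_iff)
  then show "series_act p = series_act q"
    by (simp add: fun_eq_iff)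
qed

lemma weyl_series_mult: "weyl_series (a * b) f = weyl_series a (weyl_series b f)"
  by transfer (rule series_act_mult)

lemma weyl_series_add: "weyl_series (a + b) f = (\<lambda>\<alpha>. weyl_series a f \<alpha> + weyl_series b f \<alpha>)"
  by transfer (rule series_act_add)

lemma weyl_series_zero [simp]: "weyl_series 0 f = (\<lambda>_. 0)"
  by transfer (rule series_act_zero)

lemma weyl_series_one [simp]: "weyl_series 1 f = f"
  by transfer (rule series_act_one)

lemma weyl_series_const: "weyl_series (weyl_const c) f = (\<lambda>\<alpha>. c * f \<alpha>)"
  by transfer (simp add: free_const_def series_act_single series_word_def zero_word_def)

lemma weyl_series_x: "weyl_series (weyl_x i) f = series_gen (GenX i) f"
  by transfer (rule series_act_gen)

lemma weyl_series_d: "weyl_series (weyl_d i) f = series_gen (GenD i) f"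
  by transfer (rule series_act_gen)

lemma weyl_series_scale: "weyl_series (weyl_scale c a) f = (\<lambda>\<alpha>. c * weyl_series a f \<alpha>)"
  by (simp add: weyl_scale_def weyl_series_mult weyl_series_const)

lemma weyl_series_smult: "weyl_series a (\<lambda>\<alpha>. c * f \<alpha>) = (\<lambda>\<alpha>. c * weyl_series a f \<alpha>)"
  unfolding weyl_series_const[symmetric] weyl_series_mult[symmetric] by (simp only: weyl_const_commute)

lemma weyl_series_sum: "weyl_series (\<Sum>p\<in>P. h p) f \<alpha> = (\<Sum>p\<in>P. weyl_series (h p) f \<alpha>)"
  by (induction P rule: infinite_finite_induct) (simp_all add: weyl_series_add)

text \<open>The power series consisting of the single monomial with exponent
  \<open>\<nu>\<close>.\<close>

definition delta :: "('n \<Rightarrow> nat) \<Rightarrow> ('n \<Rightarrow> nat) \<Rightarrow> 'k::field" where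
  "delta \<nu> \<alpha> = (if \<alpha> = \<nu> then 1 else 0)"

lemma weyl_series_x_delta:
  "weyl_series (weyl_x i) (delta \<nu>) = (delta (\<nu> + eunit i) :: ('n \<Rightarrow> nat) \<Rightarrow> 'b::field)"
proof -
  have *: "\<alpha> i \<noteq> 0 \<and> \<alpha>(i := \<alpha> i - 1) = \<nu> \<longleftrightarrow> \<alpha> = \<nu> + eunit i" for \<alpha>
  proof (intro iffI conjI; (elim conjE)?)
    show "\<alpha> = \<nu> + eunit i" if "\<alpha> i \<noteq> 0" "\<alpha>(i := \<alpha> i - 1) = \<nu>"
      unfolding that(2)[symmetric] using that(1) by (auto simp: fun_eq_iff eunit_def plus_fun_apply)
    show "\<alpha> i \<noteq> 0" "\<alpha>(i := \<alpha> i - 1) = \<nu>" if "\<alpha> = \<nu> + eunit i"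
      unfolding that by (auto simp: fun_eq_iff eunit_def plus_fun_apply)
  qed
  show ?thesis
  proof
    fix \<alpha>
    have "(if \<alpha> i = 0 then 0 else if \<alpha>(i := \<alpha> i - 1) = \<nu> then 1 else (0 :: 'b))
        = (if \<alpha> = \<nu> + eunit i then 1 else 0)"
      unfolding *[symmetric] by simp
    then show "weyl_series (weyl_x i) (delta \<nu>) \<alpha> = (delta (\<nu> + eunit i) \<alpha> :: 'b)"
      unfolding weyl_series_x delta_def series_gen.simps .
  qed
qed

lemma weyl_series_d_delta:
  "weyl_series (weyl_d i) (delta (\<nu> + eunit i)) = (\<lambda>\<alpha>. of_nat (Suc (\<nu> i)) * delta \<nu> \<alpha>)"
proof
  fix \<alpha>
  have "\<alpha>(i := \<alpha> i + 1) = \<nu> + eunit i \<longleftrightarrow> \<alpha> = \<nu>"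
  proof
    assume eq: "\<alpha>(i := \<alpha> i + 1) = \<nu> + eunit i"
    show "\<alpha> = \<nu>"
    proof
      fix j show "\<alpha> j = \<nu> j"
        using fun_cong[OF eq, of j] by (cases "j = i") (simp_all add: eunit_def plus_fun_apply)
    qed
  qed (auto simp: fun_eq_iff eunit_def plus_fun_apply)
  then show "weyl_series (weyl_d i) (delta (\<nu> + eunit i)) \<alpha> = of_nat (Suc (\<nu> i)) * delta \<nu> \<alpha>"
    by (simp add: weyl_series_d delta_def del: fun_upd_apply)
qed

lemma weyl_series_d_delta_0:
  assumes "\<nu> i = 0"
  shows "weyl_series (weyl_d i) (delta \<nu>) = (\<lambda>_. 0)"
proof -
  have *: "\<alpha>(i := \<alpha> i + 1) \<noteq> \<nu>" for \<alpha>
    using assms by (auto simp: fun_eq_iff intro!: exI[of _ i])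
  show ?thesis
  proof
    fix \<alpha>
    show "weyl_series (weyl_d i) (delta \<nu>) \<alpha> = 0"
      unfolding weyl_series_d delta_def series_gen.simps using *[of \<alpha>] by simp
  qed
qed

lemma weyl_series_x_power_delta: "weyl_series (gen_power weyl_x \<alpha>) (delta 0) = delta \<alpha>"
proof (induction \<alpha> rule: exponent_induct)
  case (add \<alpha> i)
  then show ?case
    by (simp only: gen_power_eunit[OF weyl_x_commute] weyl_series_mult weyl_series_x_delta)
qed simp

text \<open>The constant is the product of the factorials of \<open>\<beta>\<close>, nonzero in
  characteristic zero. Any other monomial of degree at most \<open>edeg \<beta>\<close> has too
  small an exponent in some variable and is differentiated to zero.\<close>

lemma weyl_series_d_power_delta:
  "(\<exists>K. K \<noteq> 0 \<and> weyl_series (gen_power weyl_d \<beta>) (delta \<beta>) = (\<lambda>\<alpha>. (K :: 'k::field_char_0) * delta 0 \<alpha>))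
    \<and> (\<forall>\<nu>. edeg \<nu> \<le> edeg \<beta> \<and> \<nu> \<noteq> \<beta> \<longrightarrow> weyl_series (gen_power weyl_d \<beta>) (delta \<nu>) = (\<lambda>\<alpha>. 0 :: 'k))"
proof (induction \<beta> rule: exponent_induct)
  case zero
  show ?case by (auto simp: edeg_eq_0_iff intro!: exI[of _ 1])
next
  case (add \<beta> i)
  let ?D = "gen_power weyl_d :: ('a \<Rightarrow> nat) \<Rightarrow> ('a, 'k) weyl"
  have D: "?D (\<beta> + eunit i) = ?D \<beta> * weyl_d i"
    unfolding gen_power_eunit[OF weyl_d_commute]
    by (rule gen_power_commute[OF weyl_d_commute, symmetric])
  have shift: "weyl_series (?D (\<beta> + eunit i)) (delta (\<nu> + eunit i))
      = (\<lambda>\<alpha>. of_nat (Suc (\<nu> i)) * weyl_series (?D \<beta>) (delta \<nu>) \<alpha>)" for \<nu>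
    by (simp only: D weyl_series_mult weyl_series_d_delta weyl_series_smult)
  obtain K where K: "K \<noteq> 0" "weyl_series (?D \<beta>) (delta \<beta>) = (\<lambda>\<alpha>. K * delta 0 \<alpha>)"
    using add by blast
  have "weyl_series (?D (\<beta> + eunit i)) (delta (\<beta> + eunit i)) = (\<lambda>\<alpha>. (of_nat (Suc (\<beta> i)) * K) * delta 0 \<alpha>)"
    unfolding shift K(2) by (simp only: mult.assoc)
  moreover have "of_nat (Suc (\<beta> i)) * K \<noteq> 0"
    using K(1) of_nat_neq_0 by simp
  moreover have "weyl_series (?D (\<beta> + eunit i)) (delta \<nu>) = (\<lambda>\<alpha>. 0)"
    if \<nu>: "edeg \<nu> \<le> edeg (\<beta> + eunit i)" "\<nu> \<noteq> \<beta> + eunit i" for \<nu>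
  proof (cases "\<nu> i = 0")
    case True
    have "weyl_series (?D \<beta>) (\<lambda>_. 0) = (\<lambda>_. 0)"
      using weyl_series_smult[of "?D \<beta>" 0 "delta 0"] by simp
    with True show ?thesis
      by (simp only: D weyl_series_mult weyl_series_d_delta_0)
  next
    case False
    then have eq: "\<nu> = (\<nu> - eunit i) + eunit i"
      by (intro exponent_diff_add[symmetric]) (simp add: eunit_le_iff)
    then have "edeg \<nu> = edeg (\<nu> - eunit i) + 1"
      by (metis edeg_add edeg_eunit)
    with \<nu>(1) have "edeg (\<nu> - eunit i) \<le> edeg \<beta>"
      by simp
    moreover have "\<nu> - eunit i \<noteq> \<beta>"
      using eq \<nu>(2) by metis
    ultimately have "weyl_series (?D \<beta>) (delta (\<nu> - eunit i)) = (\<lambda>\<alpha>. 0)"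
      using add by blast
    then show ?thesis
      using shift[of "\<nu> - eunit i"] unfolding eq[symmetric] by simp
  qed
  ultimately show ?case by blast
qed

text \<open>Among the terms with nonzero coefficient take one whose derivative part
  \<open>\<nu>\<close> has least degree, and apply the sum to the monomial with exponent
  \<open>\<nu>\<close>. Terms with another derivative part vanish, and the rest become multiples of
  distinct monomials.\<close>

lemma wmon_family_independent:
  fixes c :: "('n::finite + 'n \<Rightarrow> nat) \<Rightarrow> 'k::field_char_0"
  assumes P: "finite P" and sum: "(\<Sum>\<gamma>\<in>P. weyl_scale (c \<gamma>) (wmon \<gamma>)) = 0"
  shows "\<forall>\<gamma>\<in>P. c \<gamma> = 0"
proof (rule ccontr)
  assume "\<not> (\<forall>\<gamma>\<in>P. c \<gamma> = 0)"
  then obtain \<gamma>1 where "\<gamma>1 \<in> P \<and> c \<gamma>1 \<noteq> 0" by blast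
  then obtain \<gamma>0 where \<gamma>0: "\<gamma>0 \<in> P" "c \<gamma>0 \<noteq> 0"
    and min: "\<And>\<gamma>. \<gamma> \<in> P \<Longrightarrow> c \<gamma> \<noteq> 0 \<Longrightarrow> edeg (\<gamma>0 \<circ> Inr) \<le> edeg (\<gamma> \<circ> Inr)"
    using ex_has_least_nat[of "\<lambda>\<gamma>. \<gamma> \<in> P \<and> c \<gamma> \<noteq> 0" \<gamma>1 "\<lambda>\<gamma>. edeg (\<gamma> \<circ> Inr)"] by auto
  define \<nu> where "\<nu> = \<gamma>0 \<circ> Inr"
  obtain K :: 'k where K: "K \<noteq> 0" "weyl_series (gen_power weyl_d \<nu>) (delta \<nu>) = (\<lambda>\<alpha>. K * delta 0 \<alpha>)"
    using weyl_series_d_power_delta[of \<nu>] by blast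
  have term_eq: "c \<gamma> * weyl_series (wmon \<gamma>) (delta \<nu>) (\<gamma>0 \<circ> Inl) = (if \<gamma> = \<gamma>0 then c \<gamma>0 * K else 0)"
    if "\<gamma> \<in> P" for \<gamma>
  proof (cases "c \<gamma> = 0")
    case True
    then show ?thesis using \<gamma>0 by auto
  next
    case False
    then have le: "edeg \<nu> \<le> edeg (\<gamma> \<circ> Inr)"
      using min[OF that] by (simp add: \<nu>_def)
    show ?thesis
    proof (cases "\<gamma> \<circ> Inr = \<nu>")
      case True
      then have "weyl_series (wmon \<gamma>) (delta \<nu>) (\<gamma>0 \<circ> Inl) = K * delta (\<gamma> \<circ> Inl) (\<gamma>0 \<circ> Inl)"
        by (simp add: wmon_eq weyl_series_mult K(2) weyl_series_smult weyl_series_x_power_delta)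
      moreover have "\<gamma>0 \<circ> Inl = \<gamma> \<circ> Inl \<longleftrightarrow> \<gamma> = \<gamma>0"
      proof
        assume eq: "\<gamma>0 \<circ> Inl = \<gamma> \<circ> Inl"
        show "\<gamma> = \<gamma>0"
        proof
          fix j show "\<gamma> j = \<gamma>0 j"
            using fun_cong[OF eq] fun_cong[OF True[unfolded \<nu>_def]] by (cases j) (simp_all add: comp_def)
        qed
      qed simp
      ultimately show ?thesis by (simp add: delta_def)
    next
      case neq: False
      have zero: "weyl_series (gen_power weyl_x \<alpha>) (\<lambda>_. 0) = (\<lambda>_. 0 :: 'k)" for \<alpha> :: "'n \<Rightarrow> nat"
        using weyl_series_smult[of "gen_power weyl_x \<alpha>" 0 "delta 0"] by simp
      have "weyl_series (gen_power weyl_d (\<gamma> \<circ> Inr)) (delta \<nu>) = (\<lambda>_. 0 :: 'k)"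
        using weyl_series_d_power_delta[of "\<gamma> \<circ> Inr"] le neq by blast
      then have "weyl_series (wmon \<gamma>) (delta \<nu>) (\<gamma>0 \<circ> Inl) = (0 :: 'k)"
        by (simp add: wmon_eq weyl_series_mult zero)
      then show ?thesis using neq by (auto simp: \<nu>_def)
    qed
  qed
  have "0 = (\<Sum>\<gamma>\<in>P. c \<gamma> * weyl_series (wmon \<gamma>) (delta \<nu>) (\<gamma>0 \<circ> Inl))"
    using arg_cong[OF sum, of "\<lambda>a. weyl_series a (delta \<nu>) (\<gamma>0 \<circ> Inl)"]
    by (simp add: weyl_series_sum weyl_series_scale)
  also have "\<dots> = (\<Sum>\<gamma>\<in>P. if \<gamma> = \<gamma>0 then c \<gamma>0 * K else 0)"
    by (rule sum.cong[OF refl term_eq])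
  also have "\<dots> = c \<gamma>0 * K"
    using P \<gamma>0 by simp
  finally show False using \<gamma>0 K by simp
qed

section \<open>Leading monomials\<close>

text \<open>One rank is fixed per index type, so that leading exponents of different elements can be
  compared.\<close>

definition mrank :: "('i::finite \<Rightarrow> nat) \<Rightarrow> nat" where
  "mrank = (SOME rk. inj rk \<and> (\<forall>\<gamma> \<delta>. edeg \<gamma> < edeg \<delta> \<longrightarrow> rk \<gamma> < rk \<delta>) \<and>
    (\<forall>\<gamma> \<delta> \<epsilon>. rk \<gamma> < rk \<delta> \<longrightarrow> rk (\<gamma> + \<epsilon>) < rk (\<delta> + \<epsilon>)))"

lemma mrank:
  fixes \<gamma> \<delta> \<epsilon> :: "'i::finite \<Rightarrow> nat"
  shows inj_mrank: "inj (mrank :: ('i::finite \<Rightarrow> nat) \<Rightarrow> nat)"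
    and mrank_edeg: "edeg \<gamma> < edeg \<delta> \<Longrightarrow> mrank \<gamma> < mrank \<delta>"
    and mrank_add: "mrank \<gamma> < mrank \<delta> \<Longrightarrow> mrank (\<gamma> + \<epsilon>) < mrank (\<delta> + \<epsilon>)"
proof -
  have "\<exists>rk :: ('i \<Rightarrow> nat) \<Rightarrow> nat. inj rk \<and> (\<forall>\<gamma> \<delta>. edeg \<gamma> < edeg \<delta> \<longrightarrow> rk \<gamma> < rk \<delta>) \<and>
      (\<forall>\<gamma> \<delta> \<epsilon>. rk \<gamma> < rk \<delta> \<longrightarrow> rk (\<gamma> + \<epsilon>) < rk (\<delta> + \<epsilon>))"
    using monomial_rank_exists by metis
  from someI_ex[OF this, folded mrank_def]
  show "inj (mrank :: ('i \<Rightarrow> nat) \<Rightarrow> nat)"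
    "edeg \<gamma> < edeg \<delta> \<Longrightarrow> mrank \<gamma> < mrank \<delta>"
    "mrank \<gamma> < mrank \<delta> \<Longrightarrow> mrank (\<gamma> + \<epsilon>) < mrank (\<delta> + \<epsilon>)"
    by blast+
qed

definition weyl_rank :: "nat \<Rightarrow> ('n::finite, 'k::field) weyl set" where
  "weyl_rank r = weyl.span (wmon ` {\<gamma>. mrank \<gamma> < r})"

lemma subspace_weyl_rank: "weyl.subspace (weyl_rank r)"
  by (simp add: weyl_rank_def)

lemma weyl_rank_mono: "r \<le> r' \<Longrightarrow> weyl_rank r \<subseteq> weyl_rank r'"
  unfolding weyl_rank_def by (intro weyl.span_mono image_mono) auto

lemma weyl_less_weyl_rank:
  fixes \<gamma> :: "'n::finite + 'n \<Rightarrow> nat"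
  shows "(weyl_less (edeg \<gamma>) :: ('n, 'k::field) weyl set) \<subseteq> weyl_rank (mrank \<gamma>)"
  unfolding weyl_less_def weyl_rank_def
  by (intro weyl.span_mono image_mono) (auto intro: mrank_edeg)

lemma ex_weyl_rank: "\<exists>r. a \<in> (weyl_rank r :: ('n::finite, 'k::field) weyl set)"
proof -
  obtain m where m: "a \<in> bernstein m"
    using ex_bernstein by blast
  \<comment> \<open>Any exponent of degree above \<open>m\<close> has a rank that bounds all of
    \<open>bernstein m\<close>.\<close>
  define \<delta> :: "'n + 'n \<Rightarrow> nat" where "\<delta> = (\<lambda>_. Suc m)"
  have "Suc m * 1 \<le> Suc m * CARD('n + 'n)"
    by (intro mult_le_mono) (simp_all add: Suc_le_eq)
  then have "Suc m \<le> edeg \<delta>"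
    by (simp add: \<delta>_def edeg_def mult.commute)
  then have "bernstein m \<subseteq> (weyl_rank (mrank \<delta>) :: ('n, 'k) weyl set)"
    unfolding bernstein_weyl_less
    by (rule order_trans[OF weyl_less_mono weyl_less_weyl_rank])
  with m show ?thesis by blast
qed

text \<open>Ranks are injective, so raising the bound by one adds at most one monomial; a number
  that is no rank adds nothing.\<close>

lemma weyl_rank_Suc:
  assumes "a \<in> weyl_rank (Suc r)"
  obtains "a \<in> weyl_rank r" | \<gamma> c where "mrank \<gamma> = r" "c \<noteq> 0" "a - weyl_scale c (wmon \<gamma>) \<in> weyl_rank r"
proof (cases "\<exists>\<gamma> :: 'a + 'a \<Rightarrow> nat. mrank \<gamma> = r")
  case True
  then obtain \<gamma> :: "'a + 'a \<Rightarrow> nat" where \<gamma>: "mrank \<gamma> = r" by blast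
  have "{\<delta>. mrank \<delta> < Suc r} = insert \<gamma> {\<delta>. mrank \<delta> < r}"
    using \<gamma> by (auto simp: less_Suc_eq inj_eq[OF inj_mrank])
  with assms obtain c where c: "a - weyl_scale c (wmon \<gamma>) \<in> weyl_rank r"
    by (auto simp: weyl_rank_def weyl.span_insert)
  then show ?thesis
    using that \<gamma> by (cases "c = 0") auto
next
  case False
  then have "{\<delta> :: 'a + 'a \<Rightarrow> nat. mrank \<delta> < Suc r} = {\<delta>. mrank \<delta> < r}"
    by (auto simp: less_Suc_eq)
  with assms that(1) show ?thesis by (simp add: weyl_rank_def)
qed

lemma weyl_lead:
  assumes "a \<noteq> 0"
  obtains \<gamma> c where "c \<noteq> 0" "a - weyl_scale c (wmon \<gamma>) \<in> weyl_rank (mrank \<gamma>)"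
proof -
  have "\<exists>\<gamma> c. c \<noteq> 0 \<and> a - weyl_scale c (wmon \<gamma>) \<in> weyl_rank (mrank \<gamma>)" if "a \<in> weyl_rank r" for r
    using that
  proof (induction r)
    case 0
    then show ?case using assms by (simp add: weyl_rank_def)
  next
    case (Suc r)
    show ?case
      by (rule weyl_rank_Suc[OF Suc.prems]) (use Suc.IH in blast)+
  qed
  then show ?thesis using ex_weyl_rank that by blast
qed

lemma wmon_mult_rank: "wmon \<gamma> * wmon \<delta> - wmon (\<gamma> + \<delta>) \<in> weyl_rank (mrank (\<gamma> + \<delta>))"
  using wmon_mult[of \<gamma> \<delta>] weyl_less_weyl_rank[of "\<gamma> + \<delta>"] by auto

lemma wmon_weyl_rank: "mrank \<gamma> < r \<Longrightarrow> wmon \<gamma> \<in> weyl_rank r"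
  unfolding weyl_rank_def by (rule weyl.span_base) simp

lemma wmon_mult_weyl_rank: "mrank (\<gamma> + \<delta>) < r \<Longrightarrow> wmon \<gamma> * wmon \<delta> \<in> weyl_rank r"
  using wmon_mult_rank[of \<gamma> \<delta>] weyl_rank_mono[of "mrank (\<gamma> + \<delta>)" r] wmon_weyl_rank[of "\<gamma> + \<delta>" r]
    weyl.subspace_add[OF subspace_weyl_rank, of "wmon \<gamma> * wmon \<delta> - wmon (\<gamma> + \<delta>)" r "wmon (\<gamma> + \<delta>)"]
  by auto

lemma weyl_rank_mult_wmon:
  fixes \<gamma> :: "'n::finite + 'n \<Rightarrow> nat" and a :: "('n, 'k::field) weyl"
  assumes "a \<in> weyl_rank (mrank \<gamma>)"
  shows "a * wmon \<delta> \<in> weyl_rank (mrank (\<gamma> + \<delta>))"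
  unfolding weyl_rank_def
proof (rule weyl_span_right_mult[OF assms[unfolded weyl_rank_def]], elim imageE CollectE)
  fix s \<epsilon> assume "s = (wmon \<epsilon> :: ('n, 'k) weyl)" "mrank \<epsilon> < mrank \<gamma>"
  then show "s * wmon \<delta> \<in> weyl.span (wmon ` {\<epsilon>. mrank \<epsilon> < mrank (\<gamma> + \<delta>)})"
    using wmon_mult_weyl_rank[OF mrank_add] by (auto simp: weyl_rank_def)
qed

lemma wmon_mult_weyl_rank_right:
  fixes \<gamma> \<delta> :: "'n::finite + 'n \<Rightarrow> nat" and b :: "('n, 'k::field) weyl"
  assumes "b \<in> weyl_rank (mrank \<delta>)"
  shows "wmon \<gamma> * b \<in> weyl_rank (mrank (\<gamma> + \<delta>))"
  unfolding weyl_rank_def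
proof (rule weyl_span_left_mult[OF assms[unfolded weyl_rank_def]], elim imageE CollectE)
  fix s \<epsilon> assume s: "s = (wmon \<epsilon> :: ('n, 'k) weyl)" "mrank \<epsilon> < mrank \<delta>"
  then have "mrank (\<gamma> + \<epsilon>) < mrank (\<gamma> + \<delta>)"
    using mrank_add[of \<epsilon> \<delta> \<gamma>] by (simp add: add.commute)
  then show "wmon \<gamma> * s \<in> weyl.span (wmon ` {\<epsilon>. mrank \<epsilon> < mrank (\<gamma> + \<delta>)})"
    using wmon_mult_weyl_rank by (auto simp: weyl_rank_def s)
qed

lemma weyl_rank_mult:
  fixes \<gamma> \<delta> :: "'n::finite + 'n \<Rightarrow> nat" and a b :: "('n, 'k::field) weyl"
  assumes "a \<in> weyl_rank (mrank \<gamma>)" "b \<in> weyl_rank (mrank \<delta>)"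
  shows "a * b \<in> weyl_rank (mrank (\<gamma> + \<delta>))"
  unfolding weyl_rank_def
proof (rule weyl_span_left_mult[OF assms(2)[unfolded weyl_rank_def]], elim imageE CollectE)
  fix s \<epsilon> assume s: "s = (wmon \<epsilon> :: ('n, 'k) weyl)" "mrank \<epsilon> < mrank \<delta>"
  then have "mrank (\<gamma> + \<epsilon>) < mrank (\<gamma> + \<delta>)"
    using mrank_add[of \<epsilon> \<delta> \<gamma>] by (simp add: add.commute)
  then show "a * s \<in> weyl.span (wmon ` {\<epsilon>. mrank \<epsilon> < mrank (\<gamma> + \<delta>)})"
    using weyl_rank_mult_wmon[OF assms(1), of \<epsilon>] weyl_rank_mono[of "mrank (\<gamma> + \<epsilon>)" "mrank (\<gamma> + \<delta>)"]
    by (auto simp: weyl_rank_def s)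
qed

text \<open>Otherwise the finitely many monomials up to this rank would be dependent.\<close>

lemma wmon_not_in_weyl_rank: "(wmon \<gamma> :: ('n::finite, 'k::field_char_0) weyl) \<notin> weyl_rank (mrank \<gamma>)"
proof
  assume in_span: "wmon \<gamma> \<in> (weyl_rank (mrank \<gamma>) :: ('n, 'k) weyl set)"
  let ?P = "{\<delta> :: 'n + 'n \<Rightarrow> nat. mrank \<delta> \<le> mrank \<gamma>}"
  have fin: "finite ?P"
    using finite_vimageI[OF finite_atMost inj_mrank, of "mrank \<gamma>"] by (simp add: vimage_def)
  have ind: "\<And>c. (\<Sum>\<delta>\<in>?P. weyl_scale (c \<delta>) (wmon \<delta> :: ('n, 'k) weyl)) = 0 \<Longrightarrow> \<forall>\<delta>\<in>?P. c \<delta> = 0"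
    by (rule wmon_family_independent[OF fin])
  have inj: "inj_on (wmon :: _ \<Rightarrow> ('n, 'k) weyl) ?P"
    by (rule weyl.family_independent(1)[OF fin ind])
  have indep: "weyl.independent ((wmon :: _ \<Rightarrow> ('n, 'k) weyl) ` ?P)"
    by (rule weyl.family_independent(2)[OF fin ind])
  have "wmon ` {\<delta>. mrank \<delta> < mrank \<gamma>} \<subseteq> (wmon ` ?P - {wmon \<gamma>} :: ('n, 'k) weyl set)"
    by (auto dest!: inj_onD[OF inj])
  then have "wmon \<gamma> \<in> weyl.span (wmon ` ?P - {wmon \<gamma> :: ('n, 'k) weyl})"
    using in_span weyl.span_mono unfolding weyl_rank_def by blast
  moreover have "(wmon \<gamma> :: ('n, 'k) weyl) \<in> wmon ` ?P"
    by simp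
  ultimately show False
    using indep weyl.dependent_def by blast
qed

text \<open>Leading exponents add and leading coefficients multiply. All other contributions have
  smaller rank and cannot cancel the leading term.\<close>

lemma weyl_no_zero_divisors:
  fixes a b :: "('n::finite, 'k::field_char_0) weyl"
  assumes "a \<noteq> 0" "b \<noteq> 0"
  shows "a * b \<noteq> 0"
proof
  assume ab: "a * b = 0"
  obtain \<gamma> c where c: "c \<noteq> 0" and a: "a - weyl_scale c (wmon \<gamma>) \<in> weyl_rank (mrank \<gamma>)"
    using weyl_lead[OF assms(1)] by blast
  obtain \<delta> d where d: "d \<noteq> 0" and b: "b - weyl_scale d (wmon \<delta>) \<in> weyl_rank (mrank \<delta>)"
    using weyl_lead[OF assms(2)] by blast
  define a' b' where "a' = a - weyl_scale c (wmon \<gamma>)" and "b' = b - weyl_scale d (wmon \<delta>)"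
  define R :: "('n, 'k) weyl set" where "R = weyl_rank (mrank (\<gamma> + \<delta>))"
  define m where "m = wmon \<gamma> * wmon \<delta> - (wmon (\<gamma> + \<delta>) :: ('n, 'k) weyl)"
  have "a * b = (weyl_scale c (wmon \<gamma>) + a') * (weyl_scale d (wmon \<delta>) + b')"
    by (simp add: a'_def b'_def)
  also have "\<dots> = weyl_scale (c * d) (wmon \<gamma> * wmon \<delta>) + weyl_scale c (wmon \<gamma> * b')
      + weyl_scale d (a' * wmon \<delta>) + a' * b'"
    by (simp add: distrib_left distrib_right weyl_scale_mult_left weyl_scale_mult_right
        weyl.scale_right_distrib mult.commute add.assoc)
  also have "wmon \<gamma> * wmon \<delta> = wmon (\<gamma> + \<delta>) + m"
    by (simp add: m_def)
  finally have "weyl_scale (c * d) (wmon (\<gamma> + \<delta>) + m) + weyl_scale c (wmon \<gamma> * b')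
      + weyl_scale d (a' * wmon \<delta>) + a' * b' = 0"
    unfolding ab by (rule sym)
  then have "weyl_scale (c * d) (wmon (\<gamma> + \<delta>)) = - (weyl_scale (c * d) m + weyl_scale c (wmon \<gamma> * b')
      + weyl_scale d (a' * wmon \<delta>) + a' * b')"
    by (simp only: weyl.scale_right_distrib eq_neg_iff_add_eq_0 add.assoc)
  moreover have "m \<in> R" "wmon \<gamma> * b' \<in> R" "a' * wmon \<delta> \<in> R" "a' * b' \<in> R"
    using a b wmon_mult_rank wmon_mult_weyl_rank_right weyl_rank_mult_wmon weyl_rank_mult
    unfolding R_def m_def a'_def b'_def by blast+
  moreover have "weyl.subspace R"
    by (simp add: R_def subspace_weyl_rank)
  ultimately have "weyl_scale (c * d) (wmon (\<gamma> + \<delta>)) \<in> R"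
    by (simp only: weyl.subspace_neg weyl.subspace_add weyl.subspace_scale)
  then have "weyl_scale (1 / (c * d)) (weyl_scale (c * d) (wmon (\<gamma> + \<delta>))) \<in> R"
    using \<open>weyl.subspace R\<close> weyl.subspace_scale by blast
  then have "wmon (\<gamma> + \<delta>) \<in> R"
    using c d by simp
  then show False
    using wmon_not_in_weyl_rank unfolding R_def by blast
qed

subsection \<open>Right ideals are finitely generated\<close>

text \<open>A Groebner basis argument: choose elements of \<open>J\<close> whose leading exponents
  generate all leading exponents of \<open>J\<close>, then divide by them, by induction on the
  rank.\<close>

lemma right_ideal_finitely_generated:
  fixes J :: "('n::finite, 'k::field) weyl set"
  assumes add: "\<And>a b. a \<in> J \<Longrightarrow> b \<in> J \<Longrightarrow> a + b \<in> J"
    and mult: "\<And>a b. a \<in> J \<Longrightarrow> a * b \<in> J"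
  obtains F where "finite F" "F \<subseteq> J" "\<And>a. a \<in> J \<Longrightarrow> \<exists>b. a = (\<Sum>f\<in>F. f * b f)"
proof -
  define U where "U = {\<gamma>. \<exists>f\<in>J. f - wmon \<gamma> \<in> weyl_rank (mrank \<gamma>)}"
  obtain G where G: "finite G" "G \<subseteq> U" "\<And>\<gamma>. \<gamma> \<in> U \<Longrightarrow> \<exists>\<delta>\<in>G. \<delta> \<le> \<gamma>"
    using dickson[of U] by blast
  have "\<forall>\<gamma>\<in>G. \<exists>f. f \<in> J \<and> f - wmon \<gamma> \<in> weyl_rank (mrank \<gamma>)"
    using G(2) by (auto simp: U_def)
  then obtain h where h: "\<And>\<gamma>. \<gamma> \<in> G \<Longrightarrow> h \<gamma> \<in> J" "\<And>\<gamma>. \<gamma> \<in> G \<Longrightarrow> h \<gamma> - wmon \<gamma> \<in> weyl_rank (mrank \<gamma>)"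
    by metis
  define F where "F = h ` G"
  define R where "R = {\<Sum>f\<in>F. f * b f | b. True}"
  have F: "finite F" "F \<subseteq> J"
    using G(1) h(1) by (auto simp: F_def)
  have R_add: "a + b \<in> R" if ab: "a \<in> R" "b \<in> R" for a b
  proof -
    obtain u v where "a = (\<Sum>f\<in>F. f * u f)" "b = (\<Sum>f\<in>F. f * v f)"
      using ab unfolding R_def by blast
    then have "a + b = (\<Sum>f\<in>F. f * (u f + v f))"
      by (simp add: distrib_left sum.distrib)
    then show ?thesis by (auto simp: R_def)
  qed
  have R_mult: "f * b \<in> R" if "f \<in> F" for f b
  proof -
    have "(\<Sum>g\<in>F. g * (if g = f then b else 0)) = (\<Sum>g\<in>F. if g = f then f * b else 0)"
      by (rule sum.cong) auto
    also have "\<dots> = f * b"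
      using F that by simp
    finally show ?thesis
      unfolding R_def by (intro CollectI exI[of _ "\<lambda>g. if g = f then b else 0"]) simp
  qed
  have "a \<in> R" if "a \<in> J" "a \<in> weyl_rank r" for a r
    using that
  proof (induction r arbitrary: a)
    case 0
    then have "a = 0" by (simp add: weyl_rank_def)
    then show ?case by (auto simp: R_def intro: exI[of _ "\<lambda>_. 0"])
  next
    case (Suc r)
    show ?case
    proof (rule weyl_rank_Suc[OF Suc.prems(2)])
      assume "a \<in> weyl_rank r"
      then show ?thesis using Suc by blast
    next
      fix \<gamma> c assume \<gamma>: "mrank \<gamma> = r" "c \<noteq> 0" "a - weyl_scale c (wmon \<gamma>) \<in> weyl_rank r"
      have scale_J: "weyl_scale d x \<in> J" if "x \<in> J" for d x
        using mult[OF that, of "weyl_const d"] by (simp add: weyl_scale_def weyl_const_commute)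
      have "weyl_scale (1 / c) (a - weyl_scale c (wmon \<gamma>)) \<in> weyl_rank r"
        using \<gamma>(3) by (rule weyl.subspace_scale[OF subspace_weyl_rank])
      then have "weyl_scale (1 / c) a - wmon \<gamma> \<in> weyl_rank (mrank \<gamma>)"
        using \<gamma> by (simp add: weyl.scale_right_diff_distrib)
      then have "\<gamma> \<in> U"
        using scale_J[OF Suc.prems(1)] by (auto simp: U_def)
      then obtain \<delta> where \<delta>: "\<delta> \<in> G" "\<delta> \<le> \<gamma>"
        using G(3) by blast
      define \<epsilon> where "\<epsilon> = \<gamma> - \<delta>"
      have \<gamma>_eq: "\<delta> + \<epsilon> = \<gamma>"
        using exponent_diff_add[OF \<delta>(2)] by (simp only: \<epsilon>_def add.commute)
      \<comment> \<open>A right multiple of a chosen generator with the same leading term as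
        \<open>a\<close>, so subtracting it lowers the rank.\<close>
      let ?g = "h \<delta> * weyl_scale c (wmon \<epsilon>)"
      have "(h \<delta> - wmon \<delta>) * wmon \<epsilon> + (wmon \<delta> * wmon \<epsilon> - wmon (\<delta> + \<epsilon>)) \<in> weyl_rank (mrank (\<delta> + \<epsilon>))"
        using weyl_rank_mult_wmon[OF h(2)[OF \<delta>(1)]] wmon_mult_rank
          weyl.subspace_add[OF subspace_weyl_rank] by blast
      then have "h \<delta> * wmon \<epsilon> - wmon \<gamma> \<in> weyl_rank r"
        by (simp add: \<gamma>_eq \<gamma>(1) left_diff_distrib)
      then have "weyl_scale c (h \<delta> * wmon \<epsilon> - wmon \<gamma>) \<in> weyl_rank r"
        by (rule weyl.subspace_scale[OF subspace_weyl_rank])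
      then have "(a - weyl_scale c (wmon \<gamma>)) - weyl_scale c (h \<delta> * wmon \<epsilon> - wmon \<gamma>) \<in> weyl_rank r"
        using \<gamma>(3) weyl.subspace_diff[OF subspace_weyl_rank] by blast
      then have "a - ?g \<in> weyl_rank r"
        by (simp add: weyl.scale_right_diff_distrib weyl_scale_mult_right)
      moreover have "a - ?g \<in> J"
      proof -
        have "a + h \<delta> * (- weyl_scale c (wmon \<epsilon>)) \<in> J"
          using add mult Suc.prems(1) h(1)[OF \<delta>(1)] by blast
        then show ?thesis by simp
      qed
      ultimately have "a - ?g \<in> R"
        using Suc.IH by blast
      moreover have "?g \<in> R"
        using R_mult \<delta>(1) by (auto simp: F_def)
      ultimately show ?thesis
        using R_add by fastforce
    qed
  qed
  then have "a \<in> R" if "a \<in> J" for a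
    using ex_weyl_rank that by blast
  then show ?thesis
    using that[OF F] by (auto simp: R_def)
qed

section \<open>Modules over the Weyl algebra\<close>

lemma weyl_const_inject: "weyl_const c = (weyl_const d :: ('n, 'k::field) weyl) \<longleftrightarrow> c = d"
proof
  assume "weyl_const c = (weyl_const d :: ('n, 'k) weyl)"
  then have "weyl_series (weyl_const c :: ('n, 'k) weyl) (delta 0) 0
      = weyl_series (weyl_const d :: ('n, 'k) weyl) (delta 0) 0"
    by simp
  then show "c = d" by (simp add: weyl_series_const delta_def)
qed simp

text \<open>
  The action is normalised outside \<^term>\<open>M\<close> in such a way that the constants act by the given
  scalar multiplication of the whole type.
\<close>

lemma weyl_action_exists:
  fixes M :: "'m::ab_group_add set" and sc :: "'k::field \<Rightarrow> 'm \<Rightarrow> 'm" and g_op :: "'n gen \<Rightarrow> 'm \<Rightarrow> 'm"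
  assumes vs: "vector_space sc" and M: "module.subspace sc M"
    and op_mem: "\<And>g x. x \<in> M \<Longrightarrow> g_op g x \<in> M"
    and op_add: "\<And>g x y. x \<in> M \<Longrightarrow> y \<in> M \<Longrightarrow> g_op g (x + y) = g_op g x + g_op g y"
    and op_scale: "\<And>g c x. x \<in> M \<Longrightarrow> g_op g (sc c x) = sc c (g_op g x)"
    and comm_x: "\<And>i j x. x \<in> M \<Longrightarrow>
      g_op (GenX i) (g_op (GenX j) x) = g_op (GenX j) (g_op (GenX i) x)"
    and comm_d: "\<And>i j x. x \<in> M \<Longrightarrow>
      g_op (GenD i) (g_op (GenD j) x) = g_op (GenD j) (g_op (GenD i) x)"
    and comm_dx: "\<And>i j x. x \<in> M \<Longrightarrow>
      g_op (GenD i) (g_op (GenX j) x) = g_op (GenX j) (g_op (GenD i) x) + (if i = j then x else 0)"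
  obtains act :: "('n, 'k) weyl \<Rightarrow> 'm \<Rightarrow> 'm"
  where "left_module M act" "const_scale act = sc"
    "\<And>i x. x \<in> M \<Longrightarrow> act (weyl_x i) x = g_op (GenX i) x"
    "\<And>i x. x \<in> M \<Longrightarrow> act (weyl_d i) x = g_op (GenD i) x"
proof -
  interpret V: vector_space sc by (rule vs)
  note M_add = V.subspace_add[OF M] and M_scale = V.subspace_scale[OF M] and M_0 = V.subspace_0[OF M]
  define w_op where "w_op w = foldr g_op (letters w)" for w
  have w_op_mem: "w_op w x \<in> M" if "x \<in> M" for w x
  proof -
    have "foldr g_op gs x \<in> M" for gs
      by (induction gs) (simp_all add: op_mem that)
    then show ?thesis by (simp add: w_op_def)
  qed
  have w_op_add: "w_op w (x + y) = w_op w x + w_op w y" if "x \<in> M" "y \<in> M" for w x y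
  proof -
    have "foldr g_op gs x \<in> M \<and> foldr g_op gs y \<in> M
        \<and> foldr g_op gs (x + y) = foldr g_op gs x + foldr g_op gs y" for gs
      by (induction gs) (simp_all add: op_mem op_add that)
    then show ?thesis by (simp add: w_op_def)
  qed
  have w_op_scale: "w_op w (sc c x) = sc c (w_op w x)" if "x \<in> M" for w c x
  proof -
    have "foldr g_op gs x \<in> M \<and> foldr g_op gs (sc c x) = sc c (foldr g_op gs x)" for gs
      by (induction gs) (simp_all add: op_mem op_scale that)
    then show ?thesis by (simp add: w_op_def)
  qed
  define f_op :: "('n gen, 'k) free_algebra \<Rightarrow> 'm \<Rightarrow> 'm"
    where "f_op p x = (\<Sum>w\<in>Poly_Mapping.keys p. sc (Poly_Mapping.lookup p w) (w_op w x))" for p x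
  have f_op_superset: "f_op p x = (\<Sum>w\<in>K. sc (Poly_Mapping.lookup p w) (w_op w x))"
    if "finite K" "Poly_Mapping.keys p \<subseteq> K" for p K x
    unfolding f_op_def by (rule sum.mono_neutral_left) (use that in \<open>auto simp: in_keys_iff\<close>)
  have f_op_zero: "f_op 0 x = 0" for x
    by (simp add: f_op_def)
  have f_op_plus: "f_op (p + q) x = f_op p x + f_op q x" for p q x
    using keys_add[of p q]
    by (simp add: f_op_superset[of "Poly_Mapping.keys p \<union> Poly_Mapping.keys q"] lookup_add
        sum.distrib V.scale_left_distrib)
  have f_op_uminus: "f_op (- p) x = - f_op p x" for p x
    using f_op_plus[of p "- p" x] by (simp add: f_op_zero eq_neg_iff_add_eq_0 add.commute)
  have f_op_diff: "f_op (p - q) x = f_op p x - f_op q x" for p q x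
    using f_op_plus[of p "- q" x] by (simp add: f_op_uminus)
  have f_op_single: "f_op (Poly_Mapping.single w c) x = sc c (w_op w x)" for w c x
    by (simp add: f_op_superset[of "{w}"])
  have f_op_one: "f_op 1 x = x" for x
    using f_op_single[of 0 1 x] by (simp only: single_one) (simp add: w_op_def zero_word_def)
  have f_op_mem: "f_op p x \<in> M" if "x \<in> M" for p x
    unfolding f_op_def by (intro V.subspace_sum[OF M] M_scale w_op_mem that)
  have f_op_add: "f_op p (x + y) = f_op p x + f_op p y" if "x \<in> M" "y \<in> M" for p x y
    by (simp add: f_op_def w_op_add that V.scale_right_distrib sum.distrib)
  have f_op_scale: "f_op p (sc c x) = sc c (f_op p x)" if "x \<in> M" for p c x
    by (simp add: f_op_def w_op_scale that V.scale_sum_right mult.commute)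
  have f_op_at_0: "f_op p 0 = 0" for p
    using f_op_scale[OF M_0, of p 0] by simp
  have f_op_mult: "f_op (p * q) x = f_op p (f_op q x)" if x: "x \<in> M" for p q x
  proof (induction p rule: free_algebra_induct)
    case zero
    show ?case by (simp add: f_op_zero)
  next
    case (single w c)
    show ?case
    proof (induction q rule: free_algebra_induct)
      case zero
      show ?case by (simp add: f_op_zero f_op_at_0)
    next
      case (single v d)
      show ?case
        by (simp add: mult_single f_op_single w_op_scale w_op_mem x)
          (simp add: w_op_def plus_word_def)
    next
      case (add p q)
      then show ?case by (simp add: distrib_left f_op_plus f_op_add f_op_mem x)
    qed
  next
    case (add p1 p2)
    then show ?case by (simp add: distrib_right f_op_plus)
  qed
  have f_op_gen: "f_op (free_gen g) x = g_op g x" for g x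
    by (simp add: free_gen_def f_op_single w_op_def)
  \<comment> \<open>The vector stays arbitrary because right multiplication in the ideal changes the
    vector to which a relation is applied.\<close>
  have f_op_ideal: "f_op p x = 0" if "p \<in> weyl_ideal" "x \<in> M" for p x
    using that
  proof (induction arbitrary: x rule: weyl_ideal.induct)
    case (comm_x i j)
    then show ?case by (simp add: f_op_diff f_op_mult f_op_gen assms)
  next
    case (comm_d i j)
    then show ?case by (simp add: f_op_diff f_op_mult f_op_gen assms)
  next
    case (comm_dx i j)
    then show ?case
      by (cases "i = j") (simp_all add: f_op_diff f_op_mult f_op_gen assms(8) f_op_one f_op_zero)
  qed (simp_all add: f_op_plus f_op_mult f_op_zero f_op_at_0 f_op_mem)
  \<comment> \<open>The scalar is well defined outside \<open>M\<close> because
    \<open>weyl_const\<close> is injective; elements other than constants get the default value 0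
    there.\<close>
  define act where "act a x = (if x \<in> M then f_op (rep_weyl a) x
      else if \<exists>c. a = weyl_const c then sc (THE c. a = weyl_const c) x else 0)" for a x
  have act_abs: "act (abs_weyl p) x = f_op p x" if "x \<in> M" for p x
  proof -
    have "abs_weyl (rep_weyl (abs_weyl p)) = abs_weyl p"
      by (rule Quotient_abs_rep[OF Quotient_weyl])
    then have "rep_weyl (abs_weyl p) - p \<in> weyl_ideal"
      by (simp add: weyl.abs_eq_iff)
    then have "f_op (rep_weyl (abs_weyl p) - p) x = 0"
      using that by (rule f_op_ideal)
    then show ?thesis using that by (simp add: act_def f_op_diff)
  qed
  have ex_abs: "\<exists>p. a = abs_weyl p" for a :: "('n, 'k) weyl"
    by (metis Quotient_abs_rep[OF Quotient_weyl])
  have act: "left_module M act"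
  proof
    fix x y and a b :: "('n, 'k) weyl"
    obtain p q where ab: "a = abs_weyl p" "b = abs_weyl q"
      using ex_abs by metis
    show "0 \<in> M" by (rule M_0)
    show "x + y \<in> M" if "x \<in> M" "y \<in> M" using that by (rule M_add)
    show "- x \<in> M" if "x \<in> M" using that by (rule V.subspace_neg[OF M])
    show "act a x \<in> M" if "x \<in> M" using that by (simp add: ab act_abs f_op_mem)
    show "act a (x + y) = act a x + act a y" if "x \<in> M" "y \<in> M"
      using that by (simp add: ab act_abs f_op_add M_add)
    show "act (a + b) x = act a x + act b x" if "x \<in> M"
      using that by (simp add: ab act_abs f_op_plus plus_weyl.abs_eq)
    show "act (a * b) x = act a (act b x)" if "x \<in> M"
      using that by (simp add: ab act_abs f_op_mult f_op_mem times_weyl.abs_eq)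
    show "act 1 x = x" if "x \<in> M"
      using that by (simp add: one_weyl.abs_eq act_abs f_op_one)
  qed
  have "const_scale act c x = sc c x" for c x
  proof (cases "x \<in> M")
    case True
    then show ?thesis
      by (simp add: const_scale_def weyl_const.abs_eq act_abs free_const_def f_op_single)
        (simp add: w_op_def zero_word_def)
  next
    case False
    then show ?thesis by (auto simp: const_scale_def act_def weyl_const_inject)
  qed
  then have "const_scale act = sc" by (simp add: fun_eq_iff)
  moreover have "act (weyl_x i) x = g_op (GenX i) x" "act (weyl_d i) x = g_op (GenD i) x" if "x \<in> M" for i x
    using that by (simp_all add: weyl_x.abs_eq weyl_d.abs_eq act_abs f_op_gen)
  ultimately show ?thesis using that[OF act] by blast
qed

section \<open>The filtration of a module and its Hilbert polynomial\<close>

text \<open>\<open>dim\<close> refers to a vector space structure on the whole type, about which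
  \<open>left_module\<close> says nothing outside \<open>M\<close>.\<close>

locale weyl_module =
  left_module M act + vs: vector_space "const_scale act"
  for M :: "'m::ab_group_add set" and act :: "('n::finite, 'k::field) weyl \<Rightarrow> 'm \<Rightarrow> 'm"
begin

lemma act_zero_left: "x \<in> M \<Longrightarrow> act 0 x = 0"
  using add_act[of x 0 0] by simp

lemma act_uminus: "x \<in> M \<Longrightarrow> act (- a) x = - act a x"
  using add_act[of x a "- a"] by (simp add: act_zero_left eq_neg_iff_add_eq_0 add.commute)

lemma act_diff: "x \<in> M \<Longrightarrow> act (a - b) x = act a x - act b x"
  using add_act[of x a "- b"] by (simp add: act_uminus)

lemma act_weyl_scale: "x \<in> M \<Longrightarrow> act (weyl_scale c a) x = const_scale act c (act a x)"
  by (simp add: weyl_scale_def const_scale_def mult_act)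

lemma act_const_scale: "x \<in> M \<Longrightarrow> act a (const_scale act c x) = const_scale act c (act a x)"
  by (simp add: const_scale_def mult_act[symmetric] weyl_const_commute)

lemma const_scale_mem: "x \<in> M \<Longrightarrow> const_scale act c x \<in> M"
  by (simp add: const_scale_def act_mem)

lemma subspace_M: "vs.subspace M"
  by (simp add: vs.subspace_def zero_mem add_mem const_scale_mem)

lemma sum_mem: "(\<And>s. s \<in> S \<Longrightarrow> f s \<in> M) \<Longrightarrow> sum f S \<in> M"
  by (rule vs.subspace_sum[OF subspace_M])

lemma act_zero_right: "act a 0 = 0"
  using act_add[OF zero_mem zero_mem, of a] by simp

lemma act_sum: "(\<And>s. s \<in> S \<Longrightarrow> f s \<in> M) \<Longrightarrow> act a (sum f S) = (\<Sum>s\<in>S. act a (f s))"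
  by (induction S rule: infinite_finite_induct) (simp_all add: act_zero_right act_add sum_mem)

lemma act_weyl_span:
  assumes "a \<in> weyl.span (wmon ` G)" "x \<in> M"
  shows "act a x \<in> vs.span {act (wmon \<gamma>) x | \<gamma>. \<gamma> \<in> G}"
  using assms(1)
proof (induction rule: weyl.span_induct_alt)
  case base
  show ?case using assms(2) by (simp add: act_zero_left vs.span_zero)
next
  case (step c a b)
  then have "act a x \<in> vs.span {act (wmon \<gamma>) x | \<gamma>. \<gamma> \<in> G}"
    by (auto intro: vs.span_base)
  then show ?case
    using step assms(2) by (simp add: add_act act_weyl_scale vs.span_add vs.span_scale)
qed

text \<open>A spanning set of \<open>gamma act S i\<close>, finite when \<open>S\<close> is, so that
  dimensions can be bounded by counting.\<close>

definition gamma_family :: "'m set \<Rightarrow> nat \<Rightarrow> 'm set" where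
  "gamma_family S i = {act (wmon \<gamma>) s | \<gamma> s. edeg \<gamma> \<le> i \<and> s \<in> S}"

lemma gamma_family_eq: "gamma_family S i = (\<lambda>(s, \<gamma>). act (wmon \<gamma>) s) ` (S \<times> {\<gamma>. edeg \<gamma> \<le> i})"
  by (auto simp: gamma_family_def)

lemma finite_gamma_family: "finite S \<Longrightarrow> finite (gamma_family S i)"
  by (simp add: gamma_family_eq)

lemma gamma_eq_span:
  assumes "finite S" "S \<subseteq> M"
  shows "gamma act S i = vs.span (gamma_family S i)"
proof
  show "gamma act S i \<subseteq> vs.span (gamma_family S i)"
  proof
    fix x assume "x \<in> gamma act S i"
    then obtain b where x: "x = (\<Sum>m\<in>S. act (b m) m)" "\<And>m. m \<in> S \<Longrightarrow> b m \<in> bernstein i"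
      by (auto simp: gamma_def)
    have "act (b m) m \<in> vs.span (gamma_family S i)" if "m \<in> S" for m
    proof -
      have "act (b m) m \<in> vs.span {act (wmon \<gamma>) m | \<gamma>. \<gamma> \<in> {\<gamma>. edeg \<gamma> \<le> i}}"
        using x(2)[OF that] assms(2) that by (intro act_weyl_span) (auto simp: bernstein_eq)
      also have "\<dots> \<subseteq> vs.span (gamma_family S i)"
        using that by (intro vs.span_mono) (auto simp: gamma_family_def)
      finally show ?thesis .
    qed
    then show "x \<in> vs.span (gamma_family S i)"
      unfolding x(1) by (rule vs.span_sum)
  qed
  show "vs.span (gamma_family S i) \<subseteq> gamma act S i"
  proof (rule vs.span_minimal)
    show "gamma_family S i \<subseteq> gamma act S i"
    proof
      fix x assume "x \<in> gamma_family S i"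
      then obtain \<gamma> s where x: "x = act (wmon \<gamma>) s" "edeg \<gamma> \<le> i" "s \<in> S"
        by (auto simp: gamma_family_def)
      let ?b = "\<lambda>m. if m = s then wmon \<gamma> else 0"
      have "(\<Sum>m\<in>S. act (?b m) m) = (\<Sum>m\<in>S. if m = s then x else 0)"
        by (rule sum.cong) (use x assms(2) act_zero_left in auto)
      also have "\<dots> = x"
        using assms(1) x(3) by simp
      finally show "x \<in> gamma act S i"
        using x weyl.subspace_0[OF subspace_bernstein] unfolding gamma_def
        by (intro CollectI exI[of _ ?b]) (auto intro: wmon_bernstein)
    qed
    show "vs.subspace (gamma act S i)"
      unfolding vs.subspace_def
    proof (intro conjI ballI allI)
      have "(\<Sum>m\<in>S. act 0 m) = 0"
        by (rule sum.neutral) (use assms(2) act_zero_left in auto)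
      then show "0 \<in> gamma act S i"
        unfolding gamma_def
        by (intro CollectI exI[of _ "\<lambda>_. 0"]) (simp add: weyl.subspace_0[OF subspace_bernstein])
    next
      fix x y assume "x \<in> gamma act S i" "y \<in> gamma act S i"
      then obtain b b' where "x = (\<Sum>m\<in>S. act (b m) m)" "\<forall>m\<in>S. b m \<in> bernstein i"
        "y = (\<Sum>m\<in>S. act (b' m) m)" "\<forall>m\<in>S. b' m \<in> bernstein i"
        unfolding gamma_def by blast
      moreover from this have "x + y = (\<Sum>m\<in>S. act (b m + b' m) m)"
        using assms(2) by (auto simp: sum.distrib[symmetric] add_act intro!: sum.cong)
      ultimately show "x + y \<in> gamma act S i"
        unfolding gamma_def
        by (intro CollectI exI[of _ "\<lambda>m. b m + b' m"])
          (simp add: weyl.subspace_add[OF subspace_bernstein])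
    next
      fix c x assume "x \<in> gamma act S i"
      then obtain b where b: "x = (\<Sum>m\<in>S. act (b m) m)" "\<forall>m\<in>S. b m \<in> bernstein i"
        unfolding gamma_def by blast
      then have "const_scale act c x = (\<Sum>m\<in>S. act (weyl_scale c (b m)) m)"
        using assms(2) by (auto simp: vs.scale_sum_right act_weyl_scale intro!: sum.cong)
      moreover have "\<forall>m\<in>S. weyl_scale c (b m) \<in> bernstein i"
        using b(2) weyl.subspace_scale[OF subspace_bernstein] by blast
      ultimately show "const_scale act c x \<in> gamma act S i"
        unfolding gamma_def by (intro CollectI exI[of _ "\<lambda>m. weyl_scale c (b m)"] conjI)
    qed
  qed
qed

lemma gamma_mono: "i \<le> j \<Longrightarrow> gamma act S i \<subseteq> gamma act S j"
  unfolding gamma_def using bernstein_mono[of i j] by blast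

lemma gamma_act:
  assumes "S \<subseteq> M" "x \<in> gamma act S i" "b \<in> bernstein j"
  shows "act b x \<in> gamma act S (j + i)"
proof -
  obtain c where c: "x = (\<Sum>m\<in>S. act (c m) m)" "\<forall>m\<in>S. c m \<in> bernstein i"
    using assms(2) unfolding gamma_def by blast
  have "act b x = (\<Sum>m\<in>S. act b (act (c m) m))"
    unfolding c(1) by (rule act_sum) (use assms(1) act_mem in blast)
  also have "\<dots> = (\<Sum>m\<in>S. act (b * c m) m)"
    by (rule sum.cong) (use assms(1) mult_act in auto)
  finally have "act b x = (\<Sum>m\<in>S. act (b * c m) m)" .
  moreover have "\<forall>m\<in>S. b * c m \<in> bernstein (j + i)"
    using c(2) bernstein_mult[OF assms(3)] by blast
  ultimately show ?thesis
    unfolding gamma_def by (intro CollectI exI[of _ "\<lambda>m. b * c m"] conjI)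
qed

lemma wgen_gamma:
  assumes "S \<subseteq> M" "x \<in> gamma act S i"
  shows "act (wgen k) x \<in> gamma act S (Suc i)"
proof -
  have "(wgen k :: ('n, 'k) weyl) \<in> bernstein 1"
    using wgen_weyl_less[of 1 1 k] wmon_weyl_less[of 0 1] by (simp add: bernstein_weyl_less)
  then show ?thesis using gamma_act[OF assms] by fastforce
qed

lemma ex_gamma:
  assumes "left_generates M act S" "x \<in> M"
  shows "\<exists>i. x \<in> gamma act S i"
proof -
  have S: "finite S" using assms(1) by (simp add: left_generates_def)
  obtain b where b: "x = (\<Sum>m\<in>S. act (b m) m)"
    using assms unfolding left_generates_def by blast
  have "\<forall>m. \<exists>d. b m \<in> bernstein d"
    using ex_bernstein by blast
  from choice[OF this] obtain d where d: "\<And>m. b m \<in> bernstein (d m)"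
    by blast
  have "b m \<in> bernstein (Max (insert 0 (d ` S)))" if "m \<in> S" for m
    using d[of m] bernstein_mono[of "d m" "Max (insert 0 (d ` S))"] S that by auto
  then show ?thesis unfolding b gamma_def by blast
qed

text \<open>The filtration lemma applies to the vectors \<open>act (wmon \<gamma>) s\<close>: by
  \<open>wgen_wmon\<close>, a generator shifts the exponent by a unit up to terms of lower
  degree.\<close>

lemma ex_has_hilbert_poly:
  assumes "finite S" "S \<subseteq> M"
  obtains p where "has_hilbert_poly act S p"
proof -
  have "eventually_poly (\<lambda>i. vs.dim {act (wmon \<gamma>) s | \<gamma> s. edeg \<gamma> \<le> i \<and> s \<in> S})"
  proof (rule vs.eventually_poly_dim_filtration[OF assms(1) subspace_M, where X = "\<lambda>i. act (wgen i)"])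
    fix i \<gamma> s assume s: "s \<in> S"
    have "act (wgen i * wmon \<gamma> - wmon (\<gamma> + eunit i)) s
        \<in> vs.span {act (wmon \<delta>) s | \<delta>. \<delta> \<in> {\<delta>. edeg \<delta> < edeg \<gamma>}}"
      using s assms(2) wgen_wmon[of i \<gamma>] by (intro act_weyl_span) (auto simp: weyl_less_def)
    also have "\<dots> \<subseteq> vs.span {act (wmon \<delta>) t | \<delta> t. edeg \<delta> \<le> edeg \<gamma> \<and> t \<in> S}"
      by (rule vs.span_mono) (use s in \<open>auto intro: less_imp_le\<close>)
    finally show "act (wgen i) (act (wmon \<gamma>) s) - act (wmon (\<gamma> + eunit i)) s
        \<in> vs.span {act (wmon \<delta>) t | \<delta> t. edeg \<delta> \<le> edeg \<gamma> \<and> t \<in> S}"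
      using s assms(2) by (auto simp: act_diff mult_act)
  qed (use assms(2) in \<open>auto simp: act_mem act_add act_const_scale\<close>)
  then show ?thesis
    using that unfolding eventually_poly_def has_hilbert_poly_def
    by (auto simp: gamma_eq_span[OF assms] gamma_family_def vs.dim_span)
qed

end

section \<open>The rank of a holonomic bimodule as a left module\<close>

locale enveloped_bimodule =
  weyl_bimodule UNIV l r + env: weyl_module UNIV act
  for l :: "('n::finite, 'k::field_char_0) weyl \<Rightarrow> 'm::ab_group_add \<Rightarrow> 'm"
    and r :: "'m \<Rightarrow> ('n, 'k) weyl \<Rightarrow> 'm"
    and act :: "('n + 'n, 'k) weyl \<Rightarrow> 'm \<Rightarrow> 'm" +
  assumes enveloping: "enveloping_action UNIV l r act"
begin

lemma act_const: "act (weyl_const c) x = l (weyl_const c) x"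
  and act_gen: "act (weyl_x (Inl i)) x = l (weyl_x i) x" "act (weyl_d (Inl i)) x = l (weyl_d i) x"
  using enveloping by (auto simp: enveloping_action_def)

text \<open>The outer sum tells x from d and the inner one tells left from right, hence
  \<open>map_sum Inl Inl\<close>.\<close>

lemma l_wgen: "l (wgen k) x = act (wgen (map_sum Inl Inl k)) x"
  by (cases k) (simp_all add: act_gen)

lemma l_weyl_scale: "l (weyl_scale c a) x = const_scale act c (l a x)"
  by (simp add: weyl_scale_def left.mult_act const_scale_def act_const)

lemma l_zero: "l 0 x = 0"
  using left.add_act[of x 0 0] by simp

lemma l_sum_left: "l (\<Sum>p\<in>P. f p) x = (\<Sum>p\<in>P. l (f p) x)"
  by (induction P rule: infinite_finite_induct) (simp_all add: l_zero left.add_act)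

lemma wmon_gamma:
  assumes "x \<in> gamma act S j"
  shows "l (wmon \<gamma>) x \<in> gamma act S (edeg \<gamma> + j)"
proof (induction \<gamma> rule: wmon_induct_left[where 'n = 'n and 'k = 'k])
  case zero
  then show ?case using assms by (simp add: left.one_act)
next
  case (add \<gamma> i)
  have "l (wgen i) (l (wmon \<gamma>) x) \<in> gamma act S (Suc (edeg \<gamma> + j))"
    unfolding l_wgen by (rule env.wgen_gamma[OF _ add(1)]) simp
  then show ?case
    by (simp only: add(2) left.mult_act[OF UNIV_I] edeg_add edeg_eunit) simp
qed

definition left_independent :: "'m set \<Rightarrow> bool" where
  "left_independent T \<longleftrightarrow> finite T \<and> (\<forall>a. (\<Sum>t\<in>T. l (a t) t) = 0 \<longrightarrow> (\<forall>t\<in>T. a t = 0))"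

text \<open>The monomial multiples of \<open>T\<close> are linearly independent over the field and
  stay within the filtration. Only the 2n left generators are used, so the exponents have
  \<open>CARD('n + 'n)\<close> entries.\<close>

lemma card_left_independent_le_dim:
  assumes T: "left_independent T" "T \<subseteq> gamma act S j" and S: "finite S"
  shows "card T * ((i + CARD('n + 'n)) choose CARD('n + 'n)) \<le> env.vs.dim (gamma act S (i + j))"
proof -
  let ?P = "T \<times> {\<gamma> :: 'n + 'n \<Rightarrow> nat. edeg \<gamma> \<le> i}"
  let ?v = "\<lambda>(t, \<gamma>). l (wmon \<gamma>) t"
  have gamma: "gamma act S m = env.vs.span (env.gamma_family S m)" for m
    by (rule env.gamma_eq_span[OF S]) simp
  have fin: "finite T" "finite ?P"
    using T(1) by (simp_all add: left_independent_def)
  have indep: "\<forall>p\<in>?P. c p = 0" if sum: "(\<Sum>p\<in>?P. const_scale act (c p) (?v p)) = 0" for c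
  proof -
    \<comment> \<open>Collecting the scalar relation by the elements of \<open>T\<close> turns it
      into a relation over the algebra.\<close>
    let ?a = "\<lambda>t. \<Sum>\<gamma> | edeg \<gamma> \<le> i. weyl_scale (c (t, \<gamma>)) (wmon \<gamma>)"
    have "(\<Sum>t\<in>T. l (?a t) t) = (\<Sum>t\<in>T. \<Sum>\<gamma> | edeg \<gamma> \<le> i. const_scale act (c (t, \<gamma>)) (l (wmon \<gamma>) t))"
      by (simp add: l_sum_left l_weyl_scale)
    also have "\<dots> = (\<Sum>p\<in>?P. const_scale act (c p) (?v p))"
      by (simp add: sum.cartesian_product case_prod_unfold)
    finally have "(\<Sum>t\<in>T. l (?a t) t) = 0"
      unfolding sum .
    moreover have "(\<Sum>t\<in>T. l (?a t) t) = 0 \<longrightarrow> (\<forall>t\<in>T. ?a t = 0)"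
      using T(1) unfolding left_independent_def by (elim conjE allE[of _ ?a])
    ultimately have "\<forall>t\<in>T. ?a t = 0"
      by (rule rev_mp)
    then have "\<forall>\<gamma>\<in>{\<gamma>. edeg \<gamma> \<le> i}. c (t, \<gamma>) = 0" if "t \<in> T" for t
      using that by (intro wmon_family_independent) auto
    then show ?thesis by auto
  qed
  have "?v ` ?P \<subseteq> gamma act S (i + j)"
  proof clarify
    fix t and \<gamma> :: "'n + 'n \<Rightarrow> nat" assume "t \<in> T" "edeg \<gamma> \<le> i"
    then have "l (wmon \<gamma>) t \<in> gamma act S (edeg \<gamma> + j)"
      using T(2) by (intro wmon_gamma) auto
    then show "l (wmon \<gamma>) t \<in> gamma act S (i + j)"
      using env.gamma_mono[of "edeg \<gamma> + j" "i + j" S] \<open>edeg \<gamma> \<le> i\<close> by auto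
  qed
  then have "card ?P \<le> env.vs.dim (env.gamma_family S (i + j))"
    unfolding gamma
    by (intro env.vs.family_card_le_dim[OF fin(2) indep _ env.finite_gamma_family[OF S]])
  then show ?thesis
    by (simp add: gamma env.vs.dim_span card_cartesian_product card_edeg_le)
qed

lemma left_independent_bound:
  assumes gen: "left_generates UNIV act S" and p: "has_hilbert_poly act S p"
    and deg: "degree p = CARD('n + 'n)"
  obtains B where "\<And>T. left_independent T \<Longrightarrow> card T \<le> B"
proof -
  let ?N = "CARD('n + 'n)"
  have S: "finite S" using gen by (simp add: left_generates_def)
  obtain K where K: "0 \<le> K" "\<And>i. 1 \<le> i \<Longrightarrow> poly p (of_nat i) \<le> K * of_nat i ^ ?N"
    using poly_of_nat_le_power[of p] deg by metis
  \<comment> \<open>The factorial comes from replacing the binomial by a power, \<open>K\<close>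
    from bounding \<open>p\<close>, and \<open>2 ^ ?N\<close> from
    \<open>i + j \<le> 2 * i\<close>.\<close>
  obtain B :: nat where B: "fact ?N * K * 2 ^ ?N \<le> of_nat B"
    using real_arch_simple by blast
  have "card T \<le> B" if T: "left_independent T" for T
  proof -
    have "\<forall>t. \<exists>i. t \<in> gamma act S i"
      using env.ex_gamma[OF gen] by blast
    from choice[OF this] obtain d where d: "\<And>t. t \<in> gamma act S (d t)"
      by blast
    have finT: "finite T" using T by (simp add: left_independent_def)
    define j where "j = Max (insert 0 (d ` T))"
    have Tj: "T \<subseteq> gamma act S j"
    proof
      fix t assume "t \<in> T"
      then have "d t \<le> j" unfolding j_def using finT by (intro Max_ge) auto
      then show "t \<in> gamma act S j" using d[of t] env.gamma_mono[of "d t" j S] by auto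
    qed
    obtain n where n: "\<And>i. n \<le> i \<Longrightarrow>
        of_nat (env.vs.dim (gamma act S i)) = poly p (of_nat i)"
      using p by (auto simp: has_hilbert_poly_def eventually_sequentially)
    \<comment> \<open>Taking \<open>i\<close> at least \<open>j\<close> absorbs the level of
      \<open>T\<close>, so that \<open>B\<close> does not depend on \<open>T\<close>.\<close>
    define i where "i = max 1 (max n j)"
    have i: "1 \<le> i" "n \<le> i + j" "j \<le> i" by (auto simp: i_def)
    have "card T * i ^ ?N \<le> card T * (fact ?N * ((i + ?N) choose ?N))"
      by (intro mult_le_mono2 power_le_binomial)
    also have "\<dots> = fact ?N * (card T * ((i + ?N) choose ?N))"
      by (simp only: ac_simps)
    also have "\<dots> \<le> fact ?N * env.vs.dim (gamma act S (i + j))"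
      by (intro mult_le_mono2 card_left_independent_le_dim[OF T Tj S])
    finally have "(of_nat (card T * i ^ ?N) :: rat) \<le> of_nat (fact ?N * env.vs.dim (gamma act S (i + j)))"
      by (rule of_nat_mono)
    also have "\<dots> = fact ?N * poly p (of_nat (i + j))"
      using n[OF i(2)] by simp
    also have "\<dots> \<le> fact ?N * (K * of_nat (i + j) ^ ?N)"
      using K(2)[of "i + j"] i by (intro mult_left_mono) auto
    also have "\<dots> \<le> fact ?N * (K * (2 * of_nat i) ^ ?N)"
      using K(1) i by (intro mult_left_mono power_mono) auto
    also have "\<dots> = fact ?N * K * 2 ^ ?N * of_nat i ^ ?N"
      by (simp add: power_mult_distrib)
    also have "\<dots> \<le> of_nat B * of_nat i ^ ?N"
      using B by (rule mult_right_mono) simp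
    finally have "(of_nat (card T * i ^ ?N) :: rat) \<le> of_nat (B * i ^ ?N)"
      by simp
    then have "card T * i ^ ?N \<le> B * i ^ ?N"
      by (simp only: of_nat_le_iff)
    then show ?thesis using i(1) by simp
  qed
  then show ?thesis using that by blast
qed

text \<open>Modulo a maximal left independent set every element of the bimodule is torsion.\<close>

lemma left_hom_determined_by_finite:
  assumes "\<And>T. left_independent T \<Longrightarrow> card T \<le> B"
  obtains T where "finite T"
    "\<And>\<phi>. \<phi> \<in> left_hom l (*) \<Longrightarrow> (\<And>t. t \<in> T \<Longrightarrow> \<phi> t = 0) \<Longrightarrow> \<phi> = 0"
proof -
  have "left_independent {}" by (simp add: left_independent_def)
  then obtain T where T: "left_independent T"
    and max: "\<And>T'. left_independent T' \<Longrightarrow> card T' \<le> card T"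
    using ex_has_greatest_nat[of left_independent "{}" card "Suc B"] assms by (auto simp: less_Suc_eq_le)
  have fin: "finite T" using T by (simp add: left_independent_def)
  have "\<phi> = 0" if \<phi>: "\<phi> \<in> left_hom l (*)" and zero: "\<And>t. t \<in> T \<Longrightarrow> \<phi> t = 0" for \<phi>
  proof
    fix m
    have \<phi>_add: "\<phi> (x + y) = \<phi> x + \<phi> y" and \<phi>_l: "\<phi> (l a x) = a * \<phi> x" for a x y
      using \<phi> by (simp_all add: left_hom_def)
    have \<phi>_zero: "\<phi> 0 = 0" using \<phi>_add[of 0 0] by simp
    have \<phi>_sum: "\<phi> (sum f P) = (\<Sum>p\<in>P. \<phi> (f p))" for f and P :: "'m set"
      by (induction P rule: infinite_finite_induct) (simp_all add: \<phi>_zero \<phi>_add)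
    have "\<phi> m = 0"
    proof (cases "m \<in> T")
      case False
      then have "card (insert m T) = Suc (card T)" using fin by simp
      then have "\<not> left_independent (insert m T)" using max[of "insert m T"] by auto
      then obtain a where a: "(\<Sum>t\<in>insert m T. l (a t) t) = 0" "\<not> (\<forall>t\<in>insert m T. a t = 0)"
        using fin by (auto simp: left_independent_def)
      \<comment> \<open>Otherwise the relation would already hold within \<open>T\<close>. Applying
        \<open>\<phi>\<close>, which vanishes on \<open>T\<close>, then leaves
        \<open>a m * \<phi> m = 0\<close> in a domain.\<close>
      have am: "a m \<noteq> 0"
      proof
        assume "a m = 0"
        then have "(\<Sum>t\<in>T. l (a t) t) = 0"
          using a(1) False fin by (simp add: l_zero)
        then show False using T a(2) \<open>a m = 0\<close> by (auto simp: left_independent_def)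
      qed
      have "0 = \<phi> (\<Sum>t\<in>insert m T. l (a t) t)"
        by (simp only: a(1) \<phi>_zero)
      also have "\<dots> = (\<Sum>t\<in>insert m T. a t * \<phi> t)"
        by (simp only: \<phi>_sum \<phi>_l)
      also have "\<dots> = a m * \<phi> m"
        using False fin zero by simp
      finally show ?thesis using am weyl_no_zero_divisors by metis
    qed (rule zero)
    then show "\<phi> m = 0 m" by (simp add: zero_fun_apply)
  qed
  with fin show ?thesis using that by blast
qed

end

section \<open>Finite generation of the dual\<close>

definition right_span :: "('m \<Rightarrow> 'a::ring_1) set \<Rightarrow> ('m \<Rightarrow> 'a) set" where
  "right_span F = {\<Sum>f\<in>F. hom_right_act (*) f (b f) | b. True}"

lemma hom_right_act_simps:
  fixes \<phi> \<psi> :: "'m \<Rightarrow> 'a::ring_1"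
  shows "hom_right_act (*) (\<phi> + \<psi>) a = hom_right_act (*) \<phi> a + hom_right_act (*) \<psi> a"
    and "hom_right_act (*) \<phi> (a + b) = hom_right_act (*) \<phi> a + hom_right_act (*) \<phi> b"
    and "hom_right_act (*) \<phi> (a * b) = hom_right_act (*) (hom_right_act (*) \<phi> a) b"
    and "hom_right_act (*) \<phi> 1 = \<phi>"
    and "hom_right_act (*) \<phi> 0 = 0"
    and "hom_right_act (*) 0 a = 0"
    and "hom_right_act (*) \<phi> (- a) = - hom_right_act (*) \<phi> a"
  by (simp_all add: hom_right_act_def fun_eq_iff plus_fun_apply zero_fun_apply distrib_left
      distrib_right mult.assoc)

lemma right_span_zero: "0 \<in> right_span F"
proof -
  have "(\<Sum>f\<in>F. hom_right_act (*) f 0) = 0"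
    by (rule sum.neutral) (simp add: hom_right_act_simps)
  then show ?thesis
    unfolding right_span_def by (intro CollectI exI[of _ "\<lambda>_. 0"]) simp
qed

lemma right_span_add:
  assumes "\<phi> \<in> right_span F" "\<psi> \<in> right_span F"
  shows "\<phi> + \<psi> \<in> right_span F"
proof -
  obtain u v where "\<phi> = (\<Sum>f\<in>F. hom_right_act (*) f (u f))" "\<psi> = (\<Sum>f\<in>F. hom_right_act (*) f (v f))"
    using assms unfolding right_span_def by blast
  then have "\<phi> + \<psi> = (\<Sum>f\<in>F. hom_right_act (*) f (u f + v f))"
    by (simp only: hom_right_act_simps sum.distrib)
  then show ?thesis
    unfolding right_span_def by (intro CollectI exI[of _ "\<lambda>f. u f + v f"]) simp
qed

lemma right_span_base:
  assumes "finite F" "f \<in> F"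
  shows "hom_right_act (*) f b \<in> right_span F"
proof -
  have "(\<Sum>g\<in>F. hom_right_act (*) g (if g = f then b else 0))
      = (\<Sum>g\<in>F. if g = f then hom_right_act (*) f b else 0)"
    by (rule sum.cong) (auto simp: hom_right_act_simps)
  also have "\<dots> = hom_right_act (*) f b"
    using assms by simp
  finally show ?thesis
    unfolding right_span_def by (intro CollectI exI[of _ "\<lambda>g. if g = f then b else 0"]) simp
qed

lemma right_span_sum: "(\<And>p. p \<in> P \<Longrightarrow> h p \<in> right_span F) \<Longrightarrow> sum h P \<in> right_span F"
  by (induction P rule: infinite_finite_induct) (simp_all add: right_span_zero right_span_add)

lemma right_span_mono:
  assumes "finite G" "F \<subseteq> G"
  shows "right_span F \<subseteq> right_span G"
proof
  fix \<phi> assume "\<phi> \<in> right_span F"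
  then obtain b where b: "\<phi> = (\<Sum>f\<in>F. hom_right_act (*) f (b f))"
    unfolding right_span_def by blast
  show "\<phi> \<in> right_span G"
    unfolding b by (rule right_span_sum, rule right_span_base) (use assms in auto)
qed

text \<open>
  Induction on the number of evaluation points: the values at one point form a right ideal,
  and the functions vanishing there are handled by the induction hypothesis.
\<close>

lemma right_submodule_finitely_generated:
  fixes Q :: "('m \<Rightarrow> ('n::finite, 'k::field) weyl) set"
  assumes "finite T"
    and "\<And>\<phi> \<psi>. \<phi> \<in> Q \<Longrightarrow> \<psi> \<in> Q \<Longrightarrow> \<phi> + \<psi> \<in> Q"
    and "\<And>\<phi> a. \<phi> \<in> Q \<Longrightarrow> hom_right_act (*) \<phi> a \<in> Q"
    and "\<And>\<phi>. \<phi> \<in> Q \<Longrightarrow> (\<And>t. t \<in> T \<Longrightarrow> \<phi> t = 0) \<Longrightarrow> \<phi> = 0"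
  shows "\<exists>F. finite F \<and> F \<subseteq> Q \<and> Q \<subseteq> right_span F"
  using assms
proof (induction T arbitrary: Q rule: finite_induct)
  case empty
  then have "Q \<subseteq> {0}" by blast
  then show ?case
    by (intro exI[of _ "{}"]) (auto simp: right_span_zero)
next
  case (insert t T)
  define J where "J = (\<lambda>\<phi>. \<phi> t) ` Q"
  have J_add: "a + b \<in> J" if ab: "a \<in> J" "b \<in> J" for a b
  proof -
    obtain \<phi> \<psi> where "\<phi> \<in> Q" "\<psi> \<in> Q" "a = \<phi> t" "b = \<psi> t"
      using ab unfolding J_def by blast
    moreover from this have "\<phi> + \<psi> \<in> Q"
      using insert.prems(1) by blast
    moreover have "\<phi> t + \<psi> t = (\<phi> + \<psi>) t"
      by (simp add: plus_fun_apply)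
    ultimately have "\<phi> + \<psi> \<in> Q" "a + b = (\<phi> + \<psi>) t"
      by simp_all
    then show ?thesis unfolding J_def by blast
  qed
  have J_mult: "a * b \<in> J" if a: "a \<in> J" for a b
  proof -
    obtain \<phi> where "\<phi> \<in> Q" "a = \<phi> t"
      using a unfolding J_def by blast
    then have "hom_right_act (*) \<phi> b \<in> Q" "a * b = hom_right_act (*) \<phi> b t"
      using insert.prems(2) by (simp_all add: hom_right_act_def)
    then show ?thesis unfolding J_def by blast
  qed
  obtain F where F: "finite F" "F \<subseteq> J" "\<And>a. a \<in> J \<Longrightarrow> \<exists>b. a = (\<Sum>f\<in>F. f * b f)"
    using right_ideal_finitely_generated[of J, OF J_add J_mult] by metis
  have "\<forall>f\<in>F. \<exists>\<phi>. \<phi> \<in> Q \<and> \<phi> t = f"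
    using F(2) unfolding J_def by blast
  from bchoice[OF this] obtain h where h: "\<And>f. f \<in> F \<Longrightarrow> h f \<in> Q" "\<And>f. f \<in> F \<Longrightarrow> h f t = f"
    by blast
  define Q' where "Q' = {\<phi>\<in>Q. \<phi> t = 0}"
  have "\<exists>G. finite G \<and> G \<subseteq> Q' \<and> Q' \<subseteq> right_span G"
  proof (rule insert.IH)
    show "\<phi> + \<psi> \<in> Q'" if "\<phi> \<in> Q'" "\<psi> \<in> Q'" for \<phi> \<psi>
    proof -
      have "(\<phi> + \<psi>) t = 0"
        using that by (simp add: Q'_def plus_fun_apply)
      then show ?thesis
        using that insert.prems(1) by (simp add: Q'_def)
    qed
    show "hom_right_act (*) \<phi> a \<in> Q'" if "\<phi> \<in> Q'" for \<phi> a
      using that insert.prems(2) by (simp add: Q'_def hom_right_act_def)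
    show "\<phi> = 0" if \<phi>: "\<phi> \<in> Q'" "\<And>t. t \<in> T \<Longrightarrow> \<phi> t = 0" for \<phi>
      using \<phi> insert.prems(3)[of \<phi>] by (auto simp: Q'_def)
  qed
  then obtain G where G: "finite G" "G \<subseteq> Q'" "Q' \<subseteq> right_span G"
    by blast
  have fin: "finite (h ` F \<union> G)"
    using F(1) G(1) by simp
  have "\<phi> \<in> right_span (h ` F \<union> G)" if \<phi>: "\<phi> \<in> Q" for \<phi>
  proof -
    obtain b where b: "\<phi> t = (\<Sum>f\<in>F. f * b f)"
      using F(3)[of "\<phi> t"] \<phi> unfolding J_def by blast
    \<comment> \<open>Lifts of the ideal generators are combined to match the value of
      \<open>\<phi>\<close> at \<open>t\<close>; the difference then lies in
      \<open>Q'\<close>.\<close>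
    define \<psi> where "\<psi> = (\<Sum>f\<in>F. hom_right_act (*) (h f) (b f))"
    have zero: "0 \<in> Q"
      using insert.prems(2)[OF \<phi>, of 0] by (simp add: hom_right_act_simps)
    have sum_Q: "sum g P \<in> Q" if "\<And>p. p \<in> P \<Longrightarrow> g p \<in> Q" for g and P :: "('n, 'k) weyl set"
      using that by (induction P rule: infinite_finite_induct) (simp_all add: zero insert.prems(1))
    have "\<phi> + hom_right_act (*) \<psi> (- 1) \<in> Q"
      unfolding \<psi>_def by (intro insert.prems(1,2) sum_Q \<phi> h(1))
    then have diff_Q: "\<phi> - \<psi> \<in> Q"
      by (simp add: hom_right_act_simps)
    have "\<psi> t = (\<Sum>f\<in>F. h f t * b f)"
      unfolding \<psi>_def hom_right_act_def
      by (induction F rule: infinite_finite_induct) (simp_all add: plus_fun_apply zero_fun_apply)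
    also have "\<dots> = \<phi> t"
      unfolding b by (rule sum.cong) (simp_all add: h(2))
    finally have "(\<phi> - \<psi>) t = 0" by simp
    with diff_Q have "\<phi> - \<psi> \<in> Q'"
      by (simp add: Q'_def)
    then have "\<phi> - \<psi> \<in> right_span (h ` F \<union> G)"
      using G(3) right_span_mono[OF fin, of G] by blast
    moreover have "\<psi> \<in> right_span (h ` F \<union> G)"
      unfolding \<psi>_def by (intro right_span_sum right_span_base[OF fin]) simp
    ultimately have "(\<phi> - \<psi>) + \<psi> \<in> right_span (h ` F \<union> G)"
      by (rule right_span_add)
    then show ?thesis by simp
  qed
  moreover have "h ` F \<union> G \<subseteq> Q"
    using h(1) G(2) unfolding Q'_def by blast
  ultimately show ?case using fin by blast
qed

section \<open>The dual bimodule\<close>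

text \<open>Scalars act through the target. This is a vector space on all functions, and on the dual
  it agrees with the constants acting from either side.\<close>

definition fun_scale :: "'k::field \<Rightarrow> ('m \<Rightarrow> ('n, 'k) weyl) \<Rightarrow> 'm \<Rightarrow> ('n, 'k) weyl" where
  "fun_scale c \<phi> = (\<lambda>x. weyl_const c * \<phi> x)"

lemma vector_space_fun_scale: "vector_space fun_scale"
  by standard (simp_all add: fun_scale_def fun_eq_iff plus_fun_apply distrib_left distrib_right mult.assoc)

lemma hom_right_act_weyl_scale:
  "hom_right_act (*) \<phi> (weyl_scale c a) = fun_scale c (hom_right_act (*) \<phi> a)"
  by (simp add: hom_right_act_def fun_scale_def weyl_scale_mult_right fun_eq_iff) (simp add: weyl_scale_def)

lemma hom_right_act_fun_scale:
  "hom_right_act (*) (fun_scale c \<phi>) a = fun_scale c (hom_right_act (*) \<phi> a)"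
  by (simp add: hom_right_act_def fun_scale_def mult.assoc)

text \<open>Successive right multiplications compose in reverse order; the sign on the derivative
  compensates, so that the commutator of derivative and variable keeps its sign.\<close>

fun dual_op :: "('m \<Rightarrow> ('n, 'k::field) weyl \<Rightarrow> 'm) \<Rightarrow> ('n + 'n) gen \<Rightarrow>
    ('m \<Rightarrow> ('n, 'k) weyl) \<Rightarrow> 'm \<Rightarrow> ('n, 'k) weyl" where
  "dual_op r (GenX (Inl i)) \<phi> = hom_left_act r (weyl_x i) \<phi>"
| "dual_op r (GenD (Inl i)) \<phi> = hom_left_act r (weyl_d i) \<phi>"
| "dual_op r (GenX (Inr i)) \<phi> = hom_right_act (*) \<phi> (weyl_x i)"
| "dual_op r (GenD (Inr i)) \<phi> = hom_right_act (*) \<phi> (- weyl_d i)"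

locale full_bimodule = weyl_bimodule UNIV l r
  for l :: "('n::finite, 'k::field_char_0) weyl \<Rightarrow> 'm::ab_group_add \<Rightarrow> 'm"
    and r :: "'m \<Rightarrow> ('n, 'k) weyl \<Rightarrow> 'm"
begin

abbreviation dual :: "('m \<Rightarrow> ('n, 'k) weyl) set" where
  "dual \<equiv> left_hom l (*)"

lemma dual_iff: "\<phi> \<in> dual \<longleftrightarrow> (\<forall>x y. \<phi> (x + y) = \<phi> x + \<phi> y) \<and> (\<forall>a x. \<phi> (l a x) = a * \<phi> x)"
  by (simp add: left_hom_def)

lemma dual_add: "\<phi> \<in> dual \<Longrightarrow> \<psi> \<in> dual \<Longrightarrow> \<phi> + \<psi> \<in> dual"
  unfolding dual_iff by (auto simp: plus_fun_apply distrib_left)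

lemma dual_zero: "0 \<in> dual"
  unfolding dual_iff by (auto simp: zero_fun_apply)

lemma dual_uminus: "\<phi> \<in> dual \<Longrightarrow> - \<phi> \<in> dual"
  unfolding dual_iff by auto

lemma dual_left_act: "\<phi> \<in> dual \<Longrightarrow> hom_left_act r a \<phi> \<in> dual"
  unfolding dual_iff hom_left_act_def by (simp add: right.act_add assoc)

lemma dual_right_act: "\<phi> \<in> dual \<Longrightarrow> hom_right_act (*) \<phi> a \<in> dual"
  unfolding dual_iff hom_right_act_def by (simp add: distrib_right mult.assoc)

lemma dual_at_0: "\<phi> \<in> dual \<Longrightarrow> \<phi> 0 = 0"
  unfolding dual_iff by (metis add_cancel_right_right)

lemma hom_left_act_simps:
  shows "hom_left_act r a (\<phi> + \<psi>) = hom_left_act r a \<phi> + hom_left_act r a (\<psi> :: 'm \<Rightarrow> ('n, 'k) weyl)"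
    and "\<phi> \<in> dual \<Longrightarrow> hom_left_act r (a + b) \<phi> = hom_left_act r a \<phi> + hom_left_act r b \<phi>"
    and "hom_left_act r (a * b) \<phi> = hom_left_act r a (hom_left_act r b \<phi>)"
    and "hom_left_act r 1 \<phi> = \<phi>"
    and "hom_left_act r a (fun_scale c \<phi>) = fun_scale c (hom_left_act r a \<phi>)"
    and "hom_right_act (*) (hom_left_act r a \<phi>) b = hom_left_act r a (hom_right_act (*) \<phi> b)"
  by (simp_all add: hom_left_act_def hom_right_act_def fun_scale_def fun_eq_iff plus_fun_apply
      right.add_act right.mult_act right.one_act dual_iff)

lemma dual_const:
  assumes "\<phi> \<in> dual"
  shows "hom_left_act r (weyl_const c) \<phi> = fun_scale c \<phi>"
    and "hom_right_act (*) \<phi> (weyl_const c) = fun_scale c \<phi>"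
  using assms
  by (simp_all add: hom_left_act_def hom_right_act_def fun_scale_def const_compatible[symmetric]
      dual_iff weyl_const_commute)

lemma right_module_dual: "right_module dual (hom_right_act (*))"
  by standard (simp_all only: dual_zero dual_add dual_uminus dual_right_act hom_right_act_simps)

lemma left_module_dual: "left_module dual (hom_left_act r)"
  by standard (simp_all only: dual_zero dual_add dual_uminus dual_left_act hom_left_act_simps)

lemma weyl_bimodule_dual: "weyl_bimodule dual (hom_left_act r) (hom_right_act (*))"
proof -
  interpret L: left_module dual "hom_left_act r" by (rule left_module_dual)
  interpret R: right_module dual "hom_right_act (*)" by (rule right_module_dual)
  show ?thesis
    by standard (simp_all only: hom_left_act_simps dual_const)
qed

text \<open>The operators \<open>dual_op\<close> satisfy the relations of the enveloping algebra on
  the dual. Prescribing \<open>const_scale act\<close> on all functions lets dimensions be computed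
  in \<open>fun_scale\<close>.\<close>

lemma dual_action_exists:
  obtains act where "enveloping_action dual (hom_left_act r) (hom_right_act (*)) act"
    "const_scale act = fun_scale"
proof -
  interpret V: vector_space "fun_scale :: 'k \<Rightarrow> ('m \<Rightarrow> ('n, 'k) weyl) \<Rightarrow> _"
    by (rule vector_space_fun_scale)
  have sub: "V.subspace dual"
    unfolding V.subspace_def using dual_zero dual_add dual_right_act dual_const(2) by metis
  have commute: "hom_right_act (*) (hom_right_act (*) \<phi> a) b = hom_right_act (*) (hom_right_act (*) \<phi> b) a"
    if "a * b = b * a" for \<phi> :: "'m \<Rightarrow> ('n, 'k) weyl" and a b
    using that by (metis hom_right_act_simps(3))
  have commute_left: "hom_left_act r a (hom_left_act r b \<phi>) = hom_left_act r b (hom_left_act r a \<phi>)"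
    if "a * b = b * a" for \<phi> :: "'m \<Rightarrow> ('n, 'k) weyl" and a b
    using that by (metis hom_left_act_simps(3))
  have d_x: "weyl_d i * weyl_x j = weyl_x j * weyl_d i + (if i = j then 1 else 0 :: ('n, 'k) weyl)" for i j :: 'n
    using weyl_d_x[of i j] by (simp add: diff_eq_eq add.commute)
  have zero_left: "hom_left_act r 0 \<phi> = 0" if "\<phi> \<in> dual" for \<phi>
    using dual_const(1)[OF that, of 0] by (simp add: fun_scale_def fun_eq_iff zero_fun_apply)
  obtain act :: "('n + 'n, 'k) weyl \<Rightarrow> _" where act: "left_module dual act" "const_scale act = fun_scale"
    "\<And>i \<phi>. \<phi> \<in> dual \<Longrightarrow> act (weyl_x i) \<phi> = dual_op r (GenX i) \<phi>"
    "\<And>i \<phi>. \<phi> \<in> dual \<Longrightarrow> act (weyl_d i) \<phi> = dual_op r (GenD i) \<phi>"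
  proof (rule weyl_action_exists[OF vector_space_fun_scale sub, of "dual_op r"])
    fix g :: "('n + 'n) gen" and \<phi> \<psi> :: "'m \<Rightarrow> ('n, 'k) weyl" and c
    assume \<phi>: "\<phi> \<in> dual"
    show "dual_op r g \<phi> \<in> dual"
      using \<phi> by (cases "(r, g, \<phi>)" rule: dual_op.cases) (simp_all add: dual_left_act dual_right_act)
    show "dual_op r g (fun_scale c \<phi>) = fun_scale c (dual_op r g \<phi>)"
      by (cases "(r, g, \<phi>)" rule: dual_op.cases)
        (simp_all add: hom_left_act_simps hom_right_act_fun_scale)
    show "dual_op r g (\<phi> + \<psi>) = dual_op r g \<phi> + dual_op r g \<psi>"
      by (cases "(r, g, \<phi>)" rule: dual_op.cases)
        (auto simp only: prod.inject dual_op.simps hom_left_act_simps hom_right_act_simps(1))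
  next
    fix i j :: "'n + 'n" and \<phi> :: "'m \<Rightarrow> ('n, 'k) weyl"
    assume \<phi>: "\<phi> \<in> dual"
    show "dual_op r (GenX i) (dual_op r (GenX j) \<phi>) = dual_op r (GenX j) (dual_op r (GenX i) \<phi>)"
      by (cases i; cases j)
        (simp_all only: dual_op.simps hom_left_act_simps(6) commute commute_left weyl_x_commute)
    show "dual_op r (GenD i) (dual_op r (GenD j) \<phi>) = dual_op r (GenD j) (dual_op r (GenD i) \<phi>)"
      by (cases i; cases j)
        (simp_all only: dual_op.simps hom_left_act_simps(6) commute commute_left weyl_d_commute
          minus_mult_minus)
    show "dual_op r (GenD i) (dual_op r (GenX j) \<phi>)
        = dual_op r (GenX j) (dual_op r (GenD i) \<phi>) + (if i = j then \<phi> else 0)"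
    proof (cases i)
      case i: (Inl i')
      show ?thesis
      proof (cases j)
        case j: (Inl j')
        show ?thesis
          using \<phi> zero_left[OF \<phi>]
          by (simp add: i j hom_left_act_simps(3)[symmetric] d_x hom_left_act_simps(2)[OF \<phi>]
              hom_left_act_simps(4))
      qed (simp add: i hom_left_act_simps(6))
    next
      case i: (Inr i')
      show ?thesis
      proof (cases j)
        case j: (Inr j')
        have "weyl_x j' * - weyl_d i' = - weyl_d i' * weyl_x j' + (if i' = j' then 1 else 0 :: ('n, 'k) weyl)"
          using d_x[of i' j'] by simp
        then have "hom_right_act (*) \<phi> (weyl_x j' * - weyl_d i') = hom_right_act (*) \<phi> (- weyl_d i' * weyl_x j')
            + hom_right_act (*) \<phi> (if i' = j' then 1 else 0)"
          by (simp only: hom_right_act_simps(2))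
        then show ?thesis
          by (simp add: i j hom_right_act_simps(3)[symmetric]) (simp add: hom_right_act_simps)
      qed (simp add: i hom_left_act_simps(6))
    qed
  qed blast
  have "act (weyl_const c) \<phi> = hom_left_act r (weyl_const c) \<phi>" if "\<phi> \<in> dual" for c \<phi>
    using fun_cong[OF fun_cong[OF act(2)], of c \<phi>] dual_const(1)[OF that] by (simp add: const_scale_def)
  then have "enveloping_action dual (hom_left_act r) (hom_right_act (*)) act"
    unfolding enveloping_action_def
    using act by (simp add: hom_right_act_simps(7))
  then show ?thesis using act(2) that by blast
qed

end

lemma right_act_span:
  fixes A B :: "('m \<Rightarrow> ('n, 'k::field) weyl) set"
  assumes "\<phi> \<in> module.span fun_scale A"
    and "\<And>f. f \<in> A \<Longrightarrow> hom_right_act (*) f b \<in> module.span fun_scale B"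
  shows "hom_right_act (*) \<phi> b \<in> module.span fun_scale B"
proof -
  interpret V: vector_space "fun_scale :: 'k \<Rightarrow> ('m \<Rightarrow> ('n, 'k) weyl) \<Rightarrow> _"
    by (rule vector_space_fun_scale)
  from assms(1) show ?thesis
    by (induction rule: V.span_induct_alt)
      (simp_all add: hom_right_act_simps hom_right_act_fun_scale V.span_zero V.span_add V.span_scale assms(2))
qed

section \<open>Growth of the dual under the enveloping action\<close>

context full_bimodule
begin

lemma right_generates_dual:
  assumes "finite F" "F \<subseteq> dual" "dual \<subseteq> right_span F"
  shows "right_generates dual (hom_right_act (*)) F"
proof -
  interpret R: right_module dual "hom_right_act (*)" by (rule right_module_dual)
  have sum_mem: "sum g P \<in> dual" if "\<And>p. p \<in> P \<Longrightarrow> g p \<in> dual" for g and P :: "('m \<Rightarrow> ('n, 'k) weyl) set"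
    using that by (induction P rule: infinite_finite_induct) (simp_all add: dual_zero dual_add)
  have "right_span F \<subseteq> dual"
    unfolding right_span_def using assms(2) dual_right_act by (auto intro!: sum_mem)
  with assms show ?thesis
    unfolding right_generates_def right_span_def by blast
qed

lemma holonomic_dual:
  assumes F: "finite F" "F \<subseteq> dual" "dual \<subseteq> right_span F"
    and act: "enveloping_action dual (hom_left_act r) (hom_right_act (*)) act"
      "const_scale act = fun_scale"
  shows "holonomic dual act"
proof -
  have "left_module dual act"
    using act(1) by (simp add: enveloping_action_def)
  then interpret D: weyl_module dual act
    unfolding weyl_module_def act(2) using vector_space_fun_scale by blast

  let ?N = "CARD('n + 'n)"
  have act_simps: "act (weyl_x (Inl i)) \<phi> = hom_left_act r (weyl_x i) \<phi>"
    "act (weyl_d (Inl i)) \<phi> = hom_left_act r (weyl_d i) \<phi>"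
    "act (weyl_x (Inr i)) \<phi> = hom_right_act (*) \<phi> (weyl_x i)"
    "act (weyl_d (Inr i)) \<phi> = - hom_right_act (*) \<phi> (weyl_d i)" if "\<phi> \<in> dual" for i \<phi>
    using act(1) that by (simp_all add: enveloping_action_def)
  \<comment> \<open>\<open>e k\<close> acts as right multiplication by \<open>wgen k\<close>; its
    sign undoes the one in the action of the right derivatives.\<close>
  define e :: "'n + 'n \<Rightarrow> ('n + 'n, 'k) weyl" where
    "e = case_sum (\<lambda>i. weyl_x (Inr i)) (\<lambda>i. - weyl_d (Inr i))"
  have right_wgen: "hom_right_act (*) \<phi> (wgen k) = act (e k) \<phi>" if "\<phi> \<in> dual" for k \<phi>
    using that by (cases k) (simp_all add: e_def act_simps D.act_uminus)
  \<comment> \<open>Every right multiplication is an operator of the enveloping algebra, with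
    products reversed. Hence right generators of the dual also generate it over that
    algebra.\<close>
  have right_as_left: "\<exists>\<beta>. \<forall>\<phi>\<in>dual. hom_right_act (*) \<phi> a = act \<beta> \<phi>" for a
  proof (induction a rule: weyl_induct)
    case one
    show ?case by (intro exI[of _ 1]) (simp add: hom_right_act_simps(4) D.one_act)
  next
    case (gen a k)
    then obtain \<beta> where \<beta>: "\<And>\<phi>. \<phi> \<in> dual \<Longrightarrow> hom_right_act (*) \<phi> a = act \<beta> \<phi>" by blast
    have "hom_right_act (*) \<phi> (wgen k * a) = act (\<beta> * e k) \<phi>" if "\<phi> \<in> dual" for \<phi>
      by (simp only: hom_right_act_simps(3) right_wgen[OF that] \<beta>[OF D.act_mem[OF that]] D.mult_act[OF that])
    then show ?case by blast
  next
    case (scale a c)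
    then obtain \<beta> where \<beta>: "\<And>\<phi>. \<phi> \<in> dual \<Longrightarrow> hom_right_act (*) \<phi> a = act \<beta> \<phi>" by blast
    have "hom_right_act (*) \<phi> (weyl_scale c a) = act (weyl_scale c \<beta>) \<phi>" if "\<phi> \<in> dual" for \<phi>
      by (simp only: hom_right_act_weyl_scale \<beta>[OF that] D.act_weyl_scale[OF that] act(2))
    then show ?case by blast
  next
    case (add a b)
    then obtain \<beta> \<beta>' where \<beta>: "\<And>\<phi>. \<phi> \<in> dual \<Longrightarrow> hom_right_act (*) \<phi> a = act \<beta> \<phi>"
      "\<And>\<phi>. \<phi> \<in> dual \<Longrightarrow> hom_right_act (*) \<phi> b = act \<beta>' \<phi>" by blast
    have "hom_right_act (*) \<phi> (a + b) = act (\<beta> + \<beta>') \<phi>" if "\<phi> \<in> dual" for \<phi>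
      by (simp only: hom_right_act_simps(2) \<beta>[OF that] D.add_act[OF that])
    then show ?case by blast
  qed
  have gen: "left_generates dual act F"
    unfolding left_generates_def
  proof (intro conjI equalityI subsetI F(1,2))
    fix \<phi> assume "\<phi> \<in> dual"
    then obtain b where b: "\<phi> = (\<Sum>f\<in>F. hom_right_act (*) f (b f))"
      using F(3) unfolding right_span_def by blast
    have "\<forall>a. \<exists>\<beta>. \<forall>\<phi>\<in>dual. hom_right_act (*) \<phi> a = act \<beta> \<phi>"
      using right_as_left by blast
    from choice[OF this] obtain \<beta> where \<beta>: "\<And>a \<phi>. \<phi> \<in> dual \<Longrightarrow> hom_right_act (*) \<phi> a = act (\<beta> a) \<phi>"
      by blast
    have "\<phi> = (\<Sum>f\<in>F. act (\<beta> (b f)) f)"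
      unfolding b by (rule sum.cong) (use \<beta> F(2) in auto)
    then show "\<phi> \<in> {\<Sum>m\<in>F. act (a m) m | a. True}"
      by (intro CollectI exI[of _ "\<lambda>f. \<beta> (b f)"]) simp
  next
    fix \<phi> assume "\<phi> \<in> {\<Sum>m\<in>F. act (a m) m | a. True}"
    then obtain a where "\<phi> = (\<Sum>m\<in>F. act (a m) m)" by blast
    moreover have "(\<Sum>m\<in>F. act (a m) m) \<in> dual"
      by (rule D.sum_mem, rule D.act_mem) (use F(2) in blast)
    ultimately show "\<phi> \<in> dual" by simp
  qed (use F(2) in blast)

  \<comment> \<open>\<open>G i\<close> collects the multiples of \<open>F\<close> by elements of
    degree at most \<open>i\<close> on the right; \<open>gamma act F\<close> is measured against
    it.\<close>
  define A where "A i = (\<lambda>(f, \<gamma>). hom_right_act (*) f (wmon \<gamma>)) ` (F \<times> {\<gamma> :: 'n + 'n \<Rightarrow> nat. edeg \<gamma> \<le> i})" for i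
  define G where "G i = D.vs.span (A i)" for i
  have G_mono: "G i \<subseteq> G j" if "i \<le> j" for i j
    unfolding G_def by (rule D.vs.span_mono) (use that in \<open>auto simp: A_def\<close>)
  have A_dual: "A i \<subseteq> dual" for i
    using F(2) by (auto simp: A_def intro!: dual_right_act)
  have G_base: "hom_right_act (*) f b \<in> G i" if "f \<in> F" "b \<in> bernstein i" for f b i
    using that(2) unfolding bernstein_eq
  proof (induction rule: weyl.span_induct_alt)
    case base
    show ?case by (simp add: hom_right_act_simps G_def D.vs.span_zero)
  next
    case (step c a b)
    then have "hom_right_act (*) f a \<in> G i"
      using that(1) unfolding G_def A_def by (intro D.vs.span_base) auto
    with step show ?case
      unfolding G_def
      by (simp only: hom_right_act_simps(2) hom_right_act_weyl_scale act(2)[symmetric] D.vs.span_add D.vs.span_scale)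
  qed
  have G_right: "hom_right_act (*) \<phi> b \<in> G (i + j)" if "\<phi> \<in> G i" "b \<in> bernstein j" for \<phi> b i j
    unfolding G_def act(2)
  proof (rule right_act_span[OF that(1)[unfolded G_def act(2)]])
    fix f assume "f \<in> A i"
    then obtain f' \<gamma> where f: "f = hom_right_act (*) f' (wmon \<gamma>)" "f' \<in> F" "edeg \<gamma> \<le> i"
      by (auto simp: A_def)
    then have "wmon \<gamma> * b \<in> bernstein (i + j)"
      using that(2) by (intro bernstein_mult wmon_bernstein)
    then have "hom_right_act (*) f' (wmon \<gamma> * b) \<in> G (i + j)"
      by (rule G_base[OF f(2)])
    then show "hom_right_act (*) f b \<in> module.span fun_scale (A (i + j))"
      by (simp only: f(1) hom_right_act_simps(3) G_def act(2))
  qed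
  have ex_G: "\<exists>i. \<phi> \<in> G i" if \<phi>: "\<phi> \<in> dual" for \<phi>
  proof -
    obtain b where b: "\<phi> = (\<Sum>f\<in>F. hom_right_act (*) f (b f))"
      using F(3) \<phi> unfolding right_span_def by blast
    have "\<forall>f. \<exists>d. b f \<in> bernstein d"
      using ex_bernstein by blast
    from choice[OF this] obtain d where d: "\<And>f. b f \<in> bernstein (d f)" by blast
    have "hom_right_act (*) f (b f) \<in> G (Max (insert 0 (d ` F)))" if "f \<in> F" for f
      using G_base[OF that d] G_mono[of "d f" "Max (insert 0 (d ` F))"] F(1) that by auto
    then have "\<phi> \<in> G (Max (insert 0 (d ` F)))"
      unfolding b G_def by (rule D.vs.span_sum)
    then show ?thesis by blast
  qed
  \<comment> \<open>Finitely many generators act on finitely many elements of \<open>F\<close>, so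
    one level suffices. The bound \<open>1 \<le> C\<close> leaves room for a right multiplication,
    which raises the level by 1.\<close>
  obtain C where C: "1 \<le> C" "\<And>k f. f \<in> F \<Longrightarrow> act (wgen k) f \<in> G C"
  proof -
    have "\<forall>p\<in>UNIV \<times> F. \<exists>i. act (wgen (fst p)) (snd p) \<in> G i"
      using ex_G D.act_mem F(2) by auto
    from bchoice[OF this] obtain d where d: "\<And>p. p \<in> UNIV \<times> F \<Longrightarrow> act (wgen (fst p)) (snd p) \<in> G (d p)"
      by blast
    let ?C = "Max (insert 1 (d ` (UNIV \<times> F)))"
    have fin: "finite (insert 1 (d ` (UNIV \<times> F)))" using F(1) by simp
    have "act (wgen k) f \<in> G ?C" if "f \<in> F" for k f
    proof -
      have "d (k, f) \<le> ?C" by (rule Max_ge[OF fin]) (use that in auto)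
      then show ?thesis using d[of "(k, f)"] G_mono that by auto
    qed
    moreover have "1 \<le> ?C" by (rule Max_ge[OF fin]) simp
    ultimately show ?thesis using that by blast
  qed
  \<comment> \<open>Left operators pass by the right factor and act on \<open>F\<close>, where
    \<open>C\<close> controls them; right operators lengthen the right factor by one
    generator.\<close>
  have G_act: "act (wgen k) \<phi> \<in> G (C + i)" if "\<phi> \<in> G i" for k \<phi> i
  proof -
    have A_act: "act (wgen k) f \<in> G (C + i)" if fA: "f \<in> A i" for f
    proof -
      obtain f' \<gamma> where f: "f = hom_right_act (*) f' (wmon \<gamma>)" "f' \<in> F" "edeg \<gamma> \<le> i"
        using fA by (auto simp: A_def)
      have f': "f' \<in> dual" "f \<in> dual" using f F(2) dual_right_act by auto
      have right: "hom_right_act (*) f (wgen j) \<in> G (C + i)" for j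
      proof -
        have "wmon \<gamma> * wgen j \<in> bernstein (Suc i)"
          unfolding bernstein_weyl_less
          by (rule weyl_less_wgen[OF wmon_weyl_less]) (use f(3) in simp)
        then have "hom_right_act (*) f' (wmon \<gamma> * wgen j) \<in> G (Suc i)"
          by (rule G_base[OF f(2)])
        moreover have "G (Suc i) \<subseteq> G (C + i)"
          using C(1) by (intro G_mono) simp
        ultimately show ?thesis unfolding f(1) hom_right_act_simps(3) by blast
      qed
      have left: "hom_right_act (*) (act (wgen k) f') (wmon \<gamma>) \<in> G (C + i)"
        by (rule G_right[OF C(2)[OF f(2)]]) (rule wmon_bernstein[OF f(3)])
      consider j where "k = Inl (Inl j)" | j where "k = Inr (Inl j)"
        | j where "k = Inl (Inr j)" | j where "k = Inr (Inr j)"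
        by (metis sum.exhaust)
      then show ?thesis
      proof cases
        case 1
        then show ?thesis
          using left by (simp add: act_simps[OF f'(1)] act_simps[OF f'(2)] hom_left_act_simps(6) f(1)[symmetric])
      next
        case 2
        then show ?thesis
          using left by (simp add: act_simps[OF f'(1)] act_simps[OF f'(2)] hom_left_act_simps(6) f(1)[symmetric])
      next
        case 3
        then show ?thesis
          using right[of "Inl j"] by (simp add: act_simps[OF f'(2)])
      next
        case 4
        have "- hom_right_act (*) f (weyl_d j) \<in> G (C + i)"
          using right[of "Inr j"] D.vs.span_neg unfolding G_def by auto
        with 4 show ?thesis by (simp add: act_simps[OF f'(2)])
      qed
    qed
    \<comment> \<open>\<open>act\<close> is additive only on the dual, so membership is part of the
      induction.\<close>
    have "\<phi> \<in> dual \<and> act (wgen k) \<phi> \<in> G (C + i)"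
      using \<open>\<phi> \<in> G i\<close> unfolding G_def[of i]
    proof (induction rule: D.vs.span_induct_alt)
      case base
      show ?case by (simp add: D.act_zero_right dual_zero G_def D.vs.span_zero)
    next
      case (step c f \<psi>)
      have f: "f \<in> dual" "act (wgen k) f \<in> G (C + i)"
        using step.hyps A_dual A_act by blast+
      have "act (wgen k) (const_scale act c f + \<psi>) = const_scale act c (act (wgen k) f) + act (wgen k) \<psi>"
        using f step.IH by (simp only: D.act_add D.const_scale_mem D.act_const_scale)
      then show ?case
        using f step.IH unfolding G_def
        by (simp only: dual_add D.const_scale_mem D.vs.span_add D.vs.span_scale)
    qed
    then show ?thesis by simp
  qed
  \<comment> \<open>Starting from level 0, each generator in a monomial costs one shift by
    \<open>C\<close>.\<close>
  have gamma_G: "gamma act F i \<subseteq> G (i * C)" for i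
  proof -
    have "act (wmon \<gamma>) f \<in> G (edeg \<gamma> * C)" if f: "f \<in> F" for f and \<gamma>
    proof (induction \<gamma> rule: wmon_induct_left[where 'n = "'n + 'n" and 'k = 'k])
      case zero
      have "hom_right_act (*) f 1 \<in> G 0"
        using G_base[OF f, of "wmon 0" 0] wmon_bernstein[of 0 0] by simp
      then show ?case using f F(2) by (auto simp: D.one_act hom_right_act_simps)
    next
      case (add \<gamma> k)
      have "act (wgen k) (act (wmon \<gamma>) f) \<in> G (C + edeg \<gamma> * C)"
        by (rule G_act[OF add(1)])
      moreover have "act (wmon (\<gamma> + eunit k)) f = act (wgen k) (act (wmon \<gamma>) f)"
        unfolding add(2) using f F(2) by (intro D.mult_act) blast
      ultimately show ?case by (simp only: edeg_add edeg_eunit) simp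
    qed
    moreover have "G (edeg \<gamma> * C) \<subseteq> G (i * C)" if "edeg \<gamma> \<le> i" for \<gamma> :: "('n + 'n) + ('n + 'n) \<Rightarrow> nat"
      using that by (intro G_mono mult_right_mono) simp_all
    ultimately have "D.gamma_family F i \<subseteq> G (i * C)"
      unfolding D.gamma_family_def by blast
    then show ?thesis
      unfolding D.gamma_eq_span[OF F(1,2)] G_def using D.vs.span_minimal[OF _ D.vs.subspace_span] by blast
  qed
  have upper: "D.vs.dim (gamma act F i) \<le> card F * ((i * C + ?N) choose ?N)" for i
  proof -
    have "finite (A (i * C))" using F(1) by (simp add: A_def)
    then have "D.vs.dim (gamma act F i) \<le> card (A (i * C))"
      using gamma_G unfolding G_def by (intro D.vs.dim_le_card)
    also have "\<dots> \<le> card (F \<times> {\<gamma> :: 'n + 'n \<Rightarrow> nat. edeg \<gamma> \<le> i * C})"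
      unfolding A_def using F(1) by (intro card_image_le) simp
    finally show ?thesis by (simp add: card_cartesian_product card_edeg_le)
  qed
  obtain p where p: "has_hilbert_poly act F p"
    using D.ex_has_hilbert_poly[OF F(1,2)] .
  then have p_eq: "\<forall>\<^sub>F i in sequentially. poly p (of_nat i) = of_nat (D.vs.dim (gamma act F i))"
    by (simp add: has_hilbert_poly_def eq_commute)
  have "degree p = ?N" if nonzero: "dual \<noteq> {0}"
  proof -
    \<comment> \<open>Taking the nonzero element from \<open>F\<close> places it in degree 0 of the
      filtration.\<close>
    obtain f where f: "f \<in> F" "f \<noteq> 0"
    proof (rule ccontr)
      assume "\<not> thesis"
      then have "F \<subseteq> {0}" using that by blast
      have "\<phi> = 0" if \<phi>: "\<phi> \<in> dual" for \<phi>
      proof -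
        obtain b where b: "\<phi> = (\<Sum>f\<in>F. hom_right_act (*) f (b f))"
          using F(3) \<phi> unfolding right_span_def by blast
        show ?thesis
          unfolding b by (rule sum.neutral) (use \<open>F \<subseteq> {0}\<close> hom_right_act_simps(6) in blast)
      qed
      then show False using nonzero dual_zero by blast
    qed
    have f_dual: "f \<in> dual" using f(1) F(2) by blast
    have gamma_dual: "gamma act F i \<subseteq> dual" for i
      unfolding gamma_def using F(2) D.act_mem by (auto intro!: D.sum_mem)
    \<comment> \<open>A right multiplication by a generator is \<open>act (e k)\<close> with
      \<open>e k\<close> of degree at most 1, so it costs at most one step of the
      filtration.\<close>
    have right_gamma: "hom_right_act (*) f (wmon \<gamma>) \<in> gamma act F (edeg \<gamma>)" for \<gamma>
    proof (induction \<gamma> rule: wmon_induct_right[where 'n = 'n and 'k = 'k])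
      case zero
      have "act (wmon 0) f \<in> gamma act F 0"
        unfolding D.gamma_eq_span[OF F(1,2)]
        unfolding D.gamma_family_def
        by (intro D.vs.span_base CollectI exI[of _ 0] exI[of _ f]) (simp add: f(1))
      then show ?case using f_dual by (simp add: D.one_act hom_right_act_simps)
    next
      case (add \<gamma> k)
      have mem: "hom_right_act (*) f (wmon \<gamma>) \<in> dual"
        using f_dual by (rule dual_right_act)
      have "e k \<in> bernstein 1"
      proof (cases k)
        case (Inl i)
        have "(wgen (Inl (Inr i)) * wmon 0 :: ('n + 'n, 'k) weyl) \<in> bernstein 1"
          unfolding bernstein_weyl_less by (intro wgen_weyl_less wmon_weyl_less) simp
        then show ?thesis by (simp add: e_def Inl)
      next
        case (Inr i)
        have "(wgen (Inr (Inr i)) * wmon 0 :: ('n + 'n, 'k) weyl) \<in> bernstein 1"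
          unfolding bernstein_weyl_less by (intro wgen_weyl_less wmon_weyl_less) simp
        then have "- weyl_d (Inr i) \<in> (bernstein 1 :: ('n + 'n, 'k) weyl set)"
          using weyl.subspace_neg[OF subspace_bernstein] by auto
        then show ?thesis by (simp add: e_def Inr)
      qed
      then have "act (e k) (hom_right_act (*) f (wmon \<gamma>)) \<in> gamma act F (1 + edeg \<gamma>)"
        using add(1) by (intro D.gamma_act[OF F(2)])
      then show ?case
        by (simp only: add(2) hom_right_act_simps(3) right_wgen[OF mem] edeg_add edeg_eunit add.commute)
    qed
    have lower: "(i + ?N) choose ?N \<le> D.vs.dim (gamma act F i)" for i
    proof -
      let ?P = "{\<gamma> :: 'n + 'n \<Rightarrow> nat. edeg \<gamma> \<le> i}"
      let ?v = "\<lambda>\<gamma>. hom_right_act (*) f (wmon \<gamma>)"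
      have "\<forall>\<gamma>\<in>?P. c \<gamma> = 0" if sum: "(\<Sum>\<gamma>\<in>?P. const_scale act (c \<gamma>) (?v \<gamma>)) = 0" for c
      proof -
        \<comment> \<open>Evaluation at this point turns a relation among multiples of
          \<open>f\<close> into one in the algebra, where \<open>f x\<close> can be
          cancelled.\<close>
        obtain x where x: "f x \<noteq> 0"
          using f(2) by (auto simp: fun_eq_iff zero_fun_apply)
        have "(\<Sum>\<gamma>\<in>P. const_scale act (c \<gamma>) (?v \<gamma>)) x = f x * (\<Sum>\<gamma>\<in>P. weyl_scale (c \<gamma>) (wmon \<gamma>))" for P
          by (induction P rule: infinite_finite_induct)
            (simp_all add: act(2) fun_scale_def hom_right_act_def plus_fun_apply zero_fun_apply
              distrib_left weyl_scale_mult_right, simp_all add: weyl_scale_def)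
        from this[of ?P] sum have "f x * (\<Sum>\<gamma>\<in>?P. weyl_scale (c \<gamma>) (wmon \<gamma>)) = 0"
          by (simp add: zero_fun_apply)
        then have "(\<Sum>\<gamma>\<in>?P. weyl_scale (c \<gamma>) (wmon \<gamma>)) = 0"
          using x weyl_no_zero_divisors by blast
        then show ?thesis by (intro wmon_family_independent) simp_all
      qed
      moreover have "?v ` ?P \<subseteq> D.vs.span (D.gamma_family F i)"
      proof clarify
        fix \<gamma> :: "'n + 'n \<Rightarrow> nat" assume "edeg \<gamma> \<le> i"
        then show "?v \<gamma> \<in> D.vs.span (D.gamma_family F i)"
          using right_gamma[of \<gamma>] D.gamma_mono[of "edeg \<gamma>" i F] D.gamma_eq_span[OF F(1,2)] by blast
      qed
      ultimately have "card ?P \<le> D.vs.dim (D.gamma_family F i)"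
        using D.finite_gamma_family[OF F(1)] by (intro D.vs.family_card_le_dim) auto
      then show ?thesis
        by (simp add: D.gamma_eq_span[OF F(1,2)] D.vs.dim_span card_edeg_le)
    qed
    \<comment> \<open>The lower constant comes from \<open>power_le_binomial\<close>, the upper one
      from \<open>binomial_le_power\<close> at \<open>i * C\<close>.\<close>
    show ?thesis
    proof (rule degree_eq_growth)
      show "0 < (1 / fact ?N :: rat)" by simp
      show "\<forall>\<^sub>F i in sequentially. (1 / fact ?N) * of_nat i ^ ?N \<le> poly p (of_nat i)"
        using p_eq
      proof eventually_elim
        case (elim i)
        have "i ^ ?N \<le> fact ?N * D.vs.dim (gamma act F i)"
          using power_le_binomial[of i ?N] lower[of i] by (meson le_trans mult_le_mono2)
        then have "(of_nat (i ^ ?N) :: rat) \<le> of_nat (fact ?N * D.vs.dim (gamma act F i))"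
          by (rule of_nat_mono)
        then have "(of_nat i ^ ?N :: rat) \<le> fact ?N * poly p (of_nat i)"
          by (simp add: elim)
        then show ?case by (simp add: divide_le_eq mult.commute)
      qed
      show "\<forall>\<^sub>F i in sequentially.
          poly p (of_nat i) \<le> of_nat (card F * (Suc ?N * C) ^ ?N) * of_nat i ^ ?N"
        using p_eq eventually_ge_at_top[of 1]
      proof eventually_elim
        case (elim i)
        have "1 \<le> i * C" using elim(2) C(1) by simp
        then have "(i * C + ?N) choose ?N \<le> (Suc ?N * (i * C)) ^ ?N"
          by (rule binomial_le_power)
        then have "D.vs.dim (gamma act F i) \<le> card F * (Suc ?N * (i * C)) ^ ?N"
          using upper[of i] by (meson le_trans mult_le_mono2)
        also have "\<dots> = card F * (Suc ?N * C) ^ ?N * i ^ ?N"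
          by (simp only: power_mult_distrib ac_simps)
        finally have "(of_nat (D.vs.dim (gamma act F i)) :: rat)
            \<le> of_nat (card F * (Suc ?N * C) ^ ?N * i ^ ?N)"
          by (rule of_nat_mono)
        also have "\<dots> = of_nat (card F * (Suc ?N * C) ^ ?N) * of_nat i ^ ?N"
          by (simp only: of_nat_mult of_nat_power)
        finally show ?case unfolding elim(1) .
      qed
    qed
  qed
  then show ?thesis
    unfolding holonomic_def left_finitely_generated_def has_weyl_dim_def
    using D.left_module_axioms gen p by blast
qed

end

theorem theorem2p5:
  fixes l :: "('n::finite, 'k::field_char_0) weyl \<Rightarrow> 'm::ab_group_add \<Rightarrow> 'm"
    and r :: "'m \<Rightarrow> ('n, 'k) weyl \<Rightarrow> 'm"
  assumes "holonomic_bimodule UNIV l r"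
  shows "right_finitely_generated (left_hom l (*)) (hom_right_act (*))
    \<and> holonomic_bimodule (left_hom l (*)) (hom_left_act r) (hom_right_act (*))"
proof -
  obtain act where bim: "weyl_bimodule UNIV l r" and env: "enveloping_action UNIV l r act"
    and hol: "holonomic UNIV act"
    using assms by (auto simp: holonomic_bimodule_def)
  interpret full_bimodule l r
    by (rule full_bimodule.intro[OF bim])
  have module: "left_module UNIV act"
    using env by (simp add: enveloping_action_def)
  interpret E: left_module UNIV act by (rule module)
  have "vector_space (const_scale act)"
    by standard (simp_all add: const_scale_def E.act_add E.add_act E.mult_act E.one_act)
  then interpret enveloped_bimodule l r act
    by (intro enveloped_bimodule.intro weyl_module.intro enveloped_bimodule_axioms.intro bim module env)
  \<comment> \<open>For the zero bimodule \<open>holonomic\<close> supplies no Hilbert polynomial,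
    but every homomorphism vanishes and the empty set determines it.\<close>
  obtain T where T: "finite T" "\<And>\<phi>. \<phi> \<in> dual \<Longrightarrow> (\<And>t. t \<in> T \<Longrightarrow> \<phi> t = 0) \<Longrightarrow> \<phi> = 0"
  proof (cases "(UNIV :: 'm set) = {0}")
    case True
    have "\<phi> = 0" if "\<phi> \<in> dual" for \<phi>
    proof
      fix x :: 'm
      have "x = 0" using True by blast
      then show "\<phi> x = 0 x" using dual_at_0[OF that] by (simp add: zero_fun_apply)
    qed
    then show ?thesis using that[of "{}"] by blast
  next
    case False
    then obtain S p where "left_generates UNIV act S" "has_hilbert_poly act S p" "degree p = CARD('n + 'n)"
      using hol by (auto simp: holonomic_def has_weyl_dim_def)
    then obtain B where "\<And>T. left_independent T \<Longrightarrow> card T \<le> B"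
      by (metis left_independent_bound)
    then show ?thesis
      using that by (metis left_hom_determined_by_finite)
  qed
  obtain F where F: "finite F" "F \<subseteq> dual" "dual \<subseteq> right_span F"
    using right_submodule_finitely_generated[OF T(1) dual_add dual_right_act T(2)] by metis
  obtain act' where act': "enveloping_action dual (hom_left_act r) (hom_right_act (*)) act'"
    "const_scale act' = fun_scale"
    using dual_action_exists by blast
  have "right_finitely_generated dual (hom_right_act (*))"
    unfolding right_finitely_generated_def
    using right_module_dual right_generates_dual[OF F] by blast
  moreover have "holonomic_bimodule dual (hom_left_act r) (hom_right_act (*))"
    unfolding holonomic_bimodule_def
    using weyl_bimodule_dual act'(1) holonomic_dual[OF F act'] by blast
  ultimately show ?thesis by blast
qed

end
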